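(* Let $L/K$ be a Galois extension of number fields with Galois group $G$, let $f \in \mathbf{R}_{L/K}$, and let $S \in \mathscr{S}$, where $\mathscr{S}$ is the collection of subsets of $G$ attached to $f$ defined in the context. If the class number of $K$ is one, then the element $\theta_f(S)=\sum_{\sigma \in S}\sigma \in \mathbb{Z}[G]$ annihilates the class group of $L$; that is, for every non-zero ideal $\mathfrak{a}$ of $L$ the ideal $\theta_f(S)(\mathfrak{a})$ is principal.
   Context: The group ring $\mathbb{Z}[G]$ acts on the non-zero (integral or fractional) ideals of $L$: for $\theta=\sum_{\sigma\in G} n_\sigma\sigma$, put $\theta(\mathfrak{a})=\prod_{\sigma\in G}\sigma(\mathfrak{a})^{n_\sigma}$. For a prime ideal $\wp$ of $L$ lying above a prime $\mathfrak{p}$ of $K$, the residue degree of $\wp$ (for $L/K$) is $[\mathcal{O}_L/\wp:\mathcal{O}_K/\mathfrak{p}]$. Let $C\ell(L)$ be the class group of $L$. Define $$\mathbf{R}_{L/K}=\{f\in\mathbb{N}: C\ell(L)\text{ is generated by the classes of prime ideals of } L \text{ that are unramified over } K \text{ and have residue degree } f \text{ for } L/K\}.$$ For $f\in\mathbf{R}_{L/K}$, let $H_f^1,\dots,H_f^r$ be all the cyclic subgroups of $G$ of order $f$, and put $H=\bigcap_{i=1}^r H_f^i$. For each $i$, let $\mathscr{S}_i$ be the collection of all subsets $S_i\subseteq G$ such that (i) $S_i$ is a complete set of (left) coset representatives of $H$ in $G$, and (ii) $S_i$ is a product $T_iT_i'=\{tt' : t\in T_i, t'\in T_i'\}$, where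 $T_i$ is a complete set of (left) coset representatives of $H_f^i$ in $G$ and $T_i'$ is a complete set of (left) coset representatives of $H$ in $H_f^i$. Put $\mathscr{S}=\bigcap_{i=1}^r\mathscr{S}_i$. *)

theory Defs
  imports
    "HOL-Algebra.Algebra"
    "HOL-Algebra.Algebraic_Closure_Type"
begin

section \<open>Number fields\<close>

text \<open>
  Number fields are subfields of an arbitrary ambient field of characteristic 0 (for instance the
  complex numbers), so that an extension of number fields is an inclusion of subfields.
\<close>

abbreviation ambient :: "'a::field_char_0 ring" where
  "ambient \<equiv> ring_of_type_algebra"

definition field_ring :: "'a::field_char_0 set \<Rightarrow> 'a ring" where
  "field_ring F = ambient\<lparr>carrier := F\<rparr>"

definition number_field :: "'a::field_char_0 set \<Rightarrow> bool" where
  "number_field F \<longleftrightarrow> subfield F ambient \<and> ring.finite_dimension ambient \<rat> F"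

definition ring_of_integers :: "'a::field_char_0 set \<Rightarrow> 'a ring" where
  "ring_of_integers F = ambient\<lparr>carrier := {x \<in> F. algebraic_int x}\<rparr>"

text \<open>
  Automorphisms are taken to be extensional functions on \<open>L\<close>, as in \<^const>\<open>BijGroup\<close>, so
  that distinct elements of the Galois group are distinct automorphisms.
\<close>

definition Gal :: "'a::field_char_0 set \<Rightarrow> 'a set \<Rightarrow> ('a \<Rightarrow> 'a) monoid" where
  "Gal K L = (BijGroup L)\<lparr>carrier :=
     {\<sigma> \<in> Bij L. \<sigma> \<in> ring_hom (field_ring L) (field_ring L) \<and> (\<forall>x\<in>K. \<sigma> x = x)}\<rparr>"

definition galois_extension :: "'a::field_char_0 set \<Rightarrow> 'a set \<Rightarrow> bool" where
  "galois_extension K L \<longleftrightarrow>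
     subfield K (field_ring L) \<and>
     ring.finite_dimension (field_ring L) K L \<and>
     {x \<in> L. \<forall>\<sigma>\<in>carrier (Gal K L). \<sigma> x = x} = K"


section \<open>Ideals and the class group\<close>

text \<open>By convention, fractional ideals are non-zero.\<close>

definition fractional_ideal :: "'a::field_char_0 set \<Rightarrow> 'a set \<Rightarrow> bool" where
  "fractional_ideal F I \<longleftrightarrow>
     additive_subgroup I (field_ring F) \<and>
     (\<forall>a\<in>carrier (ring_of_integers F). \<forall>x\<in>I. a * x \<in> I) \<and>
     I \<noteq> {0} \<and>
     (\<exists>d\<in>carrier (ring_of_integers F). d \<noteq> 0 \<and> (\<forall>x\<in>I. d * x \<in> carrier (ring_of_integers F)))"

text \<open>
  \<^const>\<open>ideal_prod\<close> takes all finite sums of products of elements of its two arguments; over the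
  ring \<open>F\<close> it is the product of fractional ideals.
\<close>

definition ideal_group :: "'a::field_char_0 set \<Rightarrow> 'a set monoid" where
  "ideal_group F =
     \<lparr>carrier = {I. fractional_ideal F I},
      monoid.mult = ideal_prod (field_ring F),
      monoid.one = carrier (ring_of_integers F)\<rparr>"

definition principal_ideals :: "'a::field_char_0 set \<Rightarrow> 'a set set" where
  "principal_ideals F = {(\<lambda>a. x * a) ` carrier (ring_of_integers F) | x. x \<in> F \<and> x \<noteq> 0}"

definition class_group :: "'a::field_char_0 set \<Rightarrow> 'a set set monoid" where
  "class_group F = ideal_group F Mod principal_ideals F"

definition ideal_class :: "'a::field_char_0 set \<Rightarrow> 'a set \<Rightarrow> 'a set set" where
  "ideal_class F I = principal_ideals F #>\<^bsub>ideal_group F\<^esub> I"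

definition class_number :: "'a::field_char_0 set \<Rightarrow> nat" where
  "class_number F = Coset.order (class_group F)"


section \<open>Primes, ramification and residue degree\<close>

definition prime_of :: "'a::field_char_0 set \<Rightarrow> 'a set \<Rightarrow> bool" where
  "prime_of F P \<longleftrightarrow> primeideal P (ring_of_integers F) \<and> P \<noteq> {0}"

text \<open>
  The prime of \<open>K\<close> below \<open>P\<close> is \<open>P \<inter> K\<close>; the ramification index is the exponent of \<open>P\<close> in the
  factorisation of the ideal that it generates in the integers of \<open>L\<close>.
\<close>

definition ramification_index :: "'a::field_char_0 set \<Rightarrow> 'a set \<Rightarrow> 'a set \<Rightarrow> nat" where
  "ramification_index K L P =
     (GREATEST e. \<exists>J. ideal J (ring_of_integers L) \<and>
        Idl\<^bsub>ring_of_integers L\<^esub> (P \<inter> K) =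
        ideal_prod (ring_of_integers L) (P [^]\<^bsub>ideal_group L\<^esub> (e::nat)) J)"

text \<open>Residue fields are finite, hence perfect, so no separability condition is needed.\<close>

definition unramified :: "'a::field_char_0 set \<Rightarrow> 'a set \<Rightarrow> 'a set \<Rightarrow> bool" where
  "unramified K L P \<longleftrightarrow> ramification_index K L P = 1"

text \<open>
  The residue field of \<open>P \<inter> K\<close> is identified with its canonical image in that of \<open>P\<close>, namely the
  set of residue classes modulo \<open>P\<close> of the integers of \<open>K\<close>.
\<close>

definition residue_degree :: "'a::field_char_0 set \<Rightarrow> 'a set \<Rightarrow> 'a set \<Rightarrow> nat" where
  "residue_degree K L P =
     (let k = ring_of_integers L Quot P
      in ring.dim k ((\<lambda>x. P +>\<^bsub>ring_of_integers L\<^esub> x) ` carrier (ring_of_integers K)) (carrier k))"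

definition generating_degrees :: "'a::field_char_0 set \<Rightarrow> 'a set \<Rightarrow> nat set" where
  "generating_degrees K L =
     {f. generate (class_group L)
           {ideal_class L P | P. prime_of L P \<and> unramified K L P \<and> residue_degree K L P = f}
         = carrier (class_group L)}"


section \<open>The group ring and its action on ideals\<close>

text \<open>
  Elements of the integral group ring of \<open>G\<close> are formal integral combinations of elements of \<open>G\<close>.
\<close>

definition group_ring_act ::
  "'a::field_char_0 set \<Rightarrow> 'a set \<Rightarrow> (('a \<Rightarrow> 'a) \<Rightarrow>\<^sub>0 int) \<Rightarrow> 'a set \<Rightarrow> 'a set" where
  "group_ring_act K L \<theta> I =
     (\<Otimes>\<^bsub>ideal_group L\<^esub>\<sigma>\<in>carrier (Gal K L).
        (\<sigma> ` I) [^]\<^bsub>ideal_group L\<^esub> (Poly_Mapping.lookup \<theta> \<sigma>))"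

definition theta :: "('a \<Rightarrow> 'a) set \<Rightarrow> (('a \<Rightarrow> 'a) \<Rightarrow>\<^sub>0 int)" where
  "theta S = (\<Sum>\<sigma>\<in>S. frag_of \<sigma>)"


section \<open>Coset representatives\<close>

definition left_coset_reps :: "('g, 'b) monoid_scheme \<Rightarrow> 'g set \<Rightarrow> 'g set \<Rightarrow> bool" where
  "left_coset_reps G H T \<longleftrightarrow> T \<subseteq> carrier G \<and> (\<forall>C\<in>lcosets\<^bsub>G\<^esub> H. \<exists>!t. t \<in> T \<inter> C)"

definition cyclic_subgroups :: "('g, 'b) monoid_scheme \<Rightarrow> nat \<Rightarrow> 'g set set" where
  "cyclic_subgroups G f = {C. subgroup C G \<and> cyclic_group (G\<lparr>carrier := C\<rparr>) \<and> card C = f}"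

text \<open>
  Intersections are taken inside \<open>G\<close>; this only matters if \<open>G\<close> has no cyclic subgroup of order
  \<open>f\<close>.
\<close>

definition cyclic_core :: "('g, 'b) monoid_scheme \<Rightarrow> nat \<Rightarrow> 'g set" where
  "cyclic_core G f = carrier G \<inter> \<Inter>(cyclic_subgroups G f)"

definition product_reps ::
  "('g, 'b) monoid_scheme \<Rightarrow> 'g set \<Rightarrow> 'g set \<Rightarrow> 'g set set" where
  "product_reps G H C =
     {S. left_coset_reps G H S \<and>
         (\<exists>T T'. left_coset_reps G C T \<and> left_coset_reps (G\<lparr>carrier := C\<rparr>) H T' \<and>
                 S = T <#>\<^bsub>G\<^esub> T')}"

definition common_product_reps :: "('g, 'b) monoid_scheme \<Rightarrow> nat \<Rightarrow> 'g set set" where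
  "common_product_reps G f =
     Pow (carrier G) \<inter> (\<Inter>C\<in>cyclic_subgroups G f. product_reps G (cyclic_core G f) C)"

end

theory Submission
  imports Defs "Jordan_Normal_Form.Char_Poly"
begin

text \<open>
  Whether \<open>\<theta>(S)(\<aa>)\<close> is principal depends only on the class of \<open>\<aa>\<close>, and multiplicatively so; it
  suffices to treat a prime \<open>P\<close> that is unramified over \<open>K\<close> with residue degree \<open>f\<close>. Its
  decomposition group \<open>D\<close> is cyclic of order \<open>f\<close>, generated by a Frobenius element, hence is one of the \<open>H\<^sub>f\<^sup>i\<close>, and \<open>S = T T'\<close> with \<open>T\<close> a transversal
  of \<open>D\<close> in \<open>G\<close> and \<open>T' \<subseteq> D\<close>. The ideals \<open>t(P)\<close> for \<open>t \<in> T\<close> are the distinct primes above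
  \<open>P \<inter> K = (\<pi>)\<close>, so \<open>\<theta>(S)(P)\<close> is the ideal \<open>(\<pi>)\<close> raised to the power \<open>|T'|\<close>.

  The arithmetic of \<open>\<O> = \<O>\<^sub>L\<close> all comes from the finiteness of \<open>\<O>/a\<O>\<close> for \<open>a \<noteq> 0\<close>, which needs no
  integral basis: \<open>M/\<ell>M\<close> is finite for every subgroup \<open>M\<close> of a finite-dimensional rational
  vector space.
\<close>

section \<open>Algebraic integers\<close>

text \<open>Finiteness of \<open>ints / a ints\<close> mostly acts as a pigeonhole: among the powers
  of an integer two agree modulo \<open>a\<close>. So an integer outside \<open>P\<close> has a
  power congruent to 1 modulo \<open>P\<close>; this supplies inverses in the residue field,
  comaximality with \<open>P\<close>, and the equality of conjugates of \<open>P\<close> contained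
  in one another.

  The delicate point is that \<open>D\<close> has order exactly \<open>f\<close>, for which an
  element of \<open>D\<close> acting trivially on \<open>ints / P\<close> must be the identity.
  Unramifiedness is therefore turned into a statement about elements: there is \<open>w\<close>
  outside \<open>P\<close> with \<open>w P\<close> contained in \<open>\<pi> ints\<close>. Hence
  \<open>\<pi>\<close>, which lies in \<open>K\<close> and is fixed by \<open>G\<close>, generates
  \<open>P\<close> up to a factor invertible modulo \<open>P\<close>. The same \<open>w\<close>
  shows later that no conjugate of \<open>P\<close> divides \<open>(\<pi>)\<close> twice.

  The residue fields are soon replaced by congruences between integers: \<open>q\<close> is the size
  of the residue field of \<open>K\<close>, and \<open>\<gamma>\<close> lifts a generator of the
  multiplicative group of \<open>ints / P\<close>, so an element of \<open>D\<close> is controlled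
  modulo \<open>P\<close> by its value at \<open>\<gamma>\<close>.\<close>

lemma algebraic_int_of_finite_module:
  fixes z :: "'a::field_char_0"
  assumes "finite G" and "g0 \<in> G" and "g0 \<noteq> 0"
    and step: "\<And>g. g \<in> G \<Longrightarrow> \<exists>c. z * g = (\<Sum>h\<in>G. of_int (c h) * h)"
  shows "algebraic_int z"
proof -
  obtain gs where gs: "set gs = G" "distinct gs"
    using finite_distinct_list[OF \<open>finite G\<close>] by blast
  define n where "n = length gs"
  obtain c where c: "\<And>g. g \<in> G \<Longrightarrow> z * g = (\<Sum>h\<in>G. of_int (c g h) * h)"
    using step by metis
  define A :: "int mat" where "A = mat n n (\<lambda>(i, j). c (gs ! i) (gs ! j))"
  have A: "A \<in> carrier_mat n n" by (simp add: A_def)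
  define v where "v = vec n (\<lambda>i. gs ! i)"
  let ?A = "map_mat (of_int :: int \<Rightarrow> 'a) A"
  \<comment> \<open>Multiplication by \<open>z\<close> acts on the tuple of generators as the
    integer matrix \<open>A\<close>; the tuple is nonzero because it contains \<open>g0\<close>. So
    \<open>z\<close> is a root of the monic integer polynomial \<open>char_poly A\<close>.\<close>
  have "eigenvector ?A v z"
    unfolding eigenvector_def
  proof (intro conjI)
    show "v \<in> carrier_vec (dim_row ?A)" using A by (simp add: v_def)
    obtain k where k: "k < n" "gs ! k = g0"
      using \<open>g0 \<in> G\<close> gs by (auto simp: n_def in_set_conv_nth)
    then have "v $ k \<noteq> 0" using \<open>g0 \<noteq> 0\<close> by (simp add: v_def)
    then show "v \<noteq> 0\<^sub>v (dim_row ?A)" using k A by auto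
    show "?A *\<^sub>v v = z \<cdot>\<^sub>v v"
    proof (rule eq_vecI)
      show "dim_vec (?A *\<^sub>v v) = dim_vec (z \<cdot>\<^sub>v v)" using A by (simp add: v_def)
      fix i assume "i < dim_vec (z \<cdot>\<^sub>v v)"
      then have i: "i < n" by (simp add: v_def)
      have "(?A *\<^sub>v v) $ i = (\<Sum>j<n. of_int (c (gs ! i) (gs ! j)) * gs ! j)"
        using i by (simp add: A_def v_def scalar_prod_def lessThan_atLeast0)
      also have "\<dots> = (\<Sum>h\<in>G. of_int (c (gs ! i) h) * h)"
        by (rule sum.reindex_bij_betw)
          (use gs in \<open>auto simp: n_def bij_betw_def inj_on_nth set_conv_nth\<close>)
      also have "\<dots> = z * gs ! i" using c[of "gs ! i"] gs(1) i nth_mem[of i gs] by (simp add: n_def)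
      finally show "(?A *\<^sub>v v) $ i = (z \<cdot>\<^sub>v v) $ i" using i by (simp add: v_def)
    qed
  qed
  then have "eigenvalue ?A z" by (auto simp: eigenvalue_def)
  then have "poly (char_poly ?A) z = 0"
    using eigenvalue_root_char_poly[of ?A n] A by simp
  then have "poly (map_poly of_int (char_poly A)) z = 0"
    by (simp add: of_int_hom.char_poly_hom[OF A])
  moreover have "lead_coeff (char_poly A) = 1"
    using degree_monic_char_poly[OF A] by simp
  ultimately show ?thesis
    unfolding algebraic_int_altdef_ipoly by blast
qed

lemma algebraic_int_combination_powers:
  fixes x :: "'a::field_char_0"
  assumes "algebraic_int x"
  obtains m c where "m > 0" "x ^ m = (\<Sum>i<m. of_int (c i) * x ^ i)"
proof -
  obtain p :: "int poly" where p: "poly (map_poly of_int p) x = 0" "lead_coeff p = 1"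
    using assms unfolding algebraic_int_altdef_ipoly by blast
  define m where "m = degree p"
  have dm: "degree (map_poly of_int p :: 'a poly) = m"
    by (simp add: degree_map_poly m_def)
  have "0 = (\<Sum>i\<le>m. of_int (coeff p i) * x ^ i)"
    using p(1) unfolding poly_altdef dm by (simp add: coeff_map_poly)
  also have "\<dots> = (\<Sum>i<m. of_int (coeff p i) * x ^ i) + x ^ m"
    using p(2) by (simp add: lessThan_Suc_atMost[symmetric] m_def)
  finally have "x ^ m = - (\<Sum>i<m. of_int (coeff p i) * x ^ i)"
    by (metis add_eq_0_iff)
  then have *: "x ^ m = (\<Sum>i<m. of_int (- coeff p i) * x ^ i)"
    by (simp only: sum_negf[symmetric] of_int_minus mult_minus_left)
  \<comment> \<open>For \<open>m = 0\<close> the relation would read \<open>1 = 0\<close>.\<close>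
  have "m > 0"
    by (metis * lessThan_0 sum.empty power_0 zero_neq_one gr0I)
  then show ?thesis using * by (rule that)
qed

text \<open>The products \<open>x ^ i * y ^ j\<close> with \<open>i < m\<close>,
  \<open>j < n\<close> span a finitely generated additive group \<open>M\<close> that contains 1 and
  is stable under \<open>x\<close> and \<open>y\<close>, hence under their sum and product; the
  finite module criterion applies.\<close>

lemma algebraic_int_add_mult:
  fixes x y :: "'a::field_char_0"
  assumes "algebraic_int x" "algebraic_int y"
  shows "algebraic_int (x + y)" "algebraic_int (x * y)"
proof -
  obtain m c where m: "m > 0" "x ^ m = (\<Sum>i<m. of_int (c i) * x ^ i)"
    using algebraic_int_combination_powers[OF assms(1)] .
  obtain n d where n: "n > 0" "y ^ n = (\<Sum>i<n. of_int (d i) * y ^ i)"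
    using algebraic_int_combination_powers[OF assms(2)] .
  define G where "G = (\<lambda>(i, j). x ^ i * y ^ j) ` ({..<m} \<times> {..<n})"
  have fin: "finite G" by (simp add: G_def)
  define M where "M = {u. \<exists>c. u = (\<Sum>h\<in>G. of_int (c h) * h)}"
  have M_sum: "(\<Sum>i\<in>I. of_int (e i) * f i) \<in> M"
    if fI: "\<And>i. i \<in> I \<Longrightarrow> f i \<in> M" for I :: "nat set" and e f
  proof -
    obtain b where b: "\<And>i. i \<in> I \<Longrightarrow> f i = (\<Sum>h\<in>G. of_int (b i h) * h)"
      using fI unfolding M_def by (auto, metis)
    have "(\<Sum>i\<in>I. of_int (e i) * f i) = (\<Sum>i\<in>I. \<Sum>h\<in>G. of_int (e i * b i h) * h)"
      by (intro sum.cong refl) (simp add: b sum_distrib_left mult.assoc)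
    also have "\<dots> = (\<Sum>h\<in>G. of_int (\<Sum>i\<in>I. e i * b i h) * h)"
      by (subst sum.swap) (simp add: sum_distrib_right)
    finally show ?thesis unfolding M_def by (intro CollectI exI)
  qed
  have M_G: "g \<in> M" if "g \<in> G" for g
  proof -
    have "g = (\<Sum>h\<in>G. of_int (if h = g then 1 else 0) * h)"
      using that fin by (simp add: if_distrib[of of_int] if_distrib[of "\<lambda>t. t * _"] cong: if_cong)
    then show ?thesis unfolding M_def by (intro CollectI exI)
  qed
  have M_add: "u + w \<in> M" if "u \<in> M" "w \<in> M" for u w
    using M_sum[of "{0,1::nat}" "\<lambda>i. if i = 0 then u else w" "\<lambda>_. 1"] that by auto
  have xG: "x * g \<in> M" if gG: "g \<in> G" for g
  proof -
    obtain i j where g: "g = x ^ i * y ^ j" "i < m" "j < n"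
      using gG by (auto simp: G_def)
    show ?thesis
    proof (cases "Suc i < m")
      case True
      then show ?thesis
        using g by (intro M_G) (auto simp: G_def intro!: rev_image_eqI[of "(Suc i, j)"])
    next
      case False
      then have "m = Suc i" using g by simp
      then have "x * g = x ^ m * y ^ j" by (simp add: g mult.assoc)
      also have "\<dots> = (\<Sum>l<m. of_int (c l) * (x ^ l * y ^ j))"
        by (simp add: m(2) sum_distrib_right mult.assoc)
      also have "\<dots> \<in> M" using g by (intro M_sum M_G) (auto simp: G_def)
      finally show ?thesis .
    qed
  qed
  have yG: "y * g \<in> M" if gG: "g \<in> G" for g
  proof -
    obtain i j where g: "g = x ^ i * y ^ j" "i < m" "j < n"
      using gG by (auto simp: G_def)
    show ?thesis
    proof (cases "Suc j < n")
      case True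
      then show ?thesis
        using g by (intro M_G) (auto simp: G_def mult_ac intro!: rev_image_eqI[of "(i, Suc j)"])
    next
      case False
      then have "n = Suc j" using g by simp
      then have "y * g = x ^ i * y ^ n" by (simp add: g mult_ac)
      also have "\<dots> = (\<Sum>l<n. of_int (d l) * (x ^ i * y ^ l))"
        by (simp add: n(2) sum_distrib_left mult_ac)
      also have "\<dots> \<in> M" using g by (intro M_sum M_G) (auto simp: G_def)
      finally show ?thesis .
    qed
  qed
  have xM: "x * u \<in> M" if uM: "u \<in> M" for u
  proof -
    obtain b where u: "u = (\<Sum>h\<in>G. of_int (b h) * h)" using uM by (auto simp: M_def)
    \<comment> \<open>The generators are listed so that \<open>M_sum\<close>, which takes sums
      indexed by natural numbers, applies.\<close>
    obtain gs where gs: "set gs = G" "distinct gs"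
      using finite_distinct_list[OF fin] by blast
    have bij: "bij_betw ((!) gs) {..<length gs} G"
      using gs by (auto simp: bij_betw_def inj_on_nth set_conv_nth)
    have "x * u = (\<Sum>h\<in>G. of_int (b h) * (x * h))"
      by (simp add: u sum_distrib_left mult_ac)
    also have "\<dots> = (\<Sum>i<length gs. of_int (b (gs ! i)) * (x * gs ! i))"
      using sum.reindex_bij_betw[OF bij, of "\<lambda>h. of_int (b h) * (x * h)"] by simp
    also have "\<dots> \<in> M" using gs by (intro M_sum xG) auto
    finally show ?thesis .
  qed
  have one: "1 \<in> G" using m n by (auto simp: G_def intro!: rev_image_eqI[of "(0, 0)"])
  have "\<exists>c. (x + y) * g = (\<Sum>h\<in>G. of_int (c h) * h)" if "g \<in> G" for g
    using M_add[OF xG[OF that] yG[OF that]] by (simp add: M_def distrib_right)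
  from algebraic_int_of_finite_module[OF fin one _ this] show "algebraic_int (x + y)"
    by simp
  have "\<exists>c. (x * y) * g = (\<Sum>h\<in>G. of_int (c h) * h)" if "g \<in> G" for g
    using xM[OF yG[OF that]] by (simp add: M_def mult.assoc)
  from algebraic_int_of_finite_module[OF fin one _ this] show "algebraic_int (x * y)"
    by simp
qed

lemma algebraic_int_of_int: "algebraic_int (of_int n :: 'a::field_char_0)"
  by (rule int_imp_algebraic_int) auto

text \<open>If \<open>p\<close> is monic with root \<open>x ^ j - x ^ i\<close>, then
  \<open>x\<close> is a root of \<open>p\<close> composed with \<open>X ^ j - X ^ i\<close>, which
  is monic because \<open>i < j\<close>.\<close>

lemma algebraic_int_of_power_diff:
  fixes x :: "'a::field_char_0"
  assumes "algebraic_int (x ^ j - x ^ i)" "i < j"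
  shows "algebraic_int x"
proof -
  obtain p :: "int poly"
    where p: "poly (map_poly of_int p) (x ^ j - x ^ i) = 0" "lead_coeff p = 1"
    using assms unfolding algebraic_int_altdef_ipoly by blast
  define q :: "int poly" where "q = Polynomial.monom 1 j - Polynomial.monom 1 i"
  have dq: "degree q = j"
    unfolding q_def using \<open>i < j\<close>
    by (intro antisym degree_le le_degree) auto
  have lq: "lead_coeff q = 1"
    unfolding dq using \<open>i < j\<close> by (simp add: q_def)
  have "lead_coeff (p \<circ>\<^sub>p q) = 1"
    using lead_coeff_comp[of q p] dq lq p \<open>i < j\<close> by simp
  moreover have "poly (map_poly of_int q) x = x ^ j - x ^ i"
    by (simp add: q_def hom_distribs poly_monom)
  then have "poly (map_poly of_int (p \<circ>\<^sub>p q)) x = 0"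
    using p(1) by (simp add: of_int_hom.map_poly_pcompose poly_pcompose)
  ultimately show ?thesis
    unfolding algebraic_int_altdef_ipoly by blast
qed

text \<open>Multiplying \<open>p(x) = 0\<close> by \<open>d ^ (n - 1)\<close>, with \<open>d\<close>
  the leading coefficient, turns it into a monic equation for \<open>d * x\<close>.\<close>

lemma algebraic_imp_multiple_algebraic_int:
  fixes x :: "'a::field_char_0" and p :: "int poly"
  assumes "poly (map_poly of_int p) x = 0" "p \<noteq> 0"
  shows "\<exists>d::int. d \<noteq> 0 \<and> algebraic_int (of_int d * x)"
proof -
  define n where "n = degree p"
  define d where "d = lead_coeff p"
  have "d \<noteq> 0" using assms by (simp add: d_def)
  have dm: "degree (map_poly of_int p :: 'a poly) = n"
    by (simp add: degree_map_poly n_def)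
  have n0: "n > 0"
    using assms by (cases "n = 0") (auto simp: n_def elim!: degree_eq_zeroE)
  have rel: "(of_int d * x) ^ n = (\<Sum>i<n. of_int (- (coeff p i * d ^ (n - 1 - i))) * (of_int d * x) ^ i)"
  proof -
    have "0 = of_int d ^ (n - 1) * (\<Sum>i\<le>n. of_int (coeff p i) * x ^ i)"
      using assms(1) unfolding poly_altdef dm by (simp add: coeff_map_poly)
    also have "\<dots> = of_int d ^ (n - 1) * (\<Sum>i<n. of_int (coeff p i) * x ^ i) + of_int d ^ (n - 1) * (of_int d * x ^ n)"
      by (simp add: lessThan_Suc_atMost[symmetric] d_def n_def distrib_left)
    also have "of_int d ^ (n - 1) * (of_int d * x ^ n) = (of_int d * x) ^ n"
      using n0 by (cases n) (simp_all add: power_mult_distrib mult_ac)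
    also have "of_int d ^ (n - 1) * (\<Sum>i<n. of_int (coeff p i) * x ^ i) =
        (\<Sum>i<n. of_int (coeff p i * d ^ (n - 1 - i)) * (of_int d * x) ^ i)"
      unfolding sum_distrib_left
    proof (rule sum.cong)
      fix i assume "i \<in> {..<n}"
      then have "n - 1 = (n - 1 - i) + i" by auto
      then have "(of_int d :: 'a) ^ (n - 1) = of_int d ^ (n - 1 - i) * of_int d ^ i"
        by (metis power_add)
      then show "of_int d ^ (n - 1) * (of_int (coeff p i) * x ^ i) =
          of_int (coeff p i * d ^ (n - 1 - i)) * (of_int d * x) ^ i"
        by (simp only: power_mult_distrib of_int_mult of_int_power mult_ac)
    qed simp
    finally have "(of_int d * x) ^ n = - (\<Sum>i<n. of_int (coeff p i * d ^ (n - 1 - i)) * (of_int d * x) ^ i)"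
      by (metis add_eq_0_iff)
    then show ?thesis
      by (simp only: sum_negf[symmetric] of_int_minus mult_minus_left)
  qed
  define q :: "int poly" where
    "q = Polynomial.monom 1 n + (\<Sum>i<n. Polynomial.monom (coeff p i * d ^ (n - 1 - i)) i)"
  have cq: "coeff q k = (if k = n then 1 else if k < n then coeff p k * d ^ (n - 1 - k) else 0)" for k
    by (auto simp: q_def Polynomial.coeff_sum)
  have dq: "degree q = n"
    by (rule antisym) (auto simp: cq intro!: degree_le le_degree)
  have "poly (map_poly of_int q) (of_int d * x) = 0"
  proof -
    have dmq: "degree (map_poly of_int q :: 'a poly) = n"
      by (simp add: degree_map_poly dq)
    have "poly (map_poly of_int q) (of_int d * x) = (\<Sum>i\<le>n. of_int (coeff q i) * (of_int d * x) ^ i)"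
      unfolding poly_altdef dmq by (simp add: coeff_map_poly)
    also have "\<dots> = (\<Sum>i<n. of_int (coeff p i * d ^ (n - 1 - i)) * (of_int d * x) ^ i) + (of_int d * x) ^ n"
      by (simp add: lessThan_Suc_atMost[symmetric] cq)
    also have "\<dots> = 0"
      unfolding rel by (simp only: sum_negf of_int_minus mult_minus_left right_minus)
    finally show ?thesis .
  qed
  moreover have "lead_coeff q = 1" by (simp add: dq cq)
  ultimately show ?thesis
    unfolding algebraic_int_altdef_ipoly using \<open>d \<noteq> 0\<close> by blast
qed

text \<open>Cancel from a monic equation for \<open>x\<close> the powers of \<open>x\<close>
  dividing it, which is possible since \<open>x \<noteq> 0\<close>. The constant coefficient that
  remains is the nonzero integer \<open>m\<close>, and the rest of the equation exhibits it as a
  multiple of \<open>x\<close>.\<close>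

lemma algebraic_int_dvd_int:
  fixes x :: "'a::field_char_0"
  assumes "algebraic_int x" "x \<noteq> 0"
  obtains m :: int and p :: "int poly"
    where "m \<noteq> 0" "of_int m = x * poly (map_poly of_int p) x"
proof -
  obtain p :: "int poly" where p: "poly (map_poly of_int p) x = 0" "lead_coeff p = 1"
    using assms unfolding algebraic_int_altdef_ipoly by blast
  have "\<exists>m q. m \<noteq> 0 \<and> of_int m = x * poly (map_poly of_int q) x"
    if "p \<noteq> 0" "poly (map_poly of_int p) x = 0" for p :: "int poly"
    using that
  proof (induction p)
    case 0
    then show ?case by simp
  next
    case (pCons a p)
    have eq: "of_int a + x * poly (map_poly of_int p) x = 0"
      using pCons.prems by (simp add: of_int_hom.map_poly_pCons_hom)
    show ?case
    proof (cases "a = 0")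
      case True
      then show ?thesis using pCons eq \<open>x \<noteq> 0\<close> by auto
    next
      case False
      then show ?thesis
        using eq by (intro exI[of _ a] exI[of _ "- p"])
          (simp add: of_int_poly_hom.hom_uminus eq_neg_iff_add_eq_0)
    qed
  qed
  moreover have "p \<noteq> 0" using p by auto
  ultimately show ?thesis using p that by blast
qed

section \<open>Finite quotients of orders in number fields\<close>

lemma ambient_simps [simp]:
  "carrier ambient = UNIV" "x \<otimes>\<^bsub>ambient\<^esub> y = x * y" "x \<oplus>\<^bsub>ambient\<^esub> y = x + y"
  "\<zero>\<^bsub>ambient\<^esub> = 0" "\<one>\<^bsub>ambient\<^esub> = 1"
  by (simp_all add: ring_of_type_algebra_def)

lemma ring_ambient: "ring (ambient :: 'a::field_char_0 ring)"
  by (rule ring_from_type_algebra)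

lemma field_ambient: "field (ambient :: 'a::field_char_0 ring)"
  by (rule field_from_type_algebra)

lemma ambient_minus [simp]: "\<ominus>\<^bsub>ambient\<^esub> x = - (x :: 'a::field_char_0)"
proof -
  have "\<ominus>\<^bsub>ambient\<^esub> x + x = 0"
    using ring.ring_simprules(9)[OF ring_ambient, of x] by simp
  then show ?thesis by (simp only: eq_neg_iff_add_eq_0)
qed

lemma ambient_inv: "x \<noteq> 0 \<Longrightarrow> inv\<^bsub>ambient\<^esub> x = inverse (x :: 'a::field_char_0)"
  using monoid.inv_char[OF ring.axioms(2)[OF ring_ambient], of x "inverse x"] by simp

definition add_subgroup :: "'a::ab_group_add set \<Rightarrow> bool" where
  "add_subgroup M \<longleftrightarrow> 0 \<in> M \<and> (\<forall>x\<in>M. \<forall>y\<in>M. x - y \<in> M)"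

lemma add_subgroupI:
  assumes "0 \<in> M" "\<And>x y. x \<in> M \<Longrightarrow> y \<in> M \<Longrightarrow> x - y \<in> M"
  shows "add_subgroup M"
  using assms by (simp add: add_subgroup_def)

lemma add_subgroup_closed:
  assumes "add_subgroup M"
  shows "0 \<in> M" "x \<in> M \<Longrightarrow> - x \<in> M"
    "x \<in> M \<Longrightarrow> y \<in> M \<Longrightarrow> x + y \<in> M" "x \<in> M \<Longrightarrow> y \<in> M \<Longrightarrow> x - y \<in> M"
proof -
  have *: "0 \<in> M" "\<And>x y. x \<in> M \<Longrightarrow> y \<in> M \<Longrightarrow> x - y \<in> M"
    using assms by (auto simp: add_subgroup_def)
  then have **: "- x \<in> M" if "x \<in> M" for x
    using that by (metis diff_0)
  show "0 \<in> M" "x \<in> M \<Longrightarrow> - x \<in> M" "x \<in> M \<Longrightarrow> y \<in> M \<Longrightarrow> x - y \<in> M"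
    using * ** by auto
  show "x + y \<in> M" if "x \<in> M" "y \<in> M"
    using *(2)[OF that(1) **[OF that(2)]] by simp
qed

lemma add_subgroup_of_int_mult:
  fixes M :: "'a::ring_1 set"
  assumes "add_subgroup M" "x \<in> M"
  shows "of_int n * x \<in> M"
proof -
  have nat: "of_nat k * x \<in> M" for k
    by (induction k) (use add_subgroup_closed[OF assms(1)] assms(2) in \<open>auto simp: distrib_right\<close>)
  show ?thesis
    by (cases n rule: int_cases2)
      (use nat add_subgroup_closed(2)[OF assms(1) nat] in auto)
qed

lemma add_subgroup_sum:
  assumes "add_subgroup M" "\<And>i. i \<in> I \<Longrightarrow> f i \<in> M"
  shows "sum f I \<in> M"
  using assms(2)
  by (induction I rule: infinite_finite_induct) (auto intro: add_subgroup_closed[OF assms(1)])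

text \<open>Finiteness of the quotient \<open>M / a M\<close>; a finite set of possibly redundant
  representatives avoids forming the quotient group.\<close>

definition finite_mod :: "'a::ring_1 \<Rightarrow> 'a set \<Rightarrow> bool" where
  "finite_mod a M \<longleftrightarrow>
     (\<exists>R. finite R \<and> R \<subseteq> M \<and> (\<forall>x\<in>M. \<exists>r\<in>R. \<exists>y\<in>M. x = r + a * y))"

lemma finite_modE:
  assumes "finite_mod a M"
  obtains R where "finite R" "R \<subseteq> M" "\<forall>x\<in>M. \<exists>r\<in>R. \<exists>y\<in>M. x = r + a * y"
  using assms unfolding finite_mod_def by (elim exE conjE)

lemma finite_modI:
  assumes "finite R" "R \<subseteq> M" "\<And>x. x \<in> M \<Longrightarrow> \<exists>r\<in>R. \<exists>y\<in>M. x = r + a * y"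
  shows "finite_mod a M"
  using assms unfolding finite_mod_def by (intro exI[of _ R]) simp

text \<open>The quotient \<open>Q / l Q\<close> is trivial or generated by any \<open>c\<close> in
  \<open>Q\<close> outside \<open>l Q\<close>. Given \<open>x\<close>, both \<open>x\<close> and
  \<open>c\<close> are integer multiples \<open>u d\<close> and \<open>w d\<close> of one
  \<open>d\<close> in \<open>Q\<close>; since \<open>c\<close> is not in \<open>l Q\<close>,
  \<open>l\<close> does not divide \<open>w\<close>, so \<open>w\<close> is invertible modulo
  \<open>l\<close>.\<close>

lemma finite_mod_prime_Rats:
  fixes Q :: "'a::field_char_0 set" and l :: int
  assumes Q: "add_subgroup Q" "Q \<subseteq> \<rat>" and l: "Factorial_Ring.prime l"
  shows "finite_mod (of_int l) Q"
proof (cases "\<forall>x\<in>Q. \<exists>y\<in>Q. x = of_int l * y")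
  case True
  then show ?thesis
    unfolding finite_mod_def using add_subgroup_closed(1)[OF Q(1)]
    by (intro exI[of _ "{0}"]) auto
next
  case False
  then obtain c where c: "c \<in> Q" "\<And>y. y \<in> Q \<Longrightarrow> c \<noteq> of_int l * y" by blast
  note Qs = add_subgroup_closed[OF Q(1)]
  have "c \<noteq> 0" using c(2)[of 0] Qs(1) by auto
  have "\<exists>r\<in>(\<lambda>j. of_int j * c) ` {0..<l}. \<exists>y\<in>Q. x = r + of_int l * y" if x: "x \<in> Q" for x
  proof -
    obtain a b where ab: "b > 0" "x = of_int a / of_int b"
      using subsetD[OF Q(2) x] by (rule Rats_cases')
    obtain a' b' where ab': "b' > 0" "c = of_int a' / of_int b'"
      using subsetD[OF Q(2) c(1)] by (rule Rats_cases')
    define U where "U = a * b'"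
    define W where "W = a' * b"
    have xU: "x = of_int U / of_int (b * b')" and cW: "c = of_int W / of_int (b * b')"
      using ab ab' by (auto simp: U_def W_def)
    have "W \<noteq> 0" using \<open>c \<noteq> 0\<close> cW by auto
    obtain s t where st: "s * U + t * W = gcd U W"
      using bezout_int by metis
    define g where "g = gcd U W"
    have "g \<noteq> 0" using \<open>W \<noteq> 0\<close> by (simp add: g_def)
    \<comment> \<open>Over a common denominator, \<open>d\<close> is the gcd of \<open>x\<close> and
      \<open>c\<close>; Bezout's identity puts it in \<open>Q\<close>.\<close>
    define d where "d = (of_int g / of_int (b * b') :: 'a)"
    have "d = of_int s * x + of_int t * c"
      unfolding d_def g_def st[symmetric] xU cW by (simp add: add_divide_distrib)
    then have dQ: "d \<in> Q"
      using Qs(3) add_subgroup_of_int_mult[OF Q(1)] x c by simp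
    define u where "u = U div g"
    define w where "w = W div g"
    have "U = u * g" "W = w * g" by (simp_all add: u_def w_def g_def)
    then have xu: "x = of_int u * d" and cw: "c = of_int w * d"
      by (simp_all add: xU cW d_def)
    have "\<not> l dvd w"
      using c(2)[of "of_int (w div l) * d"] add_subgroup_of_int_mult[OF Q(1) dQ] cw
      by (auto simp flip: mult.assoc of_int_mult)
    then have "Rings.coprime w l" using l by (metis coprime_commute prime_imp_coprime)
    then obtain p q where pq: "p * w + q * l = 1"
      by (metis bezout_int coprime_imp_gcd_eq_1)
    \<comment> \<open>\<open>p\<close> inverts \<open>w\<close> modulo \<open>l\<close>, so
      \<open>j\<close> is the residue with \<open>u\<close> congruent to \<open>j * w\<close>;
      \<open>e\<close> is the quotient, making \<open>u = j * w + l * e\<close>.\<close>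
    define j where "j = (u * p) mod l"
    define e where "e = u * q + w * ((u * p) div l)"
    have "u * p = l * ((u * p) div l) + j" by (simp add: j_def)
    then have *: "u * p * w = (l * ((u * p) div l) + j) * w" by (simp only:)
    have "u = u * (p * w + q * l)" by (simp only: pq mult_1_right)
    also have "\<dots> = u * p * w + l * (u * q)" by (simp only: distrib_left mult_ac)
    also have "\<dots> = j * w + l * e" unfolding * e_def by (simp only: distrib_left distrib_right ac_simps)
    finally have "(of_int u :: 'a) = of_int j * of_int w + of_int l * of_int e"
      by (metis of_int_add of_int_mult)
    then have "x = of_int j * c + of_int l * (of_int e * d)"
      unfolding xu cw by (simp only: distrib_right mult.assoc)
    moreover have "j \<in> {0..<l}"
      using l by (auto simp: j_def prime_gt_0_int)
    ultimately show ?thesis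
      using add_subgroup_of_int_mult[OF Q(1) dQ] by blast
  qed
  moreover have "(\<lambda>j. of_int j * c) ` {0..<l} \<subseteq> Q"
    using add_subgroup_of_int_mult[OF Q(1)] c by auto
  ultimately show ?thesis
    unfolding finite_mod_def by (intro exI[of _ "(\<lambda>j. of_int j * c) ` {0..<l}"]) simp
qed

text \<open>Induction along the extension by one line spanned by \<open>v\<close>: the possible
  coefficients of \<open>v\<close> in elements of \<open>M\<close> form a subgroup \<open>Q\<close>
  of the rationals, and finiteness for \<open>M\<close> follows from that for \<open>Q\<close> and
  for \<open>M \<inter> E\<close>. That \<open>E\<close> is a subgroup is carried along for the
  induction.\<close>

lemma finite_mod_prime_dimension:
  fixes E :: "'a::field_char_0 set" and l :: int
  assumes "ring.dimension ambient n \<rat> E" and l: "Factorial_Ring.prime l"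
  shows "add_subgroup E \<and> (\<forall>M. add_subgroup M \<longrightarrow> M \<subseteq> E \<longrightarrow> finite_mod (of_int l) M)"
  using assms(1)
proof (induction n "\<rat> :: 'a set" E
    rule: ring.dimension.induct[OF ring_ambient, consumes 1, case_names zero Suc])
  case zero
  show ?case
    unfolding add_subgroup_def finite_mod_def
    by (auto intro!: exI[of _ "{0}"] bexI[of _ 0])
next
  case (Suc v E n)
  then have E: "add_subgroup E"
    and IH: "\<And>M. add_subgroup M \<Longrightarrow> M \<subseteq> E \<Longrightarrow> finite_mod (of_int l) M" by auto
  note Es = add_subgroup_closed[OF E]
  let ?E = "ring.line_extension ambient \<rat> v E"
  have mem: "u \<in> ?E \<longleftrightarrow> (\<exists>k\<in>\<rat>. \<exists>w\<in>E. u = k * v + w)" for u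
    by (simp add: ring.line_extension_mem_iff[OF ring_ambient])
  show ?case
  proof (intro conjI allI impI)
    show "add_subgroup ?E"
    proof (rule add_subgroupI)
      show "0 \<in> ?E" unfolding mem using Es(1) by (intro bexI[of _ 0]) auto
      fix x y assume "x \<in> ?E" "y \<in> ?E"
      then obtain k w k' w' where "x = k * v + w" "y = k' * v + w'"
        "k \<in> \<rat>" "k' \<in> \<rat>" "w \<in> E" "w' \<in> E" unfolding mem by blast
      then show "x - y \<in> ?E"
        unfolding mem using Es(4)
        by (intro bexI[of _ "k - k'"] bexI[of _ "w - w'"]) (auto simp: algebra_simps)
    qed
    fix M assume M: "add_subgroup M" and ME: "M \<subseteq> ?E"
    note Ms = add_subgroup_closed[OF M]
    define Q where "Q = {k\<in>\<rat>. \<exists>w\<in>E. k * v + w \<in> M}"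
    have "add_subgroup Q"
    proof (rule add_subgroupI)
      show "0 \<in> Q" unfolding Q_def using Es(1) Ms(1) by auto
      fix x y assume xy: "x \<in> Q" "y \<in> Q"
      then obtain w w' where w: "w \<in> E" "w' \<in> E" "x * v + w \<in> M" "y * v + w' \<in> M"
        unfolding Q_def by blast
      have "(x - y) * v + (w - w') = (x * v + w) - (y * v + w')" by (simp add: algebra_simps)
      then have "(x - y) * v + (w - w') \<in> M" using Ms(4)[OF w(3,4)] by (simp only:)
      moreover have "x - y \<in> \<rat>" "w - w' \<in> E"
        using xy Es(4)[OF w(1,2)] by (auto simp: Q_def)
      ultimately show "x - y \<in> Q" unfolding Q_def by (intro CollectI conjI bexI)
    qed
    moreover have "Q \<subseteq> \<rat>" by (auto simp: Q_def)
    ultimately have fQ: "finite_mod (of_int l) Q" by (rule finite_mod_prime_Rats[OF _ _ l])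
    obtain R where R: "finite R" "R \<subseteq> Q" "\<forall>x\<in>Q. \<exists>r\<in>R. \<exists>y\<in>Q. x = r + of_int l * y"
      using finite_modE[OF fQ] .
    have "add_subgroup (M \<inter> E)" using M E by (auto simp: add_subgroup_def)
    then have fE: "finite_mod (of_int l) (M \<inter> E)" by (rule IH) auto
    obtain R' where R': "finite R'" "R' \<subseteq> M \<inter> E"
      "\<forall>x\<in>M \<inter> E. \<exists>r\<in>R'. \<exists>y\<in>M \<inter> E. x = r + of_int l * y"
      using finite_modE[OF fE] .
    have "\<exists>w\<in>E. r * v + w \<in> M" if "r \<in> Q" for r
      using that by (auto simp: Q_def)
    then obtain h where h: "\<And>r. r \<in> Q \<Longrightarrow> h r \<in> E" "\<And>r. r \<in> Q \<Longrightarrow> r * v + h r \<in> M"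
      by metis
    let ?R = "(\<lambda>(r, s). r * v + h r + s) ` (R \<times> R')"
    have "\<exists>r\<in>?R. \<exists>y\<in>M. x = r + of_int l * y" if x: "x \<in> M" for x
    proof -
      obtain k w where k: "k \<in> \<rat>" "w \<in> E" "x = k * v + w"
        using x ME mem by blast
      then have "k \<in> Q" using x by (auto simp: Q_def)
      then obtain r y where r: "r \<in> R" "y \<in> Q" "k = r + of_int l * y" using bspec[OF R(3)] by blast
      have rQ: "r \<in> Q" using r R by auto
      \<comment> \<open>Subtracting the lifts \<open>r * v + h r\<close> and
        \<open>y * v + h y\<close>, which lie in \<open>M\<close>, removes the \<open>v\<close> part
        of \<open>x\<close>. The error \<open>z\<close> lies in \<open>M \<inter> E\<close>, where
        the induction hypothesis applies.\<close>
      define z where "z = x - (r * v + h r) - of_int l * (y * v + h y)"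
      have "z \<in> M" unfolding z_def
        by (intro Ms(4) x h(2) rQ add_subgroup_of_int_mult[OF M] r(2))
      moreover have "z = w - h r - of_int l * h y"
        by (simp add: z_def k(3) r(3) algebra_simps)
      then have "z \<in> E"
        by (metis Es(4) k(2) h(1)[OF rQ] h(1)[OF r(2)] add_subgroup_of_int_mult[OF E])
      ultimately obtain s t where s: "s \<in> R'" "t \<in> M" "z = s + of_int l * t"
        using bspec[OF R'(3), of z] by blast
      have "x = (r * v + h r + s) + of_int l * (y * v + h y + t)"
        using s(3) by (simp add: z_def algebra_simps)
      moreover have "y * v + h y + t \<in> M" by (intro Ms(3) h(2) r(2) s(2))
      ultimately show ?thesis using r(1) s(1) by force
    qed
    moreover have "?R \<subseteq> M"
      using R(2) R'(2) by (auto intro!: Ms(3) h(2))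
    moreover have "finite ?R" using R(1) R'(1) by simp
    ultimately show "finite_mod (of_int l) M"
      by (intro finite_modI[of ?R])
  qed
qed

lemma finite_mod_mult:
  fixes M :: "'a::comm_ring_1 set"
  assumes "add_subgroup M" "\<And>x. x \<in> M \<Longrightarrow> a * x \<in> M" "finite_mod a M" "finite_mod b M"
  shows "finite_mod (a * b) M"
proof -
  obtain R where R: "finite R" "R \<subseteq> M" "\<forall>x\<in>M. \<exists>r\<in>R. \<exists>y\<in>M. x = r + a * y"
    using finite_modE[OF assms(3)] .
  obtain R' where R': "finite R'" "R' \<subseteq> M" "\<forall>x\<in>M. \<exists>r\<in>R'. \<exists>y\<in>M. x = r + b * y"
    using finite_modE[OF assms(4)] .
  let ?R = "(\<lambda>(r, s). r + a * s) ` (R \<times> R')"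
  have "\<exists>r\<in>?R. \<exists>y\<in>M. x = r + a * b * y" if x: "x \<in> M" for x
  proof -
    obtain r y where r: "r \<in> R" "y \<in> M" "x = r + a * y" using bspec[OF R(3) x] by blast
    obtain s z where s: "s \<in> R'" "z \<in> M" "y = s + b * z" using bspec[OF R'(3) r(2)] by blast
    have "x = (r + a * s) + a * b * z" by (simp add: r(3) s(3) algebra_simps)
    then show ?thesis using r(1) s(1,2) by force
  qed
  moreover have "?R \<subseteq> M"
    using R(2) R'(2) by (auto intro!: add_subgroup_closed(3)[OF assms(1)] assms(2))
  moreover have "finite ?R" using R(1) R'(1) by simp
  ultimately show ?thesis
    by (intro finite_modI[of ?R])
qed

lemma finite_mod_pigeonhole:
  fixes s :: "nat \<Rightarrow> 'a::ring_1"
  assumes "finite_mod a M" "add_subgroup M" "\<And>k. s k \<in> M"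
  obtains i j y where "i < j" "y \<in> M" "s j - s i = a * y"
proof -
  obtain R where R: "finite R" "R \<subseteq> M" "\<forall>x\<in>M. \<exists>r\<in>R. \<exists>y\<in>M. x = r + a * y"
    using finite_modE[OF assms(1)] .
  define f where "f k = (SOME r. r \<in> R \<and> (\<exists>y\<in>M. s k = r + a * y))" for k
  have f: "f k \<in> R \<and> (\<exists>y\<in>M. s k = f k + a * y)" for k
    unfolding f_def by (rule someI_ex) (use bspec[OF R(3) assms(3)[of k]] in blast)
  have "range f \<subseteq> R" using f by blast
  then have "\<not> inj f" using R(1) by (meson finite_imageD finite_subset infinite_UNIV_nat)
  then obtain i j where ij: "i < j" "f i = f j"
    unfolding inj_def by (metis linorder_neqE_nat)
  obtain y where y: "y \<in> M" "s i = f i + a * y" using f[of i] by blast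
  obtain z where z: "z \<in> M" "s j = f j + a * z" using f[of j] by blast
  have "s j - s i = a * (z - y)"
    using ij(2) by (simp add: y(2) z(2) right_diff_distrib)
  then show ?thesis by (rule that[OF ij(1) add_subgroup_closed(4)[OF assms(2) z(1) y(1)]])
qed

section \<open>Fractional ideals are invertible\<close>

abbreviation ideal_mult :: "'a::field_char_0 set \<Rightarrow> 'a set \<Rightarrow> 'a set" (infixl \<open>\<star>\<close> 70) where
  "I \<star> J \<equiv> ideal_prod ambient I J"

text \<open>\<open>ideal_prod\<close> never refers to the carrier, so products formed in
  \<open>field_ring F\<close>, in \<open>ring_of_integers F\<close> and in the ambient field
  coincide, and one operation serves for all.\<close>

lemma ideal_prod_cong:
  assumes "monoid.mult R = monoid.mult S" "add R = add S"
  shows "ideal_prod R I J = ideal_prod S I J"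
proof -
  have "x \<in> ideal_prod S I J"
    if "x \<in> ideal_prod R I J" "monoid.mult R = monoid.mult S" "add R = add S"
    for x and R :: "('a, 'd) ring_scheme" and S :: "('a, 'e) ring_scheme"
    using that(1)
  proof (induction rule: ideal_prod.induct)
    case (prod i j)
    then show ?case using ideal_prod.prod[of i I j J S] that(2) by simp
  next
    case (sum s1 s2)
    then show ?case using ideal_prod.sum[of s1 S I J s2] that(3) by simp
  qed
  from this[of _ R S] this[of _ S R] assms show ?thesis by auto
qed

lemma ideal_prod_field_ring: "ideal_prod (field_ring F) = ideal_prod ambient"
  by (intro ext ideal_prod_cong) (simp_all add: field_ring_def)

lemma ideal_prod_ring_of_integers: "ideal_prod (ring_of_integers F) = ideal_prod ambient"
  by (intro ext ideal_prod_cong) (simp_all add: ring_of_integers_def)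

lemma ideal_mult_prod: "i \<in> I \<Longrightarrow> j \<in> J \<Longrightarrow> i * j \<in> I \<star> J"
  using ideal_prod.prod[of i I j J ambient] by simp

lemma ideal_mult_add: "x \<in> I \<star> J \<Longrightarrow> y \<in> I \<star> J \<Longrightarrow> x + y \<in> I \<star> J"
  using ideal_prod.sum[of x ambient I J y] by simp

lemma ideal_mult_least:
  assumes "\<And>i j. i \<in> I \<Longrightarrow> j \<in> J \<Longrightarrow> i * j \<in> M" "\<And>x y. x \<in> M \<Longrightarrow> y \<in> M \<Longrightarrow> x + y \<in> M"
  shows "I \<star> J \<subseteq> M"
proof
  fix x assume "x \<in> I \<star> J"
  then show "x \<in> M" by (induction rule: ideal_prod.induct) (use assms in auto)
qed

lemma ideal_mult_mono: "I \<subseteq> I' \<Longrightarrow> J \<subseteq> J' \<Longrightarrow> I \<star> J \<subseteq> I' \<star> J'"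
  by (rule ideal_mult_least) (auto intro: ideal_mult_prod ideal_mult_add)

lemma ideal_mult_commute: "I \<star> J = J \<star> I"
proof -
  have "I \<star> J \<subseteq> J \<star> I" for I J :: "'a::field_char_0 set"
    by (rule ideal_mult_least) (metis ideal_mult_prod mult.commute, rule ideal_mult_add)
  then show ?thesis by blast
qed

lemma ideal_mult_assoc_subset: "(I \<star> J) \<star> M \<subseteq> I \<star> (J \<star> M)"
proof (rule ideal_mult_least)
  fix x k assume x: "x \<in> I \<star> J" and k: "k \<in> M"
  have "I \<star> J \<subseteq> {x. x * k \<in> I \<star> (J \<star> M)}"
  proof (rule ideal_mult_least)
    fix i j assume "i \<in> I" "j \<in> J"
    then show "i * j \<in> {x. x * k \<in> I \<star> (J \<star> M)}"
      using ideal_mult_prod[of i I "j * k" "J \<star> M"] ideal_mult_prod[of j J k M] k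
      by (simp add: mult.assoc)
  qed (simp add: distrib_right ideal_mult_add)
  then show "x * k \<in> I \<star> (J \<star> M)" using x by blast
qed (rule ideal_mult_add)

lemma ideal_mult_assoc: "(I \<star> J) \<star> M = I \<star> (J \<star> M)"
proof (rule equalityI[OF ideal_mult_assoc_subset])
  have "I \<star> (J \<star> M) = (M \<star> J) \<star> I" by (metis ideal_mult_commute)
  also have "\<dots> \<subseteq> M \<star> (J \<star> I)" by (rule ideal_mult_assoc_subset)
  also have "\<dots> = (I \<star> J) \<star> M" by (metis ideal_mult_commute)
  finally show "I \<star> (J \<star> M) \<subseteq> (I \<star> J) \<star> M" .
qed

lemma add_subgroup_ideal_mult:
  assumes "add_subgroup I" "0 \<in> J"
  shows "add_subgroup (I \<star> J)"
proof (rule add_subgroupI)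
  note Is = add_subgroup_closed[OF assms(1)]
  show "0 \<in> I \<star> J" using ideal_mult_prod[OF Is(1) assms(2)] by simp
  have neg: "I \<star> J \<subseteq> {x. - x \<in> I \<star> J}"
  proof (rule ideal_mult_least)
    fix i j assume "i \<in> I" "j \<in> J"
    then show "i * j \<in> {x. - x \<in> I \<star> J}"
      using ideal_mult_prod[OF Is(2), of i j J] by simp
  next
    fix x y assume "x \<in> {x. - x \<in> I \<star> J}" "y \<in> {x. - x \<in> I \<star> J}"
    then show "x + y \<in> {x. - x \<in> I \<star> J}"
      using ideal_mult_add[of "- x" I J "- y"] by simp
  qed
  fix x y assume "x \<in> I \<star> J" "y \<in> I \<star> J"
  then show "x - y \<in> I \<star> J" using ideal_mult_add[of x I J "- y"] neg by auto
qed

lemma subfield_ambientD: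
  fixes F :: "'a::field_char_0 set"
  assumes "subfield F ambient"
  shows "0 \<in> F" "1 \<in> F" "x \<in> F \<Longrightarrow> y \<in> F \<Longrightarrow> x + y \<in> F" "x \<in> F \<Longrightarrow> - x \<in> F"
    "x \<in> F \<Longrightarrow> y \<in> F \<Longrightarrow> x * y \<in> F" "x \<in> F \<Longrightarrow> inverse x \<in> F"
proof -
  note sr = subringE[OF subfieldE(1)[OF assms]]
  show "0 \<in> F" "1 \<in> F" "x \<in> F \<Longrightarrow> y \<in> F \<Longrightarrow> x + y \<in> F" "x \<in> F \<Longrightarrow> - x \<in> F"
    "x \<in> F \<Longrightarrow> y \<in> F \<Longrightarrow> x * y \<in> F"
    using sr(2) sr(3) sr(7)[of x y] sr(5)[of x] sr(6)[of x y] by simp_all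
  show "inverse x \<in> F" if "x \<in> F"
  proof (cases "x = 0")
    case False
    then show ?thesis
      using ring.subfield_m_inv(1)[OF ring_ambient assms, of x] that
      by (simp add: ambient_inv)
  qed (use sr(2) in simp)
qed

section \<open>Integers of a number field\<close>

locale nfield =
  fixes L :: "'a::field_char_0 set"
  assumes number_field: "number_field L"
begin

lemma L_subfield: "subfield L ambient"
  using number_field by (simp add: number_field_def)

lemmas L_closed = subfield_ambientD[OF L_subfield]

lemma L_add_subgroup: "add_subgroup L"
  by (rule add_subgroupI) (use L_closed(1) L_closed(3)[OF _ L_closed(4)] in auto)

lemma L_diff: "x \<in> L \<Longrightarrow> y \<in> L \<Longrightarrow> x - y \<in> L"
  by (rule add_subgroup_closed(4)[OF L_add_subgroup])

lemma L_of_int: "of_int n \<in> L"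
  using add_subgroup_of_int_mult[OF L_add_subgroup L_closed(2)] by simp

lemma L_power: "x \<in> L \<Longrightarrow> x ^ n \<in> L"
  by (induction n) (auto intro: L_closed)

lemma finite_mod_prime:
  assumes "add_subgroup M" "M \<subseteq> L" "Factorial_Ring.prime l"
  shows "finite_mod (of_int l) M"
proof -
  obtain n where "ring.dimension ambient n \<rat> L"
    using number_field ring.finite_dimension_def[OF ring_ambient]
    unfolding number_field_def by blast
  from finite_mod_prime_dimension[OF this assms(3)] assms show ?thesis by blast
qed

definition ints :: "'a set" where "ints = {x \<in> L. algebraic_int x}"

lemma carrier_ring_of_integers: "carrier (ring_of_integers L) = ints"
  by (simp add: ring_of_integers_def ints_def)

lemma ints_L: "x \<in> ints \<Longrightarrow> x \<in> L"
  by (simp add: ints_def)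

lemma ints_closed:
  "0 \<in> ints" "1 \<in> ints" "x \<in> ints \<Longrightarrow> y \<in> ints \<Longrightarrow> x + y \<in> ints"
  "x \<in> ints \<Longrightarrow> - x \<in> ints" "x \<in> ints \<Longrightarrow> y \<in> ints \<Longrightarrow> x * y \<in> ints"
  using algebraic_int_of_int[of 1]
  by (auto simp: ints_def intro: L_closed algebraic_int_add_mult)

lemma ints_add_subgroup: "add_subgroup ints"
  by (rule add_subgroupI) (use ints_closed(1) ints_closed(3)[OF _ ints_closed(4)] in auto)

lemma ints_diff: "x \<in> ints \<Longrightarrow> y \<in> ints \<Longrightarrow> x - y \<in> ints"
  by (rule add_subgroup_closed(4)[OF ints_add_subgroup])

lemma ints_of_int: "of_int n \<in> ints"
  by (simp add: ints_def L_of_int algebraic_int_of_int)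

lemma ints_power: "x \<in> ints \<Longrightarrow> x ^ n \<in> ints"
  by (induction n) (auto intro: ints_closed)

lemma ints_poly: "x \<in> ints \<Longrightarrow> poly (map_poly of_int p) x \<in> ints"
  by (induction p) (auto simp: hom_distribs intro: ints_closed ints_of_int)

lemma finite_mod_nat: "n > 0 \<Longrightarrow> finite_mod (of_nat n) ints"
proof (induction n rule: less_induct)
  case (less n)
  show ?case
  proof (cases "n = 1")
    case True
    then show ?thesis
      using ints_closed(1) by (intro finite_modI[of "{0}"]) auto
  next
    case False
    then obtain p where p: "Factorial_Ring.prime p" "p dvd n"
      using prime_factor_nat by blast
    then obtain k where k: "n = p * k" by blast
    have "finite_mod (of_nat p) ints"
      using finite_mod_prime[OF ints_add_subgroup _, of "int p"] p(1) by (auto simp: ints_def)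
    moreover have "k < n" "k > 0"
      using less.prems k prime_gt_1_nat[OF p(1)] by auto
    then have "finite_mod (of_nat k) ints" by (rule less.IH)
    moreover have "of_nat p * x \<in> ints" if "x \<in> ints" for x
      using ints_closed(5)[OF ints_of_int[of "int p"] that] by simp
    ultimately show ?thesis
      using finite_mod_mult[OF ints_add_subgroup, of "of_nat p" "of_nat k"] by (simp add: k)
  qed
qed

text \<open>A nonzero integer \<open>a\<close> divides some positive rational integer
  \<open>n = a * c\<close> with \<open>c\<close> integral, and representatives modulo
  \<open>n\<close> also serve modulo \<open>a\<close>.\<close>

lemma finite_mod_ints:
  assumes a: "a \<in> ints" "a \<noteq> 0"
  shows "finite_mod a ints"
proof -
  obtain m p where m: "m \<noteq> 0" "of_int m = a * poly (map_poly of_int p) a"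
    using algebraic_int_dvd_int[of a] a by (auto simp: ints_def)
  define b where "b = poly (map_poly of_int p) a"
  have b: "b \<in> ints" unfolding b_def by (rule ints_poly[OF a(1)])
  have "of_nat (nat \<bar>m\<bar>) = a * b \<or> of_nat (nat \<bar>m\<bar>) = a * (- b)"
    using m(2) by (auto simp: b_def abs_if simp flip: m(2))
  then obtain c where c: "c \<in> ints" "of_nat (nat \<bar>m\<bar>) = a * c"
    using b ints_closed(4)[OF b] by blast
  have "finite_mod (a * c) ints"
    using finite_mod_nat[of "nat \<bar>m\<bar>"] m(1) c(2) by simp
  from finite_modE[OF this] obtain R where R: "finite R" "R \<subseteq> ints"
    "\<forall>x\<in>ints. \<exists>r\<in>R. \<exists>y\<in>ints. x = r + a * c * y" .
  show ?thesis
  proof (rule finite_modI[OF R(1,2)])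
    fix x assume "x \<in> ints"
    then obtain r y where "r \<in> R" "y \<in> ints" "x = r + a * (c * y)"
      using R(3) by (metis mult.assoc)
    then show "\<exists>r\<in>R. \<exists>y\<in>ints. x = r + a * y"
      using ints_closed(5)[OF c(1)] by blast
  qed
qed

lemma ints_pigeonhole:
  fixes s :: "nat \<Rightarrow> 'a"
  assumes "a \<in> ints" "a \<noteq> 0" "\<And>k. s k \<in> ints"
  obtains i j y where "i < j" "y \<in> ints" "s j - s i = a * y"
  using finite_mod_pigeonhole[of a ints s, OF finite_mod_ints[OF assms(1,2)] ints_add_subgroup assms(3)] .

text \<open>Integral closedness without the Cayley--Hamilton theorem: as \<open>\<O>\<close> has finite index in
  \<open>a\<inverse>\<O>\<close>, two powers of \<open>x\<close> are congruent modulo \<open>\<O>\<close>.\<close>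

lemma ints_of_bounded_powers:
  assumes "x \<in> L" "a \<in> ints" "a \<noteq> 0" "\<And>k. a * x ^ k \<in> ints"
  shows "x \<in> ints"
proof -
  obtain i j y where ij: "i < j" "y \<in> ints" "a * x ^ j - a * x ^ i = a * y"
    using ints_pigeonhole[of a "\<lambda>k. a * x ^ k", OF assms(2-4)] .
  then have "a * (x ^ j - x ^ i) = a * y" by (simp add: right_diff_distrib)
  then have "x ^ j - x ^ i = y" using assms(3) by simp
  then have "algebraic_int (x ^ j - x ^ i)" using ij(2) by (simp add: ints_def)
  from algebraic_int_of_power_diff[OF this ij(1)] show ?thesis
    using assms(1) by (simp add: ints_def)
qed

text \<open>Algebraicity of \<open>x\<close> is drawn from finiteness alone: in
  \<open>M = \<int>[x]\<close> two powers of \<open>x\<close> are congruent modulo 2, which gives an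
  integer polynomial with root \<open>x\<close>. Clearing its leading coefficient yields
  \<open>d\<close>.\<close>

lemma L_multiple:
  assumes x: "x \<in> L"
  obtains d :: int where "d \<noteq> 0" "of_int d * x \<in> ints"
proof -
  define M where "M = range (\<lambda>p :: int poly. poly (map_poly of_int p) x)"
  have M: "add_subgroup M"
  proof (rule add_subgroupI)
    show "0 \<in> M" unfolding M_def by (rule range_eqI[of _ _ 0]) simp
    fix y z assume "y \<in> M" "z \<in> M"
    then obtain p q :: "int poly"
      where "y = poly (map_poly of_int p) x" "z = poly (map_poly of_int q) x"
      unfolding M_def by auto
    then show "y - z \<in> M"
      unfolding M_def by (intro range_eqI[of _ _ "p - q"]) (simp add: hom_distribs)
  qed
  have "poly (map_poly of_int p) x \<in> L" for p :: "int poly"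
    by (induction p) (auto simp: hom_distribs x intro!: L_closed L_of_int)
  then have "M \<subseteq> L" by (auto simp: M_def)
  with M have fm: "finite_mod (of_int 2) M" by (rule finite_mod_prime) simp
  have pw: "x ^ k \<in> M" for k
    unfolding M_def
    by (rule range_eqI[of _ _ "Polynomial.monom 1 k"]) (simp add: poly_monom)
  obtain i j y where ij: "i < j" "y \<in> M" "x ^ j - x ^ i = of_int 2 * y"
    using finite_mod_pigeonhole[of "of_int 2" M "\<lambda>k. x ^ k", OF fm M pw] .
  then obtain g :: "int poly" where g: "y = poly (map_poly of_int g) x"
    unfolding M_def by auto
  define p where "p = Polynomial.monom 1 j - Polynomial.monom 1 i - Polynomial.smult 2 g"
  have "poly (map_poly of_int p) x = 0"
    using ij(3) g by (simp add: p_def hom_distribs poly_monom)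
  \<comment> \<open>The coefficient at \<open>j\<close> is \<open>1 - 2 * coeff g j\<close>, hence
    odd whatever \<open>g\<close> is; so the relation is not trivial.\<close>
  moreover have "odd (coeff p j)"
    using ij(1) by (simp add: p_def)
  then have "p \<noteq> 0" by auto
  ultimately obtain d :: int where "d \<noteq> 0" "algebraic_int (of_int d * x)"
    using algebraic_imp_multiple_algebraic_int by blast
  then show ?thesis
    using that[of d] x by (simp add: ints_def L_closed L_of_int)
qed

section \<open>Submodules of L and fractional ideals\<close>

definition submodule_L :: "'a set \<Rightarrow> bool" where
  "submodule_L I \<longleftrightarrow> I \<subseteq> L \<and> add_subgroup I \<and> (\<forall>a\<in>ints. \<forall>x\<in>I. a * x \<in> I)"

lemma submodule_LD:
  assumes "submodule_L I"
  shows "I \<subseteq> L" "add_subgroup I" "a \<in> ints \<Longrightarrow> x \<in> I \<Longrightarrow> a * x \<in> I"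
    "a \<in> ints \<Longrightarrow> x \<in> I \<Longrightarrow> x * a \<in> I"
    "0 \<in> I" "x \<in> I \<Longrightarrow> - x \<in> I"
    "x \<in> I \<Longrightarrow> y \<in> I \<Longrightarrow> x + y \<in> I" "x \<in> I \<Longrightarrow> y \<in> I \<Longrightarrow> x - y \<in> I"
proof -
  show "I \<subseteq> L" and I: "add_subgroup I" and "a \<in> ints \<Longrightarrow> x \<in> I \<Longrightarrow> a * x \<in> I"
    using assms by (auto simp: submodule_L_def)
  then show "a \<in> ints \<Longrightarrow> x \<in> I \<Longrightarrow> x * a \<in> I" by (simp add: mult.commute)
  show "0 \<in> I" "x \<in> I \<Longrightarrow> - x \<in> I"
    "x \<in> I \<Longrightarrow> y \<in> I \<Longrightarrow> x + y \<in> I" "x \<in> I \<Longrightarrow> y \<in> I \<Longrightarrow> x - y \<in> I"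
    by (simp_all add: add_subgroup_closed[OF I])
qed

lemma submodule_LI:
  assumes "I \<subseteq> L" "0 \<in> I" "\<And>x y. x \<in> I \<Longrightarrow> y \<in> I \<Longrightarrow> x + y \<in> I"
    "\<And>a x. a \<in> ints \<Longrightarrow> x \<in> I \<Longrightarrow> a * x \<in> I"
  shows "submodule_L I"
proof -
  have "x - y \<in> I" if "x \<in> I" "y \<in> I" for x y
    using assms(3)[OF that(1) assms(4)[OF ints_of_int[of "-1"] that(2)]] by simp
  then show ?thesis
    using assms by (auto simp: submodule_L_def intro: add_subgroupI)
qed

lemma submodule_ints: "submodule_L ints"
  by (rule submodule_LI) (auto intro: ints_closed ints_L)

definition fideal :: "'a set \<Rightarrow> bool" where
  "fideal I \<longleftrightarrow> submodule_L I \<and> I \<noteq> {0} \<and> (\<exists>d\<in>ints. d \<noteq> 0 \<and> (\<forall>x\<in>I. d * x \<in> ints))"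

lemma fideal_nonzero:
  assumes "fideal I"
  obtains x where "x \<in> I" "x \<noteq> 0"
proof -
  have "0 \<in> I" "I \<noteq> {0}" using assms submodule_LD(5) by (auto simp: fideal_def)
  then show ?thesis using that by blast
qed

lemma fidealD: "fideal I \<Longrightarrow> submodule_L I"
  by (simp add: fideal_def)

lemma submodule_ideal_mult:
  assumes "submodule_L I" "submodule_L J"
  shows "submodule_L (I \<star> J)"
proof (rule submodule_LI)
  note I = submodule_LD[OF assms(1)] and J = submodule_LD[OF assms(2)]
  show "I \<star> J \<subseteq> L"
    by (rule ideal_mult_least) (use I(1) J(1) in \<open>auto intro: L_closed\<close>)
  show "0 \<in> I \<star> J"
    by (rule add_subgroup_closed(1)[OF add_subgroup_ideal_mult[OF I(2) J(5)]])
  show "x + y \<in> I \<star> J" if "x \<in> I \<star> J" "y \<in> I \<star> J" for x y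
    using that by (rule ideal_mult_add)
  show "a * x \<in> I \<star> J" if "a \<in> ints" "x \<in> I \<star> J" for a x
  proof -
    have "I \<star> J \<subseteq> {x. a * x \<in> I \<star> J}"
      by (rule ideal_mult_least)
        (auto simp: mult.assoc[symmetric] distrib_left intro: ideal_mult_prod ideal_mult_add I(3)[OF that(1)])
    then show ?thesis using that by blast
  qed
qed

lemma ideal_mult_ints:
  assumes "submodule_L I"
  shows "ints \<star> I = I" "I \<star> ints = I"
proof -
  note I = submodule_LD[OF assms]
  show "ints \<star> I = I"
  proof
    show "ints \<star> I \<subseteq> I" by (rule ideal_mult_least) (auto intro: I)
    show "I \<subseteq> ints \<star> I" using ideal_mult_prod[OF ints_closed(2), of _ I] by auto
  qed
  then show "I \<star> ints = I" by (simp add: ideal_mult_commute)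
qed

lemma fideal_mult:
  assumes "fideal I" "fideal J"
  shows "fideal (I \<star> J)"
proof -
  have s: "submodule_L I" "submodule_L J" using assms by (auto intro: fidealD)
  obtain d where d: "d \<in> ints" "d \<noteq> 0" "\<And>x. x \<in> I \<Longrightarrow> d * x \<in> ints"
    using assms(1) by (auto simp: fideal_def)
  obtain e where e: "e \<in> ints" "e \<noteq> 0" "\<And>x. x \<in> J \<Longrightarrow> e * x \<in> ints"
    using assms(2) by (auto simp: fideal_def)
  obtain x y where "x \<in> I" "x \<noteq> 0" "y \<in> J" "y \<noteq> 0"
    using fideal_nonzero[OF assms(1)] fideal_nonzero[OF assms(2)] by metis
  then have "x * y \<in> I \<star> J" "x * y \<noteq> 0" by (auto intro: ideal_mult_prod)
  then have "I \<star> J \<noteq> {0}" by blast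
  moreover have "I \<star> J \<subseteq> {x. d * e * x \<in> ints}"
  proof (rule ideal_mult_least)
    fix i j assume "i \<in> I" "j \<in> J"
    then have "(d * i) * (e * j) \<in> ints" by (intro ints_closed(5) d(3) e(3))
    then show "i * j \<in> {x. d * e * x \<in> ints}" by (simp add: mult_ac)
  qed (simp add: distrib_left ints_closed)
  ultimately show ?thesis
    unfolding fideal_def using submodule_ideal_mult[OF s] d(1,2) e(1,2)
    by (intro conjI bexI[of _ "d * e"] ints_closed(5)) auto
qed

lemma fideal_ints: "fideal ints"
  unfolding fideal_def
proof (intro conjI bexI[of _ 1])
  show "ints \<noteq> {0}" using ints_closed(2) by auto
qed (auto simp: submodule_ints ints_closed)

lemma fideal_principal:
  assumes x: "x \<in> L" "x \<noteq> 0"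
  shows "fideal ((\<lambda>a. x * a) ` ints)" (is "fideal ?I")
  unfolding fideal_def
proof (intro conjI)
  show "submodule_L ?I"
  proof (rule submodule_LI)
    show "?I \<subseteq> L" by (auto intro: L_closed x ints_L)
    show "0 \<in> ?I" by (rule image_eqI[of _ _ 0]) (simp_all add: ints_closed)
    show "u + v \<in> ?I" if uv: "u \<in> ?I" "v \<in> ?I" for u v
    proof -
      obtain a b where "u = x * a" "v = x * b" "a \<in> ints" "b \<in> ints" using uv by auto
      then show ?thesis by (intro image_eqI[of _ _ "a + b"]) (simp_all add: distrib_left ints_closed)
    qed
    show "a * u \<in> ?I" if au: "a \<in> ints" "u \<in> ?I" for a u
    proof -
      obtain b where "u = x * b" "b \<in> ints" using au by auto
      then show ?thesis using au by (intro image_eqI[of _ _ "a * b"]) (simp_all add: mult_ac ints_closed)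
    qed
  qed
  have "x * 1 \<in> ?I" using ints_closed(2) by blast
  then show "?I \<noteq> {0}" using x by auto
  obtain d :: int where d: "d \<noteq> 0" "of_int d * x \<in> ints" using L_multiple[OF x(1)] .
  then show "\<exists>d\<in>ints. d \<noteq> 0 \<and> (\<forall>u\<in>?I. d * u \<in> ints)"
    by (intro bexI[of _ "of_int d"] conjI)
      (auto simp: ints_of_int mult.assoc[symmetric] intro: ints_closed)
qed

lemma fideal_integral:
  assumes "submodule_L I" "I \<subseteq> ints" "I \<noteq> {0}"
  shows "fideal I"
  unfolding fideal_def using assms ints_closed(2) by (auto intro!: bexI[of _ 1])

text \<open>Among the \<open>r\<close> whose annihilator modulo \<open>a\<close> is not comaximal with \<open>J\<close>, one with maximal
  annihilator is annihilated by all of \<open>J\<close>; such a maximum exists because \<open>\<O>/a\<close> is finite.\<close>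

lemma proper_ideal_annihilator:
  assumes J: "submodule_L J" "J \<subseteq> ints" "1 \<notin> J" and a: "a \<in> J" "a \<noteq> 0"
  obtains b where "b \<in> ints" "\<And>x. x \<in> J \<Longrightarrow> \<exists>y\<in>ints. b * x = a * y" "\<And>y. y \<in> ints \<Longrightarrow> b \<noteq> a * y"
proof -
  note Js = submodule_LD[OF J(1)]
  have aB: "a \<in> ints" using a J by auto
  define A where "A = (\<lambda>y. a * y) ` ints"
  have A: "submodule_L A"
    unfolding A_def using fideal_principal[of a] a(2) ints_L[OF aB] by (auto dest: fidealD)
  note As = submodule_LD[OF A]
  have aA: "a * y \<in> A" if "y \<in> ints" for y using that by (auto simp: A_def)
  define ann where "ann r = {y \<in> ints. r * y \<in> A}" for r
  have ann_add: "x + y \<in> ann r" if "x \<in> ann r" "y \<in> ann r" for x y r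
    using that As(7)[of "r * x" "r * y"] by (auto simp: ann_def distrib_left intro: ints_closed)
  have ann_neg: "- x \<in> ann r" if "x \<in> ann r" for x r
    using that As(6)[of "r * x"] by (auto simp: ann_def intro: ints_closed)
  have ann_mult: "ann r \<subseteq> ann (r * u)" if "u \<in> ints" for r u
  proof
    fix y assume "y \<in> ann r"
    then show "y \<in> ann (r * u)"
      using As(3)[OF that, of "r * y"] by (auto simp: ann_def mult_ac)
  qed
  have A_ann: "A \<subseteq> ann r" if "r \<in> ints" for r
    using As(3)[OF that] by (auto simp: ann_def A_def intro: ints_closed aB)
  define good where "good r \<longleftrightarrow> r \<in> ints \<and> (\<forall>u\<in>ann r. \<forall>j\<in>J. u + j \<noteq> 1)" for r
  obtain R where R: "finite R" "R \<subseteq> ints" "\<forall>x\<in>ints. \<exists>r\<in>R. \<exists>y\<in>ints. x = r + a * y"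
    using finite_modE[OF finite_mod_ints[OF aB a(2)]] .
  \<comment> \<open>Every annihilator contains \<open>A\<close>, so it is determined by its members
    among the finitely many representatives in \<open>R\<close>. Cardinalities therefore detect
    strict inclusions, and a maximal annihilator can be found as a greatest natural number.\<close>
  have strict: "card (ann r \<inter> R) < card (ann r' \<inter> R)"
    if r: "r' \<in> ints" "ann r \<subseteq> ann r'" "p \<in> ann r'" "p \<notin> ann r" "r \<in> ints" for r r' p
  proof -
    have "p \<in> ints" using r(3) by (simp add: ann_def)
    then obtain s y where s: "s \<in> R" "y \<in> ints" "p = s + a * y" using R(3) by blast
    have ay: "a * y \<in> ann r" "a * y \<in> ann r'" using A_ann r(1,5) aA[OF s(2)] by auto
    have "s \<in> ann r'" using ann_add[OF r(3) ann_neg[OF ay(2)]] by (simp add: s(3))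
    moreover have "s \<notin> ann r" using ann_add[OF _ ay(1), of s] r(4) by (auto simp: s(3))
    ultimately have "ann r \<inter> R \<subset> ann r' \<inter> R" using s(1) r(2) by blast
    then show ?thesis using R(1) by (intro psubset_card_mono) auto
  qed
  \<comment> \<open>\<open>ann 1\<close> is \<open>A\<close>, which lies in \<open>J\<close>, and
    \<open>1 \<notin> J\<close>.\<close>
  have "good 1"
    unfolding good_def
  proof (intro conjI ballI notI)
    fix u j assume "u \<in> ann 1" "j \<in> J" "u + j = 1"
    moreover from this obtain y where "u = a * y" "y \<in> ints" by (auto simp: ann_def A_def)
    ultimately show False using Js(7)[OF Js(4)[OF _ a(1)], of y j] J(3) by simp
  qed (rule ints_closed)
  moreover have "card (ann r \<inter> R) < Suc (card R)" for r
    using card_mono[OF R(1), of "ann r \<inter> R"] by simp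
  ultimately obtain r where r: "good r" "\<forall>r'. good r' \<longrightarrow> card (ann r' \<inter> R) \<le> card (ann r \<inter> R)"
    using ex_has_greatest_nat[of good 1 "\<lambda>r. card (ann r \<inter> R)" "Suc (card R)"] by blast
  have rB: "r \<in> ints" using r(1) by (simp add: good_def)
  have maximal: "p \<in> ann r" if "good r'" "ann r \<subseteq> ann r'" "p \<in> ann r'" for r' p
    using strict[OF _ that(2,3) _ rB] r(2) that(1) by (force simp: good_def)
  have "J \<subseteq> ann r"
  proof
    fix p assume p: "p \<in> J"
    then have pB: "p \<in> ints" using J(2) by auto
    show "p \<in> ann r"
    proof (cases "good (r * p)")
      case True
      \<comment> \<open>By maximality \<open>ann (r * p ^ k)\<close> stays within
        \<open>ann r\<close>. Two powers of \<open>p\<close> agree modulo \<open>a\<close>, which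
        puts \<open>1 - p ^ (j - i)\<close> into \<open>ann r\<close>; together with
        \<open>p ^ (j - i)\<close> in \<open>J\<close> this contradicts
        \<open>good r\<close>.\<close>
      have step: "y \<in> ann r" if "y \<in> ann (r * p)" for y
        using maximal[OF True ann_mult[OF pB] that] .
      have pow: "y \<in> ann r" if "y \<in> ann (r * p ^ k)" for y k
        using that
      proof (induction k arbitrary: y)
        case (Suc k)
        then have "p * y \<in> ann (r * p ^ k)"
          using pB by (auto simp: ann_def mult_ac intro: ints_closed)
        then have "p * y \<in> ann r" by (rule Suc.IH)
        then have "y \<in> ann (r * p)" using Suc.prems by (auto simp: ann_def mult_ac)
        then show ?case by (rule step)
      qed simp
      obtain i j y where ij: "i < j" "y \<in> ints" "p ^ j - p ^ i = a * y"
        using ints_pigeonhole[of a "\<lambda>k. p ^ k", OF aB a(2) ints_power[OF pB]] .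
      define e where "e = p ^ (j - i) - 1"
      have "p ^ j = p ^ i * p ^ (j - i)" using ij(1) by (simp flip: power_add)
      then have "r * p ^ i * e = r * (a * y)"
        unfolding e_def ij(3)[symmetric] by (simp add: right_diff_distrib mult.assoc)
      then have "r * p ^ i * e \<in> A" using As(3)[OF rB aA[OF ij(2)]] by (simp only:)
      then have "e \<in> ann (r * p ^ i)"
        unfolding e_def ann_def by (simp add: ints_diff ints_power[OF pB] ints_closed)
      then have "- e \<in> ann r" by (intro ann_neg pow)
      moreover have "p ^ (j - i) = p ^ (j - i - 1) * p"
        using ij(1) by (metis Suc_diff_1 power_Suc2 zero_less_diff)
      then have "p ^ (j - i) \<in> J" using Js(3)[OF ints_power[OF pB] p] by simp
      ultimately show ?thesis using r(1) unfolding good_def e_def by fastforce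
    next
      case False
      \<comment> \<open>Here some \<open>u\<close> in \<open>ann (r * p)\<close> is congruent to 1
        modulo \<open>J\<close>. Then \<open>r * u\<close> is still good and is annihilated by
        \<open>p\<close>, so maximality of \<open>ann r\<close> gives the claim.\<close>
      have "r * p \<in> ints" using rB pB by (rule ints_closed)
      with False obtain u j where u: "u \<in> ann (r * p)" "j \<in> J" "u + j = 1"
        by (auto simp: good_def)
      have uB: "u \<in> ints" using u by (simp add: ann_def)
      have "good (r * u)"
        unfolding good_def
      proof (intro conjI ballI notI)
        show "r * u \<in> ints" using rB uB by (rule ints_closed)
        fix v j' assume v: "v \<in> ann (r * u)" "j' \<in> J" "v + j' = 1"
        have "u * v \<in> ann r" using v(1) uB by (auto simp: ann_def mult_ac intro: ints_closed)
        moreover have "j + u * j' \<in> J" by (intro Js u v uB)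
        moreover have "u * v + (j + u * j') = 1"
          using u(3) v(3) by (metis add.assoc add.commute distrib_left mult.right_neutral)
        ultimately show False using r(1) by (auto simp: good_def)
      qed
      moreover have "p \<in> ann (r * u)" using u(1) pB by (auto simp: ann_def mult_ac)
      ultimately show ?thesis using maximal ann_mult[OF uB] by blast
    qed
  qed
  moreover have "r \<noteq> a * y" if "y \<in> ints" for y
  proof
    assume "r = a * y"
    then have "1 \<in> ann r" using that by (auto simp: ann_def ints_closed A_def)
    then show False using r(1) Js(5) unfolding good_def by force
  qed
  ultimately show ?thesis
    using that[OF rB] by (auto simp: ann_def A_def)
qed

definition inverse_ideal :: "'a set \<Rightarrow> 'a set" where
  "inverse_ideal I = {x \<in> L. \<forall>y\<in>I. x * y \<in> ints}"

lemma fideal_inverse_ideal: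
  assumes "fideal I"
  shows "fideal (inverse_ideal I)"
  unfolding fideal_def
proof (intro conjI)
  show "submodule_L (inverse_ideal I)"
    by (rule submodule_LI)
      (auto simp: inverse_ideal_def distrib_right mult.assoc intro: L_closed ints_closed ints_L)
  obtain d where "d \<in> ints" "d \<noteq> 0" "\<forall>x\<in>I. d * x \<in> ints"
    using assms by (auto simp: fideal_def)
  then have "d \<in> inverse_ideal I" by (simp add: inverse_ideal_def ints_L)
  with \<open>d \<noteq> 0\<close> show "inverse_ideal I \<noteq> {0}" by auto
  obtain y where y: "y \<in> I" "y \<noteq> 0" using fideal_nonzero[OF assms] .
  have "y \<in> L" using y submodule_LD(1)[OF fidealD[OF assms]] by auto
  then obtain e :: int where e: "e \<noteq> 0" "of_int e * y \<in> ints" using L_multiple by blast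
  have "of_int e * y * x \<in> ints" if "x \<in> inverse_ideal I" for x
  proof -
    have "x * y \<in> ints" using that y by (auto simp: inverse_ideal_def)
    from ints_closed(5)[OF ints_of_int[of e] this] show ?thesis by (simp add: mult_ac)
  qed
  then show "\<exists>d\<in>ints. d \<noteq> 0 \<and> (\<forall>x\<in>inverse_ideal I. d * x \<in> ints)"
    using e y by (intro bexI[of _ "of_int e * y"]) auto
qed

text \<open>Suppose \<open>J = I \<star> inverse_ideal I\<close> is proper, and let
  \<open>a \<noteq> 0\<close> lie in \<open>J\<close>. The annihilator lemma gives \<open>b\<close>
  outside \<open>a ints\<close> with \<open>b J\<close> inside \<open>a ints\<close>. Then
  \<open>x = b / a\<close> maps \<open>inverse_ideal I\<close> into itself, so its powers have a
  common denominator and \<open>x\<close> is integral, a contradiction.\<close>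

lemma ideal_mult_inverse_ideal:
  assumes I: "fideal I"
  shows "I \<star> inverse_ideal I = ints"
proof -
  let ?I' = "inverse_ideal I"
  let ?J = "I \<star> ?I'"
  have J: "fideal ?J" by (intro fideal_mult fideal_inverse_ideal I)
  note Js = submodule_LD[OF fidealD[OF J]]
  have JB: "?J \<subseteq> ints"
    by (rule ideal_mult_least) (auto simp: inverse_ideal_def mult.commute intro: ints_closed)
  have "1 \<in> ?J"
  proof (rule ccontr)
    assume "1 \<notin> ?J"
    obtain a where a: "a \<in> ?J" "a \<noteq> 0" using fideal_nonzero[OF J] .
    obtain b where b: "b \<in> ints" "\<And>x. x \<in> ?J \<Longrightarrow> \<exists>y\<in>ints. b * x = a * y"
      "\<And>y. y \<in> ints \<Longrightarrow> b \<noteq> a * y"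
      using proper_ideal_annihilator[OF fidealD[OF J] JB \<open>1 \<notin> ?J\<close> a] by metis
    have aL: "a \<in> L" using a JB ints_L by blast
    define x where "x = b * inverse a"
    have xL: "x \<in> L" unfolding x_def by (intro L_closed ints_L b aL)
    have xJ: "x * z \<in> ints" if "z \<in> ?J" for z
    proof -
      obtain y where "y \<in> ints" "b * z = a * y" using b(2)[OF \<open>z \<in> ?J\<close>] by blast
      then show ?thesis using a(2) by (simp add: x_def field_simps)
    qed
    have xI': "x * w \<in> ?I'" if "w \<in> ?I'" for w
      unfolding inverse_ideal_def
    proof (intro CollectI conjI ballI)
      show "x * w \<in> L" using that xL by (auto simp: inverse_ideal_def intro: L_closed)
      fix y assume "y \<in> I"
      from xJ[OF ideal_mult_prod[OF this that]] show "x * w * y \<in> ints" by (simp add: mult_ac)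
    qed
    obtain y where y: "y \<in> I" "y \<noteq> 0" using fideal_nonzero[OF I] .
    obtain w where w: "w \<in> ?I'" "w \<noteq> 0" using fideal_nonzero[OF fideal_inverse_ideal[OF I]] .
    have xk: "x ^ k * w \<in> ?I'" for k
      by (induction k) (use w xI' in \<open>auto simp: mult.assoc\<close>)
    have "w * y * x ^ k \<in> ints" for k
      using xk[of k] y(1) by (auto simp: inverse_ideal_def mult_ac)
    moreover have "w * y \<in> ints" using w y by (auto simp: inverse_ideal_def)
    ultimately have "x \<in> ints"
      using ints_of_bounded_powers[OF xL, of "w * y"] w y by simp
    then show False using b(3)[of x] a(2) by (simp add: x_def field_simps)
  qed
  then have "x \<in> ?J" if "x \<in> ints" for x using Js(3)[OF that] by force
  then show ?thesis using JB by blast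
qed

section \<open>Translation to the ring of integers and the ideal group of the statement\<close>

lemma ring_of_integers_eq: "ring_of_integers L = ambient\<lparr>carrier := ints\<rparr>"
  by (simp add: ring_of_integers_def ints_def)

lemma ring_of_integers_simps [simp]:
  "carrier (ring_of_integers L) = ints" "x \<otimes>\<^bsub>ring_of_integers L\<^esub> y = x * y"
  "x \<oplus>\<^bsub>ring_of_integers L\<^esub> y = x + y" "\<zero>\<^bsub>ring_of_integers L\<^esub> = 0" "\<one>\<^bsub>ring_of_integers L\<^esub> = 1"
  by (simp_all add: ring_of_integers_eq)

lemma domain_ring_of_integers: "domain (ring_of_integers L)"
proof -
  have "subring ints ambient"
    by (rule ring.subringI[OF ring_ambient]) (auto intro: ints_closed)
  then show ?thesis
    unfolding ring_of_integers_eq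
    by (rule domain.subring_is_domain[OF field.axioms(1)[OF field_ambient]])
qed

lemma additive_subgroup_iff:
  assumes R: "ring R" and ops: "\<And>x y. x \<oplus>\<^bsub>R\<^esub> y = x + y" "\<zero>\<^bsub>R\<^esub> = (0 :: 'a)"
  shows "additive_subgroup I R \<longleftrightarrow> I \<subseteq> carrier R \<and> add_subgroup I"
proof -
  interpret R: ring R by (rule R)
  have neg: "\<ominus>\<^bsub>R\<^esub> x = - x" if "x \<in> carrier R" for x
    using R.l_neg[OF that] by (simp add: ops eq_neg_iff_add_eq_0)
  show ?thesis
  proof
    assume "additive_subgroup I R"
    then interpret I: additive_subgroup I R .
    have "x - y \<in> I" if "x \<in> I" "y \<in> I" for x y
      using I.a_closed[OF that(1) I.a_inv_closed[OF that(2)]] neg[OF I.a_Hcarr[OF that(2)]]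
      by (simp add: ops)
    then show "I \<subseteq> carrier R \<and> add_subgroup I"
      using I.a_subset I.zero_closed by (auto simp: ops intro: add_subgroupI)
  next
    assume I: "I \<subseteq> carrier R \<and> add_subgroup I"
    note Is = add_subgroup_closed[OF conjunct2[OF I]]
    have "subgroup I (add_monoid R)"
    proof (rule R.add.subgroupI)
      show "\<ominus>\<^bsub>R\<^esub> x \<in> I" if "x \<in> I" for x using neg[of x] Is(2)[OF that] I that by auto
    qed (use I Is in \<open>auto simp: ops\<close>)
    then show "additive_subgroup I R" by (rule additive_subgroup.intro)
  qed
qed

lemma ideal_iff: "ideal I (ring_of_integers L) \<longleftrightarrow> submodule_L I \<and> I \<subseteq> ints"
proof -
  interpret domain "ring_of_integers L" by (rule domain_ring_of_integers)
  have "ideal I (ring_of_integers L) \<longleftrightarrow> additive_subgroup I (ring_of_integers L) \<and>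
      (\<forall>a\<in>ints. \<forall>x\<in>I. a * x \<in> I)"
    by (simp add: ideal_def ideal_axioms_def ring_axioms) (metis mult.commute)
  then show ?thesis
    using additive_subgroup_iff[OF ring_axioms, of I]
    by (auto simp: submodule_L_def dest: ints_L)
qed

lemma ring_field_ring: "ring (field_ring L)"
  unfolding field_ring_def by (rule ring.subring_is_ring[OF ring_ambient subfieldE(1)[OF L_subfield]])

lemma field_ring_simps [simp]:
  "carrier (field_ring L) = L" "x \<otimes>\<^bsub>field_ring L\<^esub> y = x * y"
  "x \<oplus>\<^bsub>field_ring L\<^esub> y = x + y" "\<zero>\<^bsub>field_ring L\<^esub> = 0" "\<one>\<^bsub>field_ring L\<^esub> = 1"
  by (simp_all add: field_ring_def)

lemma fractional_ideal_iff: "fractional_ideal L I \<longleftrightarrow> fideal I"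
  using additive_subgroup_iff[OF ring_field_ring, of I]
  by (auto simp: fractional_ideal_def fideal_def submodule_L_def)

lemma ideal_group_simps [simp]:
  "carrier (ideal_group L) = Collect fideal" "I \<otimes>\<^bsub>ideal_group L\<^esub> J = I \<star> J"
  "\<one>\<^bsub>ideal_group L\<^esub> = ints"
  by (simp_all add: ideal_group_def fractional_ideal_iff ideal_prod_field_ring)

lemma comm_group_ideal_group: "comm_group (ideal_group L)"
proof (rule comm_groupI; simp)
  show "fideal (I \<star> J)" if "fideal I" "fideal J" for I J using that by (rule fideal_mult)
  show "fideal ints" by (rule fideal_ints)
  show "I \<star> J \<star> M = I \<star> (J \<star> M)" for I J M by (rule ideal_mult_assoc)
  show "I \<star> J = J \<star> I" for I J by (rule ideal_mult_commute)
  show "ints \<star> I = I" if "fideal I" for I by (rule ideal_mult_ints[OF fidealD[OF that]])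
  show "\<exists>J. fideal J \<and> J \<star> I = ints" if "fideal I" for I
    using fideal_inverse_ideal[OF that] ideal_mult_inverse_ideal[OF that] ideal_mult_commute
    by metis
qed

end

sublocale nfield \<subseteq> IG: comm_group "ideal_group L"
  by (rule comm_group_ideal_group)

section \<open>The class group\<close>

context nfield
begin

lemma principal_ideals_eq: "principal_ideals L = {(\<lambda>a. x * a) ` ints | x. x \<in> L \<and> x \<noteq> 0}"
  by (simp add: principal_ideals_def)

lemma principal_mult: "(\<lambda>a. x * a) ` ints \<star> (\<lambda>a. y * a) ` ints = (\<lambda>a. x * y * a) ` ints"
proof
  show "(\<lambda>a. x * a) ` ints \<star> (\<lambda>a. y * a) ` ints \<subseteq> (\<lambda>a. x * y * a) ` ints"
  proof (rule ideal_mult_least)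
    fix i j assume "i \<in> (\<lambda>a. x * a) ` ints" "j \<in> (\<lambda>a. y * a) ` ints"
    then obtain a b where "i = x * a" "j = y * b" "a \<in> ints" "b \<in> ints" by auto
    then show "i * j \<in> (\<lambda>a. x * y * a) ` ints"
      by (intro image_eqI[of _ _ "a * b"]) (simp_all add: mult_ac ints_closed)
  next
    fix i j assume "i \<in> (\<lambda>a. x * y * a) ` ints" "j \<in> (\<lambda>a. x * y * a) ` ints"
    then obtain a b where "i = x * y * a" "j = x * y * b" "a \<in> ints" "b \<in> ints" by auto
    then show "i + j \<in> (\<lambda>a. x * y * a) ` ints"
      by (intro image_eqI[of _ _ "a + b"]) (simp_all add: distrib_left ints_closed)
  qed
  show "(\<lambda>a. x * y * a) ` ints \<subseteq> (\<lambda>a. x * a) ` ints \<star> (\<lambda>a. y * a) ` ints"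
  proof
    fix z assume "z \<in> (\<lambda>a. x * y * a) ` ints"
    then obtain a where a: "a \<in> ints" "z = (x * a) * (y * 1)" by (auto simp: mult_ac)
    show "z \<in> (\<lambda>a. x * a) ` ints \<star> (\<lambda>a. y * a) ` ints"
      unfolding a(2) by (rule ideal_mult_prod) (use a(1) ints_closed(2) in blast)+
  qed
qed

lemma ints_principal: "ints \<in> principal_ideals L"
  unfolding principal_ideals_eq
  by (rule CollectI, rule exI[of _ 1]) (simp add: L_closed)

lemma subgroup_principal_ideals: "subgroup (principal_ideals L) (ideal_group L)"
proof (rule IG.subgroupI)
  show "principal_ideals L \<subseteq> carrier (ideal_group L)"
    by (auto simp: principal_ideals_eq fideal_principal)
  show "principal_ideals L \<noteq> {}" using ints_principal by blast
  show "inv\<^bsub>ideal_group L\<^esub> I \<in> principal_ideals L" if I: "I \<in> principal_ideals L" for I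
  proof -
    obtain x where x: "x \<in> L" "x \<noteq> 0" "I = (\<lambda>a. x * a) ` ints"
      using I by (auto simp: principal_ideals_eq)
    let ?J = "(\<lambda>a. inverse x * a) ` ints"
    have "inverse x \<in> L" "inverse x \<noteq> 0" using x L_closed(6) by auto
    then have J: "?J \<in> principal_ideals L" "fideal ?J"
      by (auto simp: principal_ideals_eq fideal_principal)
    have "?J \<star> I = ints" unfolding x(3) principal_mult using x(2) by simp
    then have "inv\<^bsub>ideal_group L\<^esub> I = ?J"
      using J(2) x fideal_principal[of x] by (intro IG.inv_equality) auto
    then show ?thesis using J(1) by simp
  qed
  show "I \<otimes>\<^bsub>ideal_group L\<^esub> J \<in> principal_ideals L"
    if IJ: "I \<in> principal_ideals L" "J \<in> principal_ideals L" for I J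
  proof -
    obtain x y where "x \<in> L" "x \<noteq> 0" "I = (\<lambda>a. x * a) ` ints" "y \<in> L" "y \<noteq> 0" "J = (\<lambda>a. y * a) ` ints"
      using IJ by (auto simp: principal_ideals_eq)
    then show ?thesis
      unfolding principal_ideals_eq
      by (intro CollectI exI[of _ "x * y"]) (simp add: principal_mult L_closed)
  qed
qed

lemma normal_principal_ideals: "principal_ideals L \<lhd> ideal_group L"
  by (rule IG.subgroup_imp_normal[OF subgroup_principal_ideals])

sublocale PI: normal "principal_ideals L" "ideal_group L"
  by (rule normal_principal_ideals)

lemma principal_if_class_number_1:
  assumes "class_number L = 1" and I: "fideal I"
  shows "I \<in> principal_ideals L"
proof -
  let ?C = "\<lambda>J. principal_ideals L #>\<^bsub>ideal_group L\<^esub> J"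
  have "card (rcosets\<^bsub>ideal_group L\<^esub> principal_ideals L) = 1"
    using assms(1) by (simp add: class_number_def class_group_def Coset.order_def FactGroup_def)
  then obtain C where "rcosets\<^bsub>ideal_group L\<^esub> principal_ideals L = {C}"
    by (auto simp: card_1_singleton_iff)
  moreover have "?C J \<in> rcosets\<^bsub>ideal_group L\<^esub> principal_ideals L" if "fideal J" for J
    using that by (auto simp: RCOSETS_def)
  ultimately have "?C I = ?C ints" using I fideal_ints by blast
  moreover have "?C ints = principal_ideals L"
    using IG.coset_mult_one[OF PI.subset] by simp
  ultimately show ?thesis
    using IG.rcos_self[OF _ subgroup_principal_ideals, of I] I by auto
qed

lemma class_number_1_generator:
  assumes "class_number L = 1" "submodule_L I" "I \<subseteq> ints" "I \<noteq> {0}"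
  obtains a where "a \<in> ints" "a \<noteq> 0" "I = (\<lambda>x. a * x) ` ints"
proof -
  obtain a where a: "a \<in> L" "a \<noteq> 0" "I = (\<lambda>x. a * x) ` ints"
    using principal_if_class_number_1[OF assms(1) fideal_integral[OF assms(2-4)]]
    by (auto simp: principal_ideals_eq)
  have "a * 1 \<in> I" unfolding a(3) using ints_closed(2) by blast
  then have "a \<in> ints" using assms(3) by auto
  then show ?thesis using that a by blast
qed

end

section \<open>The Galois group\<close>

text \<open>The map \<open>\<phi>\<close> is only required to be a ring homomorphism modulo
  \<open>P\<close>. This covers both uses: an automorphism with \<open>P = {0}\<close>, and the
  power map \<open>x ^ q\<close>, which is additive only modulo the prime ideal. Membership in
  \<open>B\<close> is carried along so that the congruences for \<open>\<phi>\<close> can be applied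
  to the coefficients.\<close>

lemma coeff_prod_linear_factors:
  fixes \<phi> :: "'a::comm_ring_1 \<Rightarrow> 'a"
  assumes "finite I" and B: "0 \<in> B" "1 \<in> B" "\<And>x y. x \<in> B \<Longrightarrow> y \<in> B \<Longrightarrow> x - y \<in> B"
      "\<And>x y. x \<in> B \<Longrightarrow> y \<in> B \<Longrightarrow> x * y \<in> B"
    and P: "0 \<in> P" "\<And>x y. x \<in> P \<Longrightarrow> y \<in> P \<Longrightarrow> x + y \<in> P" "\<And>x y. x \<in> P \<Longrightarrow> y \<in> P \<Longrightarrow> x - y \<in> P"
      "\<And>x y. x \<in> B \<Longrightarrow> y \<in> P \<Longrightarrow> x * y \<in> P"
    and \<phi>: "\<And>x. x \<in> B \<Longrightarrow> \<phi> x \<in> B" "\<phi> 0 \<in> P" "\<phi> 1 - 1 \<in> P"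
      "\<And>x y. x \<in> B \<Longrightarrow> y \<in> B \<Longrightarrow> \<phi> (x - y) - (\<phi> x - \<phi> y) \<in> P"
      "\<And>x y. x \<in> B \<Longrightarrow> y \<in> B \<Longrightarrow> \<phi> (x * y) - \<phi> x * \<phi> y \<in> P"
    and f: "\<And>i. i \<in> I \<Longrightarrow> f i \<in> B" "\<And>i. i \<in> I \<Longrightarrow> g i \<in> B" "\<And>i. i \<in> I \<Longrightarrow> \<phi> (f i) - g i \<in> P"
  shows "coeff (\<Prod>i\<in>I. [:- f i, 1:]) k \<in> B \<and> coeff (\<Prod>i\<in>I. [:- g i, 1:]) k \<in> B \<and>
    \<phi> (coeff (\<Prod>i\<in>I. [:- f i, 1:]) k) - coeff (\<Prod>i\<in>I. [:- g i, 1:]) k \<in> P"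
  using assms(1) f
proof (induction I arbitrary: k rule: finite_induct)
  case empty
  show ?case using B P \<phi> by (cases k) (auto simp: coeff_pCons)
next
  case (insert i I)
  define p where "p = (\<Prod>i\<in>I. [:- f i, 1:])"
  define q where "q = (\<Prod>i\<in>I. [:- g i, 1:])"
  have IH: "coeff p k \<in> B" "coeff q k \<in> B" "\<phi> (coeff p k) - coeff q k \<in> P" for k
    using insert.IH[of k] insert.prems by (auto simp: p_def q_def)
  \<comment> \<open>The coefficients of \<open>X * p\<close> and \<open>X * q\<close>; the value 0
    at \<open>k = 0\<close> comes from the shift.\<close>
  define p0 where "p0 = (case k of 0 \<Rightarrow> 0 | Suc j \<Rightarrow> coeff p j)"
  define q0 where "q0 = (case k of 0 \<Rightarrow> 0 | Suc j \<Rightarrow> coeff q j)"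
  have 0: "p0 \<in> B" "q0 \<in> B" "\<phi> p0 - q0 \<in> P"
    unfolding p0_def q0_def using IH B P \<phi> by (auto split: nat.split)
  have cp: "coeff ([:- f i, 1:] * p) k = p0 - f i * coeff p k"
    by (simp add: coeff_pCons p0_def)
  have cq: "coeff ([:- g i, 1:] * q) k = q0 - g i * coeff q k"
    by (simp add: coeff_pCons q0_def)
  have fi: "f i \<in> B" "g i \<in> B" "\<phi> (f i) - g i \<in> P" using insert.prems by auto
  have m: "f i * coeff p k \<in> B" "g i * coeff q k \<in> B" using fi IH B by auto
  have "\<phi> (f i * coeff p k) - g i * coeff q k =
      (\<phi> (f i * coeff p k) - \<phi> (f i) * \<phi> (coeff p k)) +
      (\<phi> (f i) * (\<phi> (coeff p k) - coeff q k) + coeff q k * (\<phi> (f i) - g i))"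
    by (simp add: algebra_simps)
  also have "\<dots> \<in> P"
    by (intro P(2) \<phi>(5) P(4) \<phi>(1) fi IH)
  finally have *: "\<phi> (f i * coeff p k) - g i * coeff q k \<in> P" .
  have "\<phi> (p0 - f i * coeff p k) - (q0 - g i * coeff q k) =
      (\<phi> (p0 - f i * coeff p k) - (\<phi> p0 - \<phi> (f i * coeff p k))) +
      ((\<phi> p0 - q0) - (\<phi> (f i * coeff p k) - g i * coeff q k))"
    by (simp add: algebra_simps)
  also have "\<dots> \<in> P" by (intro P(2,3) \<phi>(4) 0 m *)
  finally show ?case
    unfolding prod.insert[OF insert.hyps] p_def[symmetric] q_def[symmetric] cp cq
    by (intro conjI B(3) 0 m)
qed

section \<open>Automorphisms acting on integers and on ideals\<close>

locale galois_ext = K: nfield K + nfield L for K L :: "'a::field_char_0 set" +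
  assumes galois: "galois_extension K L"
    and finite_Gal: "finite (carrier (Gal K L))"
begin

abbreviation G where "G \<equiv> Gal K L"

lemma K_L: "x \<in> K \<Longrightarrow> x \<in> L"
  using galois subfieldE(3)[of K "field_ring L"] by (auto simp: galois_extension_def)

lemma Kints_ints: "x \<in> K.ints \<Longrightarrow> x \<in> ints"
  by (auto simp: K.ints_def ints_def K_L)

lemma Kints_iff: "x \<in> K.ints \<longleftrightarrow> x \<in> K \<and> x \<in> ints"
  by (auto simp: K.ints_def ints_def K_L)

text \<open>That \<open>\<sigma>\<close> preserves 1 is absorbed in its fixing \<open>K\<close>
  pointwise, as 1 lies in \<open>K\<close>.\<close>

lemma Gal_iff: "\<sigma> \<in> carrier G \<longleftrightarrow> \<sigma> \<in> extensional L \<and> bij_betw \<sigma> L L \<and>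
    (\<forall>x\<in>L. \<forall>y\<in>L. \<sigma> (x + y) = \<sigma> x + \<sigma> y \<and> \<sigma> (x * y) = \<sigma> x * \<sigma> y) \<and> (\<forall>x\<in>K. \<sigma> x = x)"
  using K.L_closed(2) by (auto simp: Gal_def Bij_def Ring.ring_hom_def dest: bij_betw_apply)

lemma Gal_L:
  assumes "\<sigma> \<in> carrier G"
  shows "x \<in> L \<Longrightarrow> \<sigma> x \<in> L" "x \<in> K \<Longrightarrow> \<sigma> x = x"
    "x \<in> L \<Longrightarrow> y \<in> L \<Longrightarrow> \<sigma> (x + y) = \<sigma> x + \<sigma> y" "x \<in> L \<Longrightarrow> y \<in> L \<Longrightarrow> \<sigma> (x * y) = \<sigma> x * \<sigma> y"
  using assms by (auto simp: Gal_iff dest: bij_betw_apply)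

lemma Gal_0 [simp]: "\<sigma> \<in> carrier G \<Longrightarrow> \<sigma> 0 = 0"
  and Gal_1 [simp]: "\<sigma> \<in> carrier G \<Longrightarrow> \<sigma> 1 = 1"
  and Gal_of_int [simp]: "\<sigma> \<in> carrier G \<Longrightarrow> \<sigma> (of_int n) = of_int n"
  by (auto intro: Gal_L(2) K.L_closed K.L_of_int)

lemma Gal_minus: "\<sigma> \<in> carrier G \<Longrightarrow> x \<in> L \<Longrightarrow> \<sigma> (- x) = - \<sigma> x"
  using Gal_L(4)[of \<sigma> "of_int (-1)" x] by (simp add: L_of_int del: of_int_minus) simp

lemma Gal_diff: "\<sigma> \<in> carrier G \<Longrightarrow> x \<in> L \<Longrightarrow> y \<in> L \<Longrightarrow> \<sigma> (x - y) = \<sigma> x - \<sigma> y"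
  using Gal_L(3)[of \<sigma> x "- y"] by (simp add: Gal_minus L_closed)

lemma Gal_power: "\<sigma> \<in> carrier G \<Longrightarrow> x \<in> L \<Longrightarrow> \<sigma> (x ^ n) = \<sigma> x ^ n"
  by (induction n) (auto simp: Gal_L(4) L_power)

lemma Gal_poly:
  "\<sigma> \<in> carrier G \<Longrightarrow> x \<in> L \<Longrightarrow> \<sigma> (poly (map_poly of_int p) x) = poly (map_poly of_int p) (\<sigma> x)"
proof (induction p)
  case (pCons a p)
  have "poly (map_poly of_int p) x \<in> L"
    by (induction p) (auto simp: hom_distribs pCons.prems intro!: L_closed L_of_int)
  with pCons show ?case
    by (simp add: hom_distribs Gal_L(3,4) L_of_int L_closed)
qed simp

lemma Gal_ints: "\<sigma> \<in> carrier G \<Longrightarrow> x \<in> ints \<Longrightarrow> \<sigma> x \<in> ints"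
  using Gal_poly[of \<sigma> x] unfolding ints_def algebraic_int_altdef_ipoly
  by (auto intro: Gal_L) (metis Gal_0)

lemma fixed_K: "x \<in> L \<Longrightarrow> (\<And>\<sigma>. \<sigma> \<in> carrier G \<Longrightarrow> \<sigma> x = x) \<Longrightarrow> x \<in> K"
  using galois by (auto simp: galois_extension_def)

lemma Gal_BijGroup: "carrier G \<subseteq> Bij L" "G = (BijGroup L)\<lparr>carrier := carrier G\<rparr>"
  by (auto simp: Gal_def)

lemma Gal_mult: "\<sigma> \<in> carrier G \<Longrightarrow> \<tau> \<in> carrier G \<Longrightarrow> \<sigma> \<otimes>\<^bsub>G\<^esub> \<tau> = compose L \<sigma> \<tau>"
  using Gal_BijGroup(1) by (auto simp: Gal_def BijGroup_def)

lemma Gal_mult_apply: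
  "\<sigma> \<in> carrier G \<Longrightarrow> \<tau> \<in> carrier G \<Longrightarrow> x \<in> L \<Longrightarrow> (\<sigma> \<otimes>\<^bsub>G\<^esub> \<tau>) x = \<sigma> (\<tau> x)"
  by (simp add: Gal_mult compose_def)

lemma Gal_one: "\<one>\<^bsub>G\<^esub> = (\<lambda>x\<in>L. x)"
  by (simp add: Gal_def BijGroup_def)

lemma Gal_group: "group G"
proof -
  interpret BG: group "BijGroup L" by (rule group_BijGroup)
  have "subgroup (carrier G) (BijGroup L)"
  proof (rule BG.subgroupI)
    show "carrier G \<subseteq> carrier (BijGroup L)" using Gal_BijGroup(1) by (simp add: BijGroup_def)
    have "(\<lambda>x\<in>L. x) \<in> carrier G"
      unfolding Gal_iff by (auto simp: bij_betw_def inj_on_def L_closed K_L)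
    then show "carrier G \<noteq> {}" by blast
    show "\<sigma> \<otimes>\<^bsub>BijGroup L\<^esub> \<tau> \<in> carrier G" if st: "\<sigma> \<in> carrier G" "\<tau> \<in> carrier G" for \<sigma> \<tau>
    proof -
      have "\<sigma> \<otimes>\<^bsub>BijGroup L\<^esub> \<tau> = compose L \<sigma> \<tau>"
        using Gal_BijGroup(1) st by (auto simp: BijGroup_def)
      moreover have "bij_betw (compose L \<sigma> \<tau>) L L"
        using st bij_betw_compose[of \<tau> L L \<sigma> L] by (simp add: Gal_iff)
      moreover have "compose L \<sigma> \<tau> \<in> carrier G" if "bij_betw (compose L \<sigma> \<tau>) L L"
        unfolding Gal_iff[of "compose L \<sigma> \<tau>"]
      proof (intro conjI ballI)
        show "bij_betw (compose L \<sigma> \<tau>) L L" by (rule that)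
      qed (use st in \<open>simp_all add: compose_def Gal_L L_closed K_L\<close>)
      ultimately show ?thesis by simp
    qed
    show "inv\<^bsub>BijGroup L\<^esub> \<sigma> \<in> carrier G" if s: "\<sigma> \<in> carrier G" for \<sigma>
    proof -
      let ?i = "inv\<^bsub>BijGroup L\<^esub> \<sigma>"
      have sB: "\<sigma> \<in> carrier (BijGroup L)" using Gal_BijGroup(1) s by (auto simp: BijGroup_def)
      then have iB: "?i \<in> carrier (BijGroup L)" by simp
      have cB: "carrier (BijGroup L) = Bij L" "\<one>\<^bsub>BijGroup L\<^esub> = (\<lambda>x\<in>L. x)"
        and mB: "\<And>f g. f \<in> Bij L \<Longrightarrow> g \<in> Bij L \<Longrightarrow> f \<otimes>\<^bsub>BijGroup L\<^esub> g = compose L f g"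
        by (simp_all add: BijGroup_def)
      note sB' = sB[unfolded cB] and iB' = iB[unfolded cB]
      have bij: "bij_betw ?i L L" "?i \<in> extensional L"
        using iB' unfolding Bij_def by blast+
      have iL: "?i x \<in> L" if "x \<in> L" for x using bij_betw_apply[OF bij(1) that] .
      have "compose L \<sigma> ?i = (\<lambda>x\<in>L. x)" "compose L ?i \<sigma> = (\<lambda>x\<in>L. x)"
        using BG.r_inv[OF sB] BG.l_inv[OF sB] unfolding cB mB[OF sB' iB'] mB[OF iB' sB'] .
      then have *: "\<sigma> (?i x) = x" "?i (\<sigma> x) = x" if "x \<in> L" for x
        using that by (metis compose_eq restrict_apply')+
      have "?i (x + y) = ?i x + ?i y \<and> ?i (x * y) = ?i x * ?i y" if xy: "x \<in> L" "y \<in> L" for x y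
      proof -
        have "?i x + ?i y = ?i (\<sigma> (?i x + ?i y))" using xy by (simp add: * iL L_closed)
        moreover have "?i x * ?i y = ?i (\<sigma> (?i x * ?i y))" using xy by (simp add: * iL L_closed)
        ultimately show ?thesis using xy by (simp add: Gal_L[OF s] iL *)
      qed
      moreover have "?i x = x" if "x \<in> K" for x
        using *(2)[OF K_L[OF that]] Gal_L(2)[OF s that] by simp
      ultimately show ?thesis unfolding Gal_iff using bij by blast
    qed
  qed
  then show ?thesis
    using BG.subgroup_imp_group Gal_BijGroup(2) by metis
qed

sublocale Gal: group G by (rule Gal_group)

lemma Gal_inv_apply:
  assumes "\<sigma> \<in> carrier G" "x \<in> L"
  shows "(inv\<^bsub>G\<^esub> \<sigma>) (\<sigma> x) = x" "\<sigma> ((inv\<^bsub>G\<^esub> \<sigma>) x) = x"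
  using Gal_mult_apply[of "inv\<^bsub>G\<^esub> \<sigma>" \<sigma> x] Gal_mult_apply[of \<sigma> "inv\<^bsub>G\<^esub> \<sigma>" x] assms
  by (simp_all add: Gal_one)

lemma Gal_one_apply: "x \<in> L \<Longrightarrow> \<one>\<^bsub>G\<^esub> x = x"
  by (simp add: Gal_one)

text \<open>Every element of \<open>L\<close> becomes integral after multiplication by a nonzero
  rational integer, which automorphisms fix; outside \<open>L\<close> both maps are
  \<open>undefined\<close>.\<close>

lemma Gal_eqI:
  assumes "\<sigma> \<in> carrier G" "\<tau> \<in> carrier G" "\<And>x. x \<in> ints \<Longrightarrow> \<sigma> x = \<tau> x"
  shows "\<sigma> = \<tau>"
proof (rule extensionalityI[of _ L])
  show "\<sigma> \<in> extensional L" "\<tau> \<in> extensional L" using assms by (auto simp: Gal_iff)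
  fix x assume x: "x \<in> L"
  obtain d :: int where d: "d \<noteq> 0" "of_int d * x \<in> ints" using L_multiple[OF x] .
  have "of_int d * \<sigma> x = of_int d * \<tau> x"
    using assms(3)[OF d(2)] Gal_L(4)[OF assms(1) L_of_int x] Gal_L(4)[OF assms(2) L_of_int x]
    by (simp add: assms)
  then show "\<sigma> x = \<tau> x" using d(1) by simp
qed

lemma Gal_image_mult:
  "\<sigma> \<in> carrier G \<Longrightarrow> \<tau> \<in> carrier G \<Longrightarrow> I \<subseteq> L \<Longrightarrow> (\<sigma> \<otimes>\<^bsub>G\<^esub> \<tau>) ` I = \<sigma> ` \<tau> ` I"
  by (auto simp: Gal_mult_apply image_image subset_eq intro!: image_cong)

lemma Gal_image_one: "I \<subseteq> L \<Longrightarrow> \<one>\<^bsub>G\<^esub> ` I = I"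
  by (force simp: Gal_one_apply subset_eq)

lemma Gal_image_inv:
  assumes "\<sigma> \<in> carrier G" "I \<subseteq> L"
  shows "(inv\<^bsub>G\<^esub> \<sigma>) ` \<sigma> ` I = I" "\<sigma> ` (inv\<^bsub>G\<^esub> \<sigma>) ` I = I"
  using Gal_image_mult[of "inv\<^bsub>G\<^esub> \<sigma>" \<sigma> I] Gal_image_mult[of \<sigma> "inv\<^bsub>G\<^esub> \<sigma>" I] assms
  by (simp_all add: Gal_image_one)

lemma Gal_image_ints: assumes "\<sigma> \<in> carrier G" shows "\<sigma> ` ints = ints"
proof
  show "\<sigma> ` ints \<subseteq> ints" using assms by (auto intro: Gal_ints)
  have "(inv\<^bsub>G\<^esub> \<sigma>) ` ints \<subseteq> ints" using assms by (auto intro: Gal_ints)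
  then have "\<sigma> ` (inv\<^bsub>G\<^esub> \<sigma>) ` ints \<subseteq> \<sigma> ` ints" by (rule image_mono)
  then show "ints \<subseteq> \<sigma> ` ints"
    using Gal_image_inv(2)[OF assms, of ints] ints_L by (simp add: subsetI)
qed

lemma submodule_image:
  assumes s: "\<sigma> \<in> carrier G" and I: "submodule_L I"
  shows "submodule_L (\<sigma> ` I)"
proof (rule submodule_LI)
  note Is = submodule_LD[OF I]
  show "\<sigma> ` I \<subseteq> L" using Is(1) s by (auto intro: Gal_L)
  show "0 \<in> \<sigma> ` I" using Is(5) s by (intro image_eqI[of _ _ 0]) simp_all
  fix x y assume "x \<in> \<sigma> ` I" "y \<in> \<sigma> ` I"
  then obtain u v where "x = \<sigma> u" "y = \<sigma> v" "u \<in> I" "v \<in> I" by auto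
  then show "x + y \<in> \<sigma> ` I"
    using Is(7) subsetD[OF Is(1)] Gal_L(3)[OF s] by (intro image_eqI[of _ _ "u + v"]) auto
next
  note Is = submodule_LD[OF I]
  fix a x assume ax: "a \<in> ints" "x \<in> \<sigma> ` I"
  then obtain u where u: "x = \<sigma> u" "u \<in> I" by auto
  obtain b where b: "a = \<sigma> b" "b \<in> ints" using ax Gal_image_ints[OF s] by blast
  show "a * x \<in> \<sigma> ` I"
    using u b Is(3) subsetD[OF Is(1)] Gal_L(4)[OF s] ints_L by (intro image_eqI[of _ _ "b * u"]) auto
qed

lemma Gal_eq_0_iff: "\<sigma> \<in> carrier G \<Longrightarrow> x \<in> L \<Longrightarrow> \<sigma> x = 0 \<longleftrightarrow> x = 0"
  by (metis Gal_0 Gal_inv_apply(1) Gal.inv_closed)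

lemma fideal_image:
  assumes s: "\<sigma> \<in> carrier G" and I: "fideal I"
  shows "fideal (\<sigma> ` I)"
  unfolding fideal_def
proof (intro conjI)
  have IL: "I \<subseteq> L" by (rule submodule_LD(1)[OF fidealD[OF I]])
  show "submodule_L (\<sigma> ` I)" by (rule submodule_image[OF s fidealD[OF I]])
  obtain x where "x \<in> I" "x \<noteq> 0" using fideal_nonzero[OF I] .
  then show "\<sigma> ` I \<noteq> {0}" using Gal_eq_0_iff[OF s, of x] IL by blast
  obtain d where d: "d \<in> ints" "d \<noteq> 0" "\<forall>x\<in>I. d * x \<in> ints"
    using I by (auto simp: fideal_def)
  have "\<sigma> d * \<sigma> x \<in> ints" if "x \<in> I" for x
    using d(3) that IL Gal_L(4)[OF s ints_L[OF d(1)], of x] Gal_ints[OF s, of "d * x"] by auto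
  then show "\<exists>d\<in>ints. d \<noteq> 0 \<and> (\<forall>x\<in>\<sigma> ` I. d * x \<in> ints)"
    using d Gal_ints[OF s] Gal_eq_0_iff[OF s ints_L] by (intro bexI[of _ "\<sigma> d"]) auto
qed

lemma image_ideal_mult_subset:
  assumes s: "\<sigma> \<in> carrier G" and I: "submodule_L I" "submodule_L J"
  shows "\<sigma> ` (I \<star> J) \<subseteq> \<sigma> ` I \<star> \<sigma> ` J"
proof -
  note IL = submodule_LD(1)[OF I(1)] submodule_LD(1)[OF I(2)]
  have "I \<star> J \<subseteq> {x \<in> L. \<sigma> x \<in> \<sigma> ` I \<star> \<sigma> ` J}"
  proof (rule ideal_mult_least)
    fix i j assume "i \<in> I" "j \<in> J"
    then show "i * j \<in> {x \<in> L. \<sigma> x \<in> \<sigma> ` I \<star> \<sigma> ` J}"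
      using subsetD[OF IL(1), of i] subsetD[OF IL(2), of j] Gal_L(4)[OF s, of i j] ideal_mult_prod[of "\<sigma> i" "\<sigma> ` I" "\<sigma> j" "\<sigma> ` J"]
      by (auto intro: L_closed)
  next
    fix x y assume "x \<in> {x \<in> L. \<sigma> x \<in> \<sigma> ` I \<star> \<sigma> ` J}" "y \<in> {x \<in> L. \<sigma> x \<in> \<sigma> ` I \<star> \<sigma> ` J}"
    then show "x + y \<in> {x \<in> L. \<sigma> x \<in> \<sigma> ` I \<star> \<sigma> ` J}"
      using Gal_L(3)[OF s, of x y] by (auto intro: L_closed ideal_mult_add)
  qed
  then show ?thesis by blast
qed

lemma image_ideal_mult:
  assumes s: "\<sigma> \<in> carrier G" and I: "submodule_L I" "submodule_L J"
  shows "\<sigma> ` (I \<star> J) = \<sigma> ` I \<star> \<sigma> ` J"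
proof (rule equalityI[OF image_ideal_mult_subset[OF assms]])
  \<comment> \<open>The reverse inclusion is the one already proved, applied to the inverse of
    \<open>\<sigma>\<close> and the two images.\<close>
  let ?i = "inv\<^bsub>G\<^esub> \<sigma>"
  have i: "?i \<in> carrier G" using s by simp
  note IL = submodule_LD(1)[OF I(1)] submodule_LD(1)[OF I(2)]
  have sm: "submodule_L (\<sigma> ` I)" "submodule_L (\<sigma> ` J)" using submodule_image[OF s] I by auto
  have "?i ` (\<sigma> ` I \<star> \<sigma> ` J) \<subseteq> ?i ` \<sigma> ` I \<star> ?i ` \<sigma> ` J"
    by (rule image_ideal_mult_subset[OF i sm])
  then have "?i ` (\<sigma> ` I \<star> \<sigma> ` J) \<subseteq> I \<star> J"
    by (simp add: Gal_image_inv[OF s] IL)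
  then have "\<sigma> ` ?i ` (\<sigma> ` I \<star> \<sigma> ` J) \<subseteq> \<sigma> ` (I \<star> J)" by (rule image_mono)
  then show "\<sigma> ` I \<star> \<sigma> ` J \<subseteq> \<sigma> ` (I \<star> J)"
    using Gal_image_inv(2)[OF s submodule_LD(1)[OF submodule_ideal_mult[OF sm]]] by simp
qed

lemma image_principal:
  assumes s: "\<sigma> \<in> carrier G" and x: "x \<in> L"
  shows "\<sigma> ` (\<lambda>a. x * a) ` ints = (\<lambda>a. \<sigma> x * a) ` ints"
proof -
  have "\<sigma> ` (\<lambda>a. x * a) ` ints = (\<lambda>a. \<sigma> x * \<sigma> a) ` ints"
    unfolding image_image by (rule image_cong) (auto simp: Gal_L(4)[OF s x] ints_L)
  also have "\<dots> = (\<lambda>a. \<sigma> x * a) ` \<sigma> ` ints" by (simp add: image_image)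
  finally show ?thesis by (simp add: Gal_image_ints[OF s])
qed

text \<open>An automorphism \<open>\<tau>\<close> permutes the factors, so it fixes every
  coefficient, and the fixed field of \<open>G\<close> is \<open>K\<close>. Taking
  \<open>P = {0}\<close> in the coefficient lemma makes its congruence an equality.\<close>

lemma char_poly_coeff:
  assumes x: "x \<in> ints"
  shows "coeff (\<Prod>\<sigma>\<in>carrier G. [:- \<sigma> x, 1:]) k \<in> K.ints"
proof -
  let ?p = "\<lambda>\<tau>. \<Prod>\<sigma>\<in>carrier G. [:- \<tau> (\<sigma> x), 1:]"
  have c: "coeff (\<Prod>\<sigma>\<in>carrier G. [:- \<sigma> x, 1:]) k \<in> ints \<and> coeff (?p \<tau>) k \<in> ints \<and>
      \<tau> (coeff (\<Prod>\<sigma>\<in>carrier G. [:- \<sigma> x, 1:]) k) - coeff (?p \<tau>) k \<in> {0}"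
    if t: "\<tau> \<in> carrier G" for \<tau>
    by (rule coeff_prod_linear_factors[OF finite_Gal])
      (use t x in \<open>auto simp: Gal_L Gal_diff ints_L Gal_ints intro: ints_closed ints_diff\<close>)
  have "?p \<tau> = (\<Prod>\<sigma>\<in>carrier G. [:- \<sigma> x, 1:])" if t: "\<tau> \<in> carrier G" for \<tau>
  proof -
    have "?p \<tau> = (\<Prod>\<sigma>\<in>carrier G. [:- (\<tau> \<otimes>\<^bsub>G\<^esub> \<sigma>) x, 1:])"
      by (rule prod.cong) (simp_all add: Gal_mult_apply t ints_L x)
    also have "\<dots> = (\<Prod>\<sigma>\<in>carrier G. [:- \<sigma> x, 1:])"
      by (rule prod.reindex_bij_witness[of _ "\<lambda>\<sigma>. inv\<^bsub>G\<^esub> \<tau> \<otimes>\<^bsub>G\<^esub> \<sigma>" "\<lambda>\<sigma>. \<tau> \<otimes>\<^bsub>G\<^esub> \<sigma>"])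
        (use t in \<open>simp_all add: Gal.m_assoc[symmetric]\<close>)
    finally show ?thesis .
  qed
  with c have "coeff (\<Prod>\<sigma>\<in>carrier G. [:- \<sigma> x, 1:]) k \<in> ints"
    "\<And>\<tau>. \<tau> \<in> carrier G \<Longrightarrow>
      \<tau> (coeff (\<Prod>\<sigma>\<in>carrier G. [:- \<sigma> x, 1:]) k) = coeff (\<Prod>\<sigma>\<in>carrier G. [:- \<sigma> x, 1:]) k"
    using Gal.one_closed by auto
  then show ?thesis
    unfolding Kints_iff by (auto intro: fixed_K ints_L)
qed

lemma norm_Kints:
  assumes x: "x \<in> ints"
  shows "(\<Prod>\<sigma>\<in>carrier G. \<sigma> x) \<in> K.ints"
proof -
  \<comment> \<open>Taken at \<open>- x\<close>, so that the constant coefficient is the norm of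
    \<open>x\<close> without a sign.\<close>
  have "coeff (\<Prod>\<sigma>\<in>carrier G. [:- \<sigma> (- x), 1:]) 0 \<in> K.ints"
    by (rule char_poly_coeff[OF ints_closed(4)[OF x]])
  also have "coeff (\<Prod>\<sigma>\<in>carrier G. [:- \<sigma> (- x), 1:]) 0 = (\<Prod>\<sigma>\<in>carrier G. \<sigma> x)"
    by (simp add: poly_0_coeff_0[symmetric] poly_prod Gal_minus ints_L[OF x])
  finally show ?thesis .
qed

end

section \<open>Residue fields\<close>

text \<open>A prime \<open>r \<noteq> l\<close> dividing the order would give, by Sylow, a subgroup
  of order \<open>r\<close> and a nontrivial element killed by both \<open>r\<close> and
  \<open>l\<close>. Applied to the additive group of the residue field of \<open>K\<close>, this
  makes \<open>q\<close> a power of the characteristic, so that \<open>x ^ q\<close> is additive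
  modulo \<open>P\<close>.\<close>

lemma (in group) order_prime_power:
  assumes fin: "finite (carrier G)" and l: "Factorial_Ring.prime (l::nat)"
    and pow: "\<And>x. x \<in> carrier G \<Longrightarrow> x [^] l = \<one>"
  shows "\<exists>j. Coset.order G = l ^ j"
proof -
  have "r = l" if r: "Factorial_Ring.prime r" "r dvd Coset.order G" for r
  proof (rule ccontr)
    assume "r \<noteq> l"
    obtain m where "Coset.order G = r ^ 1 * m" using r by auto
    then obtain H where H: "subgroup H G" "card H = r ^ 1"
      using sylow_thm[OF r(1) group_axioms _ fin] by blast
    have "\<not> H \<subseteq> {\<one>}"
      using card_mono[of "{\<one>}" H] H(2) prime_gt_1_nat[OF r(1)] by auto
    then obtain x where x: "x \<in> H" "x \<noteq> \<one>" by blast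
    interpret H: group "G\<lparr>carrier := H\<rparr>" by (rule subgroup_imp_group[OF H(1)])
    have xG: "x \<in> carrier G" using x subgroup.mem_carrier[OF H(1)] by blast
    have "x [^] r = \<one>"
      using H.pow_order_eq_1[of x] x H(2) nat_pow_consistent[of x r H]
      by (simp add: Coset.order_def)
    then have "ord x dvd r" "ord x dvd l" using pow_eq_id[OF xG] pow[OF xG] by auto
    then have "ord x = 1"
      using r(1) l \<open>r \<noteq> l\<close> by (metis One_nat_def prime_nat_iff)
    then show False using ord_eq_1[OF xG] x(2) by simp
  qed
  moreover have "\<exists>j. n = l ^ j"
    if "n > 0" "\<And>r. Factorial_Ring.prime r \<Longrightarrow> r dvd n \<Longrightarrow> r = l" for n :: nat
    using that
  proof (induction n rule: less_induct)
    case (less n)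
    show ?case
    proof (cases "n = 1")
      case False
      then have "l dvd n" using prime_factor_nat less.prems(2) by metis
      then obtain m where m: "n = l * m" by blast
      then have "m < n" "m > 0" using less.prems(1) prime_gt_1_nat[OF l] by auto
      then obtain j where "m = l ^ j" using less.IH[of m] less.prems(2) m by auto
      then show ?thesis using m by (intro exI[of _ "Suc j"]) simp
    qed (auto intro: exI[of _ 0])
  qed
  moreover have "Coset.order G > 0" using fin order_gt_0_iff_finite by simp
  ultimately show ?thesis by metis
qed

text \<open>Coordinates with respect to a basis count the elements; this turns the residue degree
  into the cardinality \<open>q ^ f\<close> of the residue field.\<close>

lemma (in ring) dimension_card:
  assumes "subfield K R" "finite K" "dimension n K E"
  shows "card E = card K ^ n"
proof -
  obtain Us where Us: "set Us \<subseteq> carrier R" "independent K Us" "length Us = n" "Span K Us = E"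
    using exists_base[OF assms(1,3)] by blast
  let ?S = "{Ks. set Ks \<subseteq> K \<and> length Ks = n}"
  have "bij_betw (\<lambda>Ks. combine Ks Us) ?S E"
    unfolding bij_betw_def
  proof
    show "(\<lambda>Ks. combine Ks Us) ` ?S = E"
      using Span_mem_iff_length_version[OF assms(1) Us(1)] Us(3,4) by auto
    show "inj_on (\<lambda>Ks. combine Ks Us) ?S"
    proof (rule inj_onI)
      fix x y assume xy: "x \<in> ?S" "y \<in> ?S" "combine x Us = combine y Us"
      then have "combine x Us \<in> Span K Us"
        using Span_mem_iff_length_version[OF assms(1) Us(1)] Us(3) by auto
      from unique_decomposition[OF assms(1) Us(2) this] xy Us(3) show "x = y" by auto
    qed
  qed
  then show ?thesis
    using card_lists_length_eq[OF assms(2), of n] by (auto dest: bij_betw_same_card)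
qed

lemma (in field) finite_field_pow_card:
  assumes "finite (carrier R)" "x \<in> carrier R"
  shows "x [^] card (carrier R) = x"
proof (cases "x = \<zero>")
  case True
  have "card (carrier R) \<noteq> 0" using assms by auto
  then show ?thesis unfolding True by (rule nat_pow_zero)
next
  case False
  interpret M: group "Multiplicative_Group.mult_of R" by (rule field_mult_group)
  have "card (carrier R) > 0" unfolding card_gt_0_iff using assms by blast
  then have c: "card (carrier R) = Suc (card (carrier R) - 1)" by simp
  have "x [^] (card (carrier R) - 1) = \<one>"
    using M.pow_order_eq_1[of x] assms False order_mult_of[OF assms(1)]
    by (simp add: Coset.order_def Multiplicative_Group.nat_pow_mult_of)
  then show ?thesis using assms(2) by (subst c) (simp only: nat_pow_Suc l_one)
qed

lemma (in field) pow_diff_one: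
  assumes "x \<in> carrier R" "x \<noteq> \<zero>" "x [^] n = x" "(n::nat) > 0"
  shows "x [^] (n - 1) = \<one>"
proof -
  have "x [^] n = x [^] (n - 1) \<otimes> x" using assms(4) by (cases n) auto
  then have "x [^] (n - 1) \<otimes> x = \<one> \<otimes> x" using assms(1,3) by simp
  then show ?thesis using m_rcancel[OF assms(2,1) nat_pow_closed[OF assms(1)] one_closed] by simp
qed

locale galois_prime = galois_ext +
  fixes P :: "'a set"
  assumes prime: "prime_of L P"
begin

lemma P_primeideal: "primeideal P (ring_of_integers L)" and P_nonzero: "P \<noteq> {0}"
  using prime by (auto simp: prime_of_def)

lemma P_sub: "submodule_L P" and P_ints: "P \<subseteq> ints"
  using primeideal.axioms(1)[OF P_primeideal] by (auto simp: ideal_iff)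

lemmas P_closed = submodule_LD(3-8)[OF P_sub]

lemma one_notin_P: "1 \<notin> P"
  using primeideal.I_notcarr[OF P_primeideal] P_closed(1)[of _ 1] P_ints by auto

lemma P_prime: "x \<in> ints \<Longrightarrow> y \<in> ints \<Longrightarrow> x * y \<in> P \<Longrightarrow> x \<in> P \<or> y \<in> P"
  using primeideal.I_prime[OF P_primeideal, of x y] by simp

lemma P_power: "x \<in> ints \<Longrightarrow> x ^ n \<in> P \<Longrightarrow> x \<in> P"
  by (induction n) (use P_prime[OF _ ints_power] one_notin_P in auto)

lemma P_fideal: "fideal P"
  by (rule fideal_integral[OF P_sub P_ints P_nonzero])

text \<open>Two powers of \<open>u\<close> agree modulo a nonzero element of \<open>P\<close>; as
  \<open>P\<close> is prime, the common factor \<open>u ^ i\<close>, which lies outside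
  \<open>P\<close>, cancels.\<close>

lemma P_power_cong:
  assumes u: "u \<in> ints" "u \<notin> P"
  obtains d where "d > 0" "u ^ d - 1 \<in> P"
proof -
  obtain a where a: "a \<in> P" "a \<noteq> 0" using fideal_nonzero[OF P_fideal] .
  then have aB: "a \<in> ints" using P_ints by blast
  obtain i j y where ij: "i < j" "y \<in> ints" "u ^ j - u ^ i = a * y"
    using ints_pigeonhole[of a "\<lambda>k. u ^ k", OF aB a(2) ints_power[OF u(1)]] .
  have "u ^ j = u ^ i * u ^ (j - i)" using ij(1) by (simp flip: power_add)
  then have "u ^ i * (u ^ (j - i) - 1) = a * y"
    unfolding ij(3)[symmetric] by (simp add: right_diff_distrib)
  then have "u ^ i * (u ^ (j - i) - 1) \<in> P" using P_closed(2)[OF ij(2) a(1)] by simp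
  then have "u ^ (j - i) - 1 \<in> P"
    using P_prime[of "u ^ i" "u ^ (j - i) - 1"] P_power[OF u(1), of i] u
    by (auto intro: ints_power ints_diff ints_closed)
  then show ?thesis using that[of "j - i"] ij(1) by simp
qed

lemma P_cong_mult:
  assumes "x \<in> ints" "y' \<in> ints" "x - x' \<in> P" "y - y' \<in> P"
  shows "x * y - x' * y' \<in> P"
proof -
  have "x * y - x' * y' = x * (y - y') + (x - x') * y'" by (simp add: algebra_simps)
  also have "\<dots> \<in> P" by (intro P_closed(5) P_closed(1,2) assms)
  finally show ?thesis .
qed

lemma P_cong_sym: "x - y \<in> P \<Longrightarrow> y - x \<in> P"
  using P_closed(4)[of "x - y"] by simp

lemma P_cong_trans: "x - y \<in> P \<Longrightarrow> y - z \<in> P \<Longrightarrow> x - z \<in> P"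
  using P_closed(5)[of "x - y" "y - z"] by simp

lemma P_cong_power:
  assumes "x \<in> ints" "y \<in> ints" "x - y \<in> P"
  shows "x ^ n - y ^ n \<in> P"
  by (induction n) (use P_closed(3) assms P_cong_mult ints_power in auto)

text \<open>A nonzero element of \<open>P\<close> divides a nonzero rational integer, which thus
  lies in \<open>P\<close>; primality of \<open>P\<close> then singles out a prime factor.\<close>

lemma residue_prime:
  obtains l :: nat where "Factorial_Ring.prime l" "of_nat l \<in> P"
proof -
  obtain a where a: "a \<in> P" "a \<noteq> 0" using fideal_nonzero[OF P_fideal] .
  then have aB: "a \<in> ints" using P_ints by blast
  obtain m p where m: "m \<noteq> 0" "of_int m = a * poly (map_poly of_int p) a"
    using algebraic_int_dvd_int[of a] a aB by (auto simp: ints_def)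
  have mP: "of_int m \<in> P" unfolding m(2) by (rule P_closed(2)[OF ints_poly[OF aB] a(1)])
  have "of_nat (nat \<bar>m\<bar>) \<in> P"
    using mP P_closed(4)[OF mP] by (auto simp: abs_if)
  moreover have "\<exists>l. Factorial_Ring.prime l \<and> of_nat l \<in> P" if "n > 0" "of_nat n \<in> P" for n :: nat
    using that
  proof (induction n rule: less_induct)
    case (less n)
    have "n \<noteq> 1" using less.prems one_notin_P by auto
    then obtain p where p: "Factorial_Ring.prime p" "p dvd n" using prime_factor_nat by blast
    then obtain k where k: "n = p * k" by blast
    then have "of_nat p * of_nat k \<in> P" using less.prems by simp
    then have "of_nat p \<in> P \<or> of_nat k \<in> P"
      using P_prime ints_of_int[of "int p"] ints_of_int[of "int k"] by simp
    moreover have "k < n" "k > 0" using k less.prems prime_gt_1_nat[OF p(1)] by auto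
    ultimately show ?case using less.IH p(1) by blast
  qed
  ultimately show ?thesis using that m(1) by (metis zero_less_nat_eq zero_less_abs_iff)
qed

lemma P_frobenius_add:
  assumes l: "Factorial_Ring.prime l" "of_nat l \<in> P" and x: "x \<in> ints" and y: "y \<in> ints"
  shows "(x + y) ^ (l ^ j) - (x ^ (l ^ j) + y ^ (l ^ j)) \<in> P"
proof (induction j)
  case 0
  then show ?case by (simp add: P_closed)
next
  case (Suc j)
  have prime_case: "(u + v) ^ l - (u ^ l + v ^ l) \<in> P" if u: "u \<in> ints" and v: "v \<in> ints" for u v
  proof -
    have l0: "l > 0" using l(1) prime_gt_0_nat by blast
    have "(u + v) ^ l = (\<Sum>k\<le>l. of_nat (l choose k) * u ^ k * v ^ (l - k))"
      by (rule binomial_ring)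
    also have "{..l} = insert 0 (insert l {1..<l})" using l0 by auto
    also have "(\<Sum>k\<in>insert 0 (insert l {1..<l}). of_nat (l choose k) * u ^ k * v ^ (l - k)) =
        v ^ l + (u ^ l + (\<Sum>k\<in>{1..<l}. of_nat (l choose k) * u ^ k * v ^ (l - k)))"
      using l0 by (subst sum.insert) (auto simp: sum.insert)
    finally have "(u + v) ^ l - (u ^ l + v ^ l) =
        (\<Sum>k\<in>{1..<l}. of_nat (l choose k) * u ^ k * v ^ (l - k))" by simp
    also have "\<dots> \<in> P"
    proof (rule add_subgroup_sum[OF submodule_LD(2)[OF P_sub]])
      fix k assume k: "k \<in> {1..<l}"
      \<comment> \<open>From \<open>k * (l choose k) = l * ((l - 1) choose (k - 1))\<close>, where
        \<open>l\<close> cannot divide \<open>k\<close> because \<open>0 < k < l\<close>.\<close>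
      have "l dvd k * (l choose k)" using times_binomial_minus1_eq[of k l] k by simp
      then have "l dvd (l choose k)"
        using l(1) k by (auto simp: prime_dvd_mult_iff dest: dvd_imp_le)
      then obtain m where m: "l choose k = l * m" by blast
      have "of_nat (l choose k) * u ^ k * v ^ (l - k) = (of_nat m * u ^ k * v ^ (l - k)) * of_nat l"
        by (simp add: m mult_ac)
      also have "\<dots> \<in> P"
        using ints_of_int[of "int m"] by (intro P_closed(1) l(2) ints_closed(5) ints_power u v) simp
      finally show "of_nat (l choose k) * u ^ k * v ^ (l - k) \<in> P" .
    qed
    finally show ?thesis .
  qed
  let ?n = "l ^ j"
  have "((x + y) ^ ?n) ^ l - (x ^ ?n + y ^ ?n) ^ l \<in> P"
    by (intro P_cong_power Suc ints_power ints_closed(3) x y)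
  from P_cong_trans[OF this prime_case[OF ints_power ints_power, OF x y]]
  show ?case by (simp add: power_mult[symmetric] mult.commute)
qed

section \<open>The residue field at P\<close>

abbreviation Q where "Q \<equiv> ring_of_integers L Quot P"
abbreviation cl where "cl x \<equiv> P +>\<^bsub>ring_of_integers L\<^esub> x"

interpretation O: domain "ring_of_integers L" by (rule domain_ring_of_integers)
interpretation PI: primeideal P "ring_of_integers L" by (rule P_primeideal)
interpretation Q: domain Q by (rule PI.quotient_is_domain)

lemma O_minus: "x \<in> ints \<Longrightarrow> y \<in> ints \<Longrightarrow> x \<ominus>\<^bsub>ring_of_integers L\<^esub> y = x - y"
  using O.minus_eq[of x y] O.l_neg[of y] by (simp add: eq_neg_iff_add_eq_0[symmetric])

lemma cl_eq_iff: "x \<in> ints \<Longrightarrow> y \<in> ints \<Longrightarrow> cl x = cl y \<longleftrightarrow> x - y \<in> P"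
  using O.quotient_eq_iff_same_a_r_cos[OF PI.is_ideal, of x y] by (simp add: O_minus)

lemma carrier_Q: "carrier Q = cl ` ints"
  by (auto simp: FactRing_def A_RCOSETS_def' )

lemma cl_hom:
  "x \<in> ints \<Longrightarrow> cl x \<in> carrier Q" "x \<in> ints \<Longrightarrow> y \<in> ints \<Longrightarrow> cl (x + y) = cl x \<oplus>\<^bsub>Q\<^esub> cl y"
  "x \<in> ints \<Longrightarrow> y \<in> ints \<Longrightarrow> cl (x * y) = cl x \<otimes>\<^bsub>Q\<^esub> cl y" "cl 1 = \<one>\<^bsub>Q\<^esub>"
  using ring_hom_add[OF PI.rcos_ring_hom, of x y] ring_hom_mult[OF PI.rcos_ring_hom, of x y]
    ring_hom_one[OF PI.rcos_ring_hom] by (auto simp: carrier_Q)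

lemma cl_0: "cl 0 = \<zero>\<^bsub>Q\<^esub>"
  using ring_hom_zero[OF PI.rcos_ring_hom O.ring_axioms PI.quotient_is_ring] by simp

lemma cl_minus: "x \<in> ints \<Longrightarrow> cl (- x) = \<ominus>\<^bsub>Q\<^esub> cl x"
  using Q.minus_equality[of "cl (- x)" "cl x"] cl_hom(2)[of "- x" x] cl_hom(1)
  by (simp add: ints_closed cl_0)

lemma cl_power: "x \<in> ints \<Longrightarrow> cl (x ^ n) = cl x [^]\<^bsub>Q\<^esub> n"
proof (induction n)
  case (Suc n)
  have "cl (x ^ Suc n) = cl (x ^ n * x)" by (simp add: mult.commute)
  then show ?case using Suc by (simp add: cl_hom(3) ints_power)
qed (simp add: cl_hom)

lemma cl_power_eq_iff: "x \<in> ints \<Longrightarrow> cl x [^]\<^bsub>Q\<^esub> n = cl x \<longleftrightarrow> x ^ n - x \<in> P"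
  using cl_eq_iff[OF ints_power, of x x n] by (simp add: cl_power)

lemma finite_Q: "finite (carrier Q)"
proof -
  obtain a where a: "a \<in> P" "a \<noteq> 0" using fideal_nonzero[OF P_fideal] .
  then have aB: "a \<in> ints" using P_ints by blast
  obtain R where R: "finite R" "R \<subseteq> ints" "\<forall>x\<in>ints. \<exists>r\<in>R. \<exists>y\<in>ints. x = r + a * y"
    using finite_modE[OF finite_mod_ints[OF aB a(2)]] .
  have "carrier Q \<subseteq> cl ` R"
  proof
    fix X' assume "X' \<in> carrier Q"
    then obtain x where x: "x \<in> ints" "X' = cl x" by (auto simp: carrier_Q)
    obtain r y where r: "r \<in> R" "y \<in> ints" "x = r + a * y" using R(3) x(1) by blast
    have "x - r \<in> P" using P_closed(2)[OF r(2) a(1)] r(3) by simp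
    then show "X' \<in> cl ` R" using cl_eq_iff[OF x(1), of r] r(1) R(2) x(2) by auto
  qed
  then show ?thesis using R(1) finite_surj by blast
qed

lemma cl_inverse:
  assumes u: "u \<in> ints" "u \<notin> P"
  obtains d where "cl u \<otimes>\<^bsub>Q\<^esub> cl (u ^ d) = \<one>\<^bsub>Q\<^esub>"
proof -
  obtain d where d: "d > 0" "u ^ d - 1 \<in> P" using P_power_cong[OF u] .
  have "u * u ^ (d - 1) = u ^ d" using d(1) by (simp add: power_eq_if)
  then have "cl u \<otimes>\<^bsub>Q\<^esub> cl (u ^ (d - 1)) = \<one>\<^bsub>Q\<^esub>"
    using cl_eq_iff[of "u * u ^ (d - 1)" 1] d(2) u by (simp add: ints_closed ints_power flip: cl_hom(3,4))
  then show ?thesis by (rule that)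
qed

lemma field_Q: "field Q"
proof (rule Q.cring_fieldI)
  have "cl u \<in> Units Q" if u: "u \<in> ints" "u \<notin> P" for u
  proof -
    obtain d where d: "cl u \<otimes>\<^bsub>Q\<^esub> cl (u ^ d) = \<one>\<^bsub>Q\<^esub>" using cl_inverse[OF u] .
    have "cl u \<in> carrier Q" "cl (u ^ d) \<in> carrier Q" using u by (auto intro: cl_hom(1) ints_power)
    with d show ?thesis using Q.m_comm[of "cl u" "cl (u ^ d)"] unfolding Units_def by auto
  qed
  moreover have "x \<in> P \<longleftrightarrow> cl x = \<zero>\<^bsub>Q\<^esub>" if "x \<in> ints" for x
    using cl_eq_iff[OF that ints_closed(1)] by (simp add: cl_0)
  moreover have zero_Units: "\<zero>\<^bsub>Q\<^esub> \<notin> Units Q"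
    using Q.one_not_zero by (auto simp: Units_def)
  ultimately show "Units Q = carrier Q - {\<zero>\<^bsub>Q\<^esub>}"
    using Q.Units_closed zero_Units by (auto simp: carrier_Q)
qed

interpretation Q: field Q by (rule field_Q)

abbreviation kres where "kres \<equiv> cl ` K.ints"

lemma subfield_kres: "subfield kres Q"
proof (rule Q.subfieldI')
  show "subring kres Q"
  proof (rule Q.subringI)
    show "kres \<subseteq> carrier Q" by (auto simp: carrier_Q Kints_ints)
    show "\<one>\<^bsub>Q\<^esub> \<in> kres" using K.ints_closed(2) by (force simp: cl_hom(4)[symmetric])
    show "\<ominus>\<^bsub>Q\<^esub> h \<in> kres" if "h \<in> kres" for h
      using that cl_minus K.ints_closed(4) Kints_ints by (force simp: image_iff)
    show "h1 \<otimes>\<^bsub>Q\<^esub> h2 \<in> kres" "h1 \<oplus>\<^bsub>Q\<^esub> h2 \<in> kres" if "h1 \<in> kres" "h2 \<in> kres" for h1 h2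
    proof -
      obtain x y where "x \<in> K.ints" "y \<in> K.ints" "h1 = cl x" "h2 = cl y" using \<open>h1 \<in> kres\<close> \<open>h2 \<in> kres\<close> by auto
      then show "h1 \<otimes>\<^bsub>Q\<^esub> h2 \<in> kres" "h1 \<oplus>\<^bsub>Q\<^esub> h2 \<in> kres"
        using cl_hom(2,3)[of x y] Kints_ints K.ints_closed(3,5)[of x y] by (auto simp: image_iff)
    qed
  qed
  fix h assume "h \<in> kres - {\<zero>\<^bsub>Q\<^esub>}"
  then obtain u where u: "u \<in> K.ints" "h = cl u" "cl u \<noteq> \<zero>\<^bsub>Q\<^esub>" by auto
  have uB: "u \<in> ints" "u \<notin> P"
    using Kints_ints[OF u(1)] u(3) cl_eq_iff[of u 0] by (auto simp: cl_0 ints_closed)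
  obtain d where d: "cl u \<otimes>\<^bsub>Q\<^esub> cl (u ^ d) = \<one>\<^bsub>Q\<^esub>" using cl_inverse[OF uB] .
  then have "inv\<^bsub>Q\<^esub> h = cl (u ^ d)"
    using Q.comm_inv_char[of h "cl (u ^ d)"] u(2) cl_hom(1)[OF uB(1)] cl_hom(1)[OF ints_power[OF uB(1)]] by simp
  then show "inv\<^bsub>Q\<^esub> h \<in> kres" using K.ints_power[OF u(1)] by blast
qed

text \<open>\<open>S\<close> is arbitrary because powers depend only on the operations of a monoid;
  it is instantiated with \<open>kres\<close>.\<close>

lemma cl_of_nat_mult:
  assumes "x \<in> ints"
  shows "cl (of_nat n * x) = cl x [^]\<^bsub>add_monoid (Q\<lparr>carrier := S\<rparr>)\<^esub> n"
proof (induction n)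
  case (Suc n)
  have "cl (of_nat (Suc n) * x) = cl (of_nat n * x + x)" by (simp add: algebra_simps)
  also have "\<dots> = cl (of_nat n * x) \<oplus>\<^bsub>Q\<^esub> cl x"
    using assms ints_of_int[of "int n"] by (intro cl_hom(2) ints_closed(5)) simp_all
  finally show ?case using Suc by simp
qed (simp add: cl_0)

text \<open>Collects what is needed about the residue fields as congruences between integers, so
  that quotient rings can be left behind. Here \<open>q\<close> is the cardinality of the residue
  field of \<open>K\<close>, and \<open>\<gamma>\<close> lifts a generator of the cyclic group of
  units of \<open>ints / P\<close>.\<close>

lemma residue_structure:
  defines "f \<equiv> residue_degree K L P"
  obtains q \<gamma> where "q > 1" "f > 0"
    "\<forall>x\<in>ints. \<forall>y\<in>ints. (x + y) ^ q - (x ^ q + y ^ q) \<in> P"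
    "\<forall>a\<in>K.ints. a ^ q - a \<in> P"
    "\<forall>c\<in>ints. c ^ q - c \<in> P \<longrightarrow> (\<exists>a\<in>K.ints. c - a \<in> P)"
    "\<gamma> \<in> ints" "\<gamma> \<notin> P" "\<forall>x\<in>ints. x \<in> P \<or> (\<exists>m. x - \<gamma> ^ m \<in> P)"
    "\<forall>x\<in>ints. x ^ (q ^ f) - x \<in> P"
    "\<forall>j. 0 < j \<longrightarrow> j < f \<longrightarrow> (\<exists>x\<in>ints. x ^ (q ^ j) - x \<notin> P)"
    "of_nat (q ^ f) \<in> P"
proof -
  define q where "q = card kres"
  have kQ: "kres \<subseteq> carrier Q" by (rule subfieldE(3)[OF subfield_kres])
  have fk: "finite kres" using finite_subset[OF kQ finite_Q] .
  have "{\<zero>\<^bsub>Q\<^esub>, \<one>\<^bsub>Q\<^esub>} \<subseteq> kres"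
    using subringE(2,3)[OF subfieldE(1)[OF subfield_kres]] by simp
  from card_mono[OF fk this] have q1: "q > 1" using Q.one_not_zero by (simp add: q_def)
  obtain Us where Us: "set Us = carrier Q" using finite_list[OF finite_Q] by blast
  have "Q.Span kres Us = carrier Q"
    using Q.Span_in_carrier[OF kQ, of Us] Q.Span_base_incl[OF subfield_kres, of Us] Us by auto
  then have "Q.finite_dimension kres (carrier Q)"
    using Q.Span_finite_dimension[OF subfield_kres, of Us] Us by simp
  then obtain n where n: "Q.dimension n kres (carrier Q)"
    unfolding Q.finite_dimension_def by blast
  then have "f = n"
    using Q.dimI[OF subfield_kres n] by (simp add: f_def residue_degree_def over_def K.carrier_ring_of_integers)
  with Q.dimension_card[OF subfield_kres fk n] have cQ: "card (carrier Q) = q ^ f"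
    by (simp add: q_def)
  have "card (carrier Q) \<noteq> 1"
    using Q.one_not_zero Q.zero_closed Q.one_closed by (metis card_1_singletonE singletonD)
  then have f0: "f > 0" using cQ by (cases f) auto
  obtain l where l: "Factorial_Ring.prime l" "of_nat l \<in> P" using residue_prime .
  let ?F = "Q\<lparr>carrier := kres\<rparr>"
  interpret F: field ?F by (rule Q.subfield_iff(2)[OF subfield_kres])
  \<comment> \<open>Every element of the residue field of \<open>K\<close> is killed by
    \<open>l\<close>, so the order of its additive group is a power of \<open>l\<close>.\<close>
  have "\<exists>j. Coset.order (add_monoid ?F) = l ^ j"
  proof (rule group.order_prime_power[OF F.a_group _ l(1)])
    show "finite (carrier (add_monoid ?F))" using fk by simp
    fix x assume "x \<in> carrier (add_monoid ?F)"
    then obtain a where a: "a \<in> ints" "x = cl a" using Kints_ints by auto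
    have "of_nat l * a - 0 \<in> P" using P_closed(2)[OF a(1) l(2)] by (simp add: mult.commute)
    moreover have "of_nat l * a \<in> ints" using P_ints calculation by auto
    ultimately have "cl (of_nat l * a) = cl 0" by (simp add: cl_eq_iff ints_closed)
    then show "x [^]\<^bsub>add_monoid ?F\<^esub> l = \<one>\<^bsub>add_monoid ?F\<^esub>"
      unfolding a(2) cl_of_nat_mult[OF a(1), of l kres, symmetric] by (simp add: cl_0)
  qed
  then obtain i where i: "q = l ^ i" by (auto simp: Coset.order_def q_def)
  then have i0: "i > 0" using q1 by (cases i) auto
  have kpow: "x [^]\<^bsub>Q\<^esub> q = x" if "x \<in> kres" for x
    using F.finite_field_pow_card[of x] fk that Q.nat_pow_consistent[of x q kres]
    by (simp add: q_def)
  have Qpow: "x [^]\<^bsub>Q\<^esub> (q ^ f) = x" if "x \<in> carrier Q" for x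
    using Q.finite_field_pow_card[OF finite_Q that] by (simp add: cQ)
  have roots: "card {x \<in> carrier Q. x [^]\<^bsub>Q\<^esub> d = \<one>\<^bsub>Q\<^esub>} \<le> d" if "d > 0" for d :: nat
    using Q.num_roots_le_deg[OF finite_Q, of d] that by simp
  \<comment> \<open>The nonzero elements of \<open>kres\<close> already account for the at most
    \<open>q - 1\<close> roots of \<open>X ^ (q - 1) - 1\<close>, so an element equal to its
    \<open>q\<close>-th power belongs to \<open>kres\<close>.\<close>
  have fixed: "x \<in> kres" if x: "x \<in> carrier Q" "x [^]\<^bsub>Q\<^esub> q = x" for x
  proof (cases "x = \<zero>\<^bsub>Q\<^esub>")
    case True
    then show ?thesis using \<open>{\<zero>\<^bsub>Q\<^esub>, \<one>\<^bsub>Q\<^esub>} \<subseteq> kres\<close> by simp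
  next
    case False
    let ?Z = "{x \<in> carrier Q. x [^]\<^bsub>Q\<^esub> (q - 1) = \<one>\<^bsub>Q\<^esub>}"
    have "kres - {\<zero>\<^bsub>Q\<^esub>} \<subseteq> ?Z"
    proof
      fix y assume "y \<in> kres - {\<zero>\<^bsub>Q\<^esub>}"
      then have "y \<in> carrier Q" "y \<noteq> \<zero>\<^bsub>Q\<^esub>" "y [^]\<^bsub>Q\<^esub> q = y"
        using kQ kpow by blast+
      then show "y \<in> ?Z" using Q.pow_diff_one[of y q] q1 by simp
    qed
    moreover have "card ?Z \<le> card (kres - {\<zero>\<^bsub>Q\<^esub>})"
      using roots[of "q - 1"] q1 \<open>{\<zero>\<^bsub>Q\<^esub>, \<one>\<^bsub>Q\<^esub>} \<subseteq> kres\<close> fk by (simp add: q_def)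
    ultimately have "kres - {\<zero>\<^bsub>Q\<^esub>} = ?Z"
      using finite_Q by (intro card_seteq) auto
    then show ?thesis using Q.pow_diff_one[OF x(1) False x(2)] x(1) q1 by blast
  qed
  obtain g where g: "g \<in> carrier Q" "carrier Q - {\<zero>\<^bsub>Q\<^esub>} = {g [^]\<^bsub>Q\<^esub> i | i::nat. i \<in> UNIV}"
    using Q.finite_field_mult_group_has_gen[OF finite_Q] by (auto simp: Multiplicative_Group.carrier_mult_of)
  then obtain \<gamma> where \<gamma>: "\<gamma> \<in> ints" "g = cl \<gamma>" by (auto simp: carrier_Q)
  have "g [^]\<^bsub>Q\<^esub> (1::nat) \<in> carrier Q - {\<zero>\<^bsub>Q\<^esub>}" unfolding g(2) by blast
  then have "\<gamma> \<notin> P"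
    using cl_eq_iff[OF \<gamma>(1) ints_closed(1)] g(1) by (simp add: \<gamma>(2) cl_0)
  show ?thesis
  proof (rule that[OF q1 f0 _ _ _ \<gamma>(1) \<open>\<gamma> \<notin> P\<close>])
    show "\<forall>x\<in>ints. \<forall>y\<in>ints. (x + y) ^ q - (x ^ q + y ^ q) \<in> P"
      unfolding i using P_frobenius_add[OF l] by blast
    show "\<forall>a\<in>K.ints. a ^ q - a \<in> P"
      using kpow cl_power_eq_iff[OF Kints_ints] by blast
    show "\<forall>c\<in>ints. c ^ q - c \<in> P \<longrightarrow> (\<exists>a\<in>K.ints. c - a \<in> P)"
    proof (intro ballI impI)
      fix c assume c: "c \<in> ints" "c ^ q - c \<in> P"
      then have "cl c [^]\<^bsub>Q\<^esub> q = cl c" by (simp add: cl_power_eq_iff)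
      then have "cl c \<in> kres" using fixed cl_hom(1)[OF c(1)] by blast
      then obtain a where "a \<in> K.ints" "cl c = cl a" by auto
      then show "\<exists>a\<in>K.ints. c - a \<in> P" using cl_eq_iff[OF c(1)] Kints_ints by blast
    qed
    show "\<forall>x\<in>ints. x \<in> P \<or> (\<exists>m. x - \<gamma> ^ m \<in> P)"
    proof
      fix x assume x: "x \<in> ints"
      show "x \<in> P \<or> (\<exists>m. x - \<gamma> ^ m \<in> P)"
      proof (cases "cl x = \<zero>\<^bsub>Q\<^esub>")
        case True
        then show ?thesis using cl_eq_iff[OF x ints_closed(1)] by (simp add: cl_0)
      next
        case False
        then have "cl x \<in> carrier Q - {\<zero>\<^bsub>Q\<^esub>}" using cl_hom(1)[OF x] by simp
        then obtain m :: nat where "cl x = cl (\<gamma> ^ m)"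
          unfolding g(2) using \<gamma> by (auto simp: cl_power)
        then show ?thesis using cl_eq_iff[OF x ints_power[OF \<gamma>(1)]] by blast
      qed
    qed
    show "\<forall>x\<in>ints. x ^ (q ^ f) - x \<in> P"
      using Qpow[OF cl_hom(1)] cl_power_eq_iff by blast
    show "\<forall>j. 0 < j \<longrightarrow> j < f \<longrightarrow> (\<exists>x\<in>ints. x ^ (q ^ j) - x \<notin> P)"
    proof (intro allI impI, rule ccontr)
      \<comment> \<open>If the power \<open>q ^ j\<close> fixed the whole residue field, its
        \<open>q ^ f - 1\<close> nonzero elements would all be roots of
        \<open>X ^ (q ^ j - 1) - 1\<close>, too many for \<open>j < f\<close>.\<close>
      fix j assume j: "0 < j" "j < f" and neg: "\<not> (\<exists>x\<in>ints. x ^ (q ^ j) - x \<notin> P)"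
      have pw: "x [^]\<^bsub>Q\<^esub> (q ^ j) = x" if "x \<in> carrier Q" for x
        using that neg cl_power_eq_iff unfolding carrier_Q by blast
      have qj: "q ^ j > 1" by (rule one_less_power[OF q1 j(1)])
      let ?Z = "{x \<in> carrier Q. x [^]\<^bsub>Q\<^esub> (q ^ j - 1) = \<one>\<^bsub>Q\<^esub>}"
      have "carrier Q - {\<zero>\<^bsub>Q\<^esub>} \<subseteq> ?Z"
      proof
        fix y assume "y \<in> carrier Q - {\<zero>\<^bsub>Q\<^esub>}"
        then have "y \<in> carrier Q" "y \<noteq> \<zero>\<^bsub>Q\<^esub>" by blast+
        then show "y \<in> ?Z" using Q.pow_diff_one[of y "q ^ j"] pw qj q1 by simp
      qed
      then have "card (carrier Q - {\<zero>\<^bsub>Q\<^esub>}) \<le> card ?Z"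
        using finite_Q by (intro card_mono) auto
      also have "\<dots> \<le> q ^ j - 1" using roots[of "q ^ j - 1"] qj by simp
      finally have "card (carrier Q - {\<zero>\<^bsub>Q\<^esub>}) \<le> q ^ j - 1" .
      then have "q ^ f - 1 \<le> q ^ j - 1" using cQ finite_Q by simp
      moreover have "q ^ j < q ^ f" using j q1 by simp
      ultimately show False using qj by linarith
    qed
    have "i * f = Suc (i * f - 1)" using i0 f0 by simp
    then have "q ^ f = l ^ (i * f - 1) * l"
      unfolding i power_mult[symmetric] by (metis power_Suc2)
    then have "of_nat (q ^ f) = of_nat (l ^ (i * f - 1)) * (of_nat l :: 'a)" by (metis of_nat_mult)
    then show "of_nat (q ^ f) \<in> P"
      using P_closed(1)[OF ints_of_int[of "int (l ^ (i * f - 1))"] l(2)] by simp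
  qed
qed

end

section \<open>The decomposition group of an unramified prime\<close>

context galois_prime
begin

lemma Gal_image_mem_iff:
  assumes "\<sigma> \<in> carrier G" "M \<subseteq> L" "x \<in> L"
  shows "x \<in> \<sigma> ` M \<longleftrightarrow> (inv\<^bsub>G\<^esub> \<sigma>) x \<in> M"
proof
  assume "x \<in> \<sigma> ` M"
  then show "(inv\<^bsub>G\<^esub> \<sigma>) x \<in> M" using Gal_inv_apply(1)[OF assms(1)] assms(2) by auto
next
  assume "(inv\<^bsub>G\<^esub> \<sigma>) x \<in> M"
  then show "x \<in> \<sigma> ` M" using Gal_inv_apply(2)[OF assms(1,3)] by (metis image_eqI)
qed

lemma P_L: "P \<subseteq> L"
  using P_ints ints_L by blast

lemma image_P:
  assumes "\<sigma> \<in> carrier G"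
  shows "submodule_L (\<sigma> ` P)" "\<sigma> ` P \<subseteq> ints"
  using submodule_image[OF assms P_sub] Gal_ints[OF assms] P_ints by auto

text \<open>\<open>P\<close> is maximal: an element of \<open>M\<close> outside \<open>P\<close> has
  a power congruent to 1 modulo \<open>P\<close>, and that power is still in
  \<open>M\<close>.\<close>

lemma comaximal_P:
  assumes M: "submodule_L M" "M \<subseteq> ints" "\<not> M \<subseteq> P"
  obtains u where "u \<in> M" "u - 1 \<in> P"
proof -
  obtain w where w: "w \<in> M" "w \<notin> P" using M(3) by blast
  then have wB: "w \<in> ints" using M(2) by blast
  obtain d where d: "d > 0" "w ^ d - 1 \<in> P" using P_power_cong[OF wB w(2)] .
  have "w ^ d = w ^ (d - 1) * w" using d(1) by (metis Suc_diff_1 power_Suc2)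
  then have "w ^ d \<in> M" using submodule_LD(3)[OF M(1) ints_power[OF wB] w(1)] by simp
  then show ?thesis using that d(2) by blast
qed

text \<open>Suppose \<open>w\<close> lies in \<open>P\<close> but not in its image. Its preimage
  under \<open>\<sigma>\<close> is then outside \<open>P\<close> and has a power congruent to 1;
  applying \<open>\<sigma>\<close> gives \<open>w ^ d - 1\<close> in the image of \<open>P\<close>,
  hence in \<open>P\<close>, although \<open>w ^ d\<close> is in \<open>P\<close>.\<close>

lemma image_P_subset:
  assumes s: "\<sigma> \<in> carrier G" and sub: "\<sigma> ` P \<subseteq> P"
  shows "\<sigma> ` P = P"
proof (rule ccontr)
  assume "\<sigma> ` P \<noteq> P"
  then obtain w where w: "w \<in> P" "w \<notin> \<sigma> ` P" using sub by blast
  let ?i = "inv\<^bsub>G\<^esub> \<sigma>"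
  have i: "?i \<in> carrier G" using s by simp
  have wB: "w \<in> ints" using w P_ints by blast
  have "?i w \<notin> P" using w(2) Gal_image_mem_iff[OF s P_L ints_L[OF wB]] by simp
  then obtain d where d: "d > 0" "(?i w) ^ d - 1 \<in> P" using P_power_cong[OF Gal_ints[OF i wB]] by blast
  have "\<sigma> ((?i w) ^ d - 1) = w ^ d - 1"
    using Gal_ints[OF i wB] s
    by (simp add: Gal_diff Gal_power ints_L ints_power ints_closed Gal_inv_apply wB)
  then have "w ^ d - 1 \<in> P" using sub d(2) by force
  moreover have "w ^ d \<in> P"
    using P_closed(2)[OF ints_power[OF wB] w(1), of "d - 1"] d(1)
    by (metis Suc_diff_1 power_Suc power_Suc2)
  ultimately show False using P_closed(6)[of "w ^ d" "w ^ d - 1"] one_notin_P by simp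
qed

definition D where "D = {\<sigma> \<in> carrier G. \<sigma> ` P = P}"

lemma D_Gal: "\<sigma> \<in> D \<Longrightarrow> \<sigma> \<in> carrier G" and D_P: "\<sigma> \<in> D \<Longrightarrow> x \<in> P \<Longrightarrow> \<sigma> x \<in> P"
  by (auto simp: D_def)

lemma D_subgroup: "subgroup D G"
proof (rule Gal.subgroupI)
  show "D \<subseteq> carrier G" by (auto simp: D_def)
  have "\<one>\<^bsub>G\<^esub> \<in> D" by (simp add: D_def Gal_image_one P_L)
  then show "D \<noteq> {}" by blast
  show "inv\<^bsub>G\<^esub> \<sigma> \<in> D" if "\<sigma> \<in> D" for \<sigma>
    using that Gal_image_inv(1)[of \<sigma> P] P_L by (simp add: D_def)
  show "\<sigma> \<otimes>\<^bsub>G\<^esub> \<tau> \<in> D" if "\<sigma> \<in> D" "\<tau> \<in> D" for \<sigma> \<tau>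
    using that Gal_image_mult[of \<sigma> \<tau> P] P_L by (simp add: D_def)
qed

lemma D_iff: "\<sigma> \<in> D \<Longrightarrow> x \<in> L \<Longrightarrow> \<sigma> x \<in> P \<longleftrightarrow> x \<in> P"
  using D_P[of \<sigma> x] D_P[OF subgroup.m_inv_closed[OF D_subgroup], of \<sigma> "\<sigma> x"]
    Gal_inv_apply(1)[OF D_Gal, of \<sigma> x] by auto

lemma P_prod:
  assumes "finite I" "\<And>i. i \<in> I \<Longrightarrow> f i \<in> ints" "(\<Prod>i\<in>I. f i) \<in> P"
  shows "\<exists>i\<in>I. f i \<in> P"
  using assms
proof (induction I rule: finite_induct)
  case (insert i I)
  have "(\<Prod>i\<in>I. f i) \<in> ints"
    using insert.hyps(1) insert.prems(1)
    by (induction I rule: finite_induct) (auto intro: ints_closed)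
  then show ?case using insert P_prime[of "f i" "\<Prod>i\<in>I. f i"] by auto
qed (use one_notin_P in simp)

text \<open>Serves to carry roots to roots modulo \<open>P\<close>: once with the power map
  \<open>x ^ q\<close> for \<open>\<phi>\<close>, once with an element of \<open>D\<close>.\<close>

lemma poly_hom_mod_P:
  assumes \<phi>: "\<And>x. x \<in> ints \<Longrightarrow> \<phi> x \<in> ints" "\<phi> 0 \<in> P"
      "\<And>x y. x \<in> ints \<Longrightarrow> y \<in> ints \<Longrightarrow> \<phi> (x + y) - (\<phi> x + \<phi> y) \<in> P"
      "\<And>x y. x \<in> ints \<Longrightarrow> y \<in> ints \<Longrightarrow> \<phi> (x * y) - \<phi> x * \<phi> y \<in> P"
    and p: "\<And>i. coeff p i \<in> ints" "\<And>i. \<phi> (coeff p i) - coeff p i \<in> P" and y: "y \<in> ints"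
  shows "poly p y \<in> ints \<and> \<phi> (poly p y) - poly p (\<phi> y) \<in> P"
  using p
proof (induction p)
  case 0
  then show ?case using \<phi>(2) by (simp add: ints_closed)
next
  case (pCons a p)
  have a: "a \<in> ints" "\<phi> a - a \<in> P" using pCons.prems[of 0] by simp_all
  have c: "coeff p i \<in> ints" "\<phi> (coeff p i) - coeff p i \<in> P" for i
    using pCons.prems[of "Suc i"] by simp_all
  have IH: "poly p y \<in> ints" "\<phi> (poly p y) - poly p (\<phi> y) \<in> P"
    using pCons.IH[OF c] by simp_all
  have yp: "y * poly p y \<in> ints" using y IH by (intro ints_closed)
  have "\<phi> (a + y * poly p y) - (a + \<phi> y * poly p (\<phi> y)) =
      (\<phi> (a + y * poly p y) - (\<phi> a + \<phi> (y * poly p y))) + ((\<phi> a - a) +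
      ((\<phi> (y * poly p y) - \<phi> y * \<phi> (poly p y)) + \<phi> y * (\<phi> (poly p y) - poly p (\<phi> y))))"
    by (simp add: algebra_simps)
  also have "\<dots> \<in> P"
    by (intro P_closed(5) P_closed(1)[of "\<phi> y"] \<phi> a IH y yp)
  finally show ?case using a yp by (auto intro: ints_closed)
qed

section \<open>Powers of P\<close>

abbreviation pow_P where "pow_P k \<equiv> P [^]\<^bsub>ideal_group L\<^esub> (k::nat)"

lemma pow_P_Suc: "pow_P (Suc k) = pow_P k \<star> P"
  by simp

lemma pow_P: "submodule_L (pow_P k)" "pow_P k \<subseteq> ints" "pow_P (Suc k) \<subseteq> pow_P k" "fideal (pow_P k)"
proof -
  show f: "fideal (pow_P k)" for k
    using IG.nat_pow_closed[of P k] P_fideal by simp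
  show s: "submodule_L (pow_P k)" for k by (rule fidealD[OF f])
  show sub: "pow_P (Suc k) \<subseteq> pow_P k" for k
    unfolding pow_P_Suc
    by (rule ideal_mult_least) (use P_ints in \<open>auto intro: submodule_LD(4,7)[OF s]\<close>)
  show "pow_P k \<subseteq> ints"
    by (induction k) (use sub in \<open>auto simp del: nat_pow_Suc\<close>)
qed

lemma pow_P_power: "x \<in> P \<Longrightarrow> x ^ k \<in> pow_P k"
proof (induction k)
  case (Suc k)
  then show ?case
    unfolding pow_P_Suc using ideal_mult_prod[of "x ^ k" "pow_P k" x P] by (simp add: mult.commute)
qed (simp add: ints_closed)

lemma pow_P_strict: "pow_P (Suc k) \<noteq> pow_P k"
proof
  assume "pow_P (Suc k) = pow_P k"
  then have "pow_P k \<otimes>\<^bsub>ideal_group L\<^esub> P = pow_P k \<otimes>\<^bsub>ideal_group L\<^esub> ints"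
    unfolding pow_P_Suc using ideal_mult_ints(2)[OF pow_P(1)] by simp
  then have "P = ints"
    using IG.l_cancel[of "pow_P k" P ints] pow_P(4) P_fideal fideal_ints by simp
  then show False using one_notin_P ints_closed(2) by simp
qed

text \<open>The powers of \<open>P\<close> strictly decrease, and as long as they contain
  \<open>t\<close> each is determined by its representatives modulo \<open>t\<close>. Every step
  loses at least one of the finitely many elements of \<open>R\<close>, so \<open>card R\<close>
  bounds the exponent.\<close>

lemma pow_P_bounded:
  assumes t: "t \<in> ints" "t \<noteq> 0"
  obtains b where "\<And>k. t \<in> pow_P k \<Longrightarrow> k \<le> b"
proof -
  obtain R where R: "finite R" "R \<subseteq> ints" "\<forall>x\<in>ints. \<exists>r\<in>R. \<exists>y\<in>ints. x = r + t * y"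
    using finite_modE[OF finite_mod_ints[OF t]] .
  have "card (pow_P k \<inter> R) + k \<le> card R" if "t \<in> pow_P k" for k
    using that
  proof (induction k)
    case 0
    then show ?case using R(1) by (auto intro: card_mono)
  next
    case (Suc k)
    have tk: "t \<in> pow_P k" using Suc.prems pow_P(3) by blast
    obtain y where y: "y \<in> pow_P k" "y \<notin> pow_P (Suc k)"
      using pow_P_strict[of k] pow_P(3)[of k] by blast
    then have "y \<in> ints" using pow_P(2) by blast
    then obtain r z where r: "r \<in> R" "z \<in> ints" "y = r + t * z" using R(3) by blast
    have "t * z \<in> pow_P k" "t * z \<in> pow_P (Suc k)"
      using submodule_LD(4)[OF pow_P(1) r(2)] tk Suc.prems by blast+
    then have "r \<in> pow_P k" "r \<notin> pow_P (Suc k)"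
      using submodule_LD(8)[OF pow_P(1) y(1), of "t * z"] submodule_LD(7)[OF pow_P(1), of r "Suc k" "t * z"] y(2)
      by (auto simp: r(3) simp del: nat_pow_Suc)
    then have "pow_P (Suc k) \<inter> R \<subset> pow_P k \<inter> R" using pow_P(3)[of k] r(1) by blast
    then have "card (pow_P (Suc k) \<inter> R) < card (pow_P k \<inter> R)" using R(1) by (intro psubset_card_mono) auto
    then show ?case using Suc.IH[OF tk] by linarith
  qed
  then show ?thesis using that[of "card R"] by (metis add_leD2)
qed

text \<open>Modulo \<open>pow_P m\<close> the element \<open>s\<close> has an inverse:
  \<open>s ^ d = 1 - e\<close> with \<open>e\<close> in \<open>P\<close>, and the geometric series
  inverts \<open>1 - e\<close> up to \<open>e ^ m\<close>.\<close>

lemma pow_P_cancel: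
  assumes s: "s \<in> ints" "s \<notin> P" and t: "t \<in> ints" "t * s \<in> pow_P m"
  shows "t \<in> pow_P m"
proof -
  obtain d where d: "d > 0" "s ^ d - 1 \<in> P" using P_power_cong[OF s] .
  define e where "e = 1 - s ^ d"
  have e: "e \<in> P" "e \<in> ints" unfolding e_def using P_cong_sym[OF d(2)] P_ints by auto
  define r where "r = s ^ (d - 1) * (\<Sum>i<m. e ^ i)"
  have r: "r \<in> ints"
    unfolding r_def by (intro ints_closed(5) ints_power s add_subgroup_sum[OF ints_add_subgroup] e)
  have "s * s ^ (d - 1) = s ^ d" using d(1) by (metis Suc_diff_1 power_Suc)
  then have "s * r = (1 - e) * (\<Sum>i<m. e ^ i)" by (simp add: r_def e_def mult.assoc[symmetric])
  also have "\<dots> = 1 - e ^ m" by (rule one_diff_power_eq[symmetric])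
  finally have "t = t * (s * r) + t * e ^ m" by (simp add: right_diff_distrib)
  then have "t = (t * s) * r + t * e ^ m" by (simp only: mult.assoc)
  also have "\<dots> \<in> pow_P m"
    by (intro submodule_LD(7)[OF pow_P(1)] submodule_LD(4)[OF pow_P(1) r t(2)]
        submodule_LD(3)[OF pow_P(1) t(1) pow_P_power[OF e(1)]])
  finally show ?thesis .
qed

end

text \<open>The assumptions are the conclusions of \<open>residue_structure\<close>, with
  \<open>f\<close> for the residue degree; the locale keeps \<open>q\<close> and
  \<open>\<gamma>\<close> fixed across several lemmas.\<close>

locale residue_data = galois_prime +
  fixes f q :: nat and \<gamma> :: 'a
  assumes q: "q > 1" and f: "f > 0"
    and frob_add: "\<forall>x\<in>ints. \<forall>y\<in>ints. (x + y) ^ q - (x ^ q + y ^ q) \<in> P"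
    and frob_K: "\<forall>a\<in>K.ints. a ^ q - a \<in> P"
    and frob_fixed: "\<forall>c\<in>ints. c ^ q - c \<in> P \<longrightarrow> (\<exists>a\<in>K.ints. c - a \<in> P)"
    and \<gamma>: "\<gamma> \<in> ints" "\<gamma> \<notin> P" "\<forall>x\<in>ints. x \<in> P \<or> (\<exists>m. x - \<gamma> ^ m \<in> P)"
    and frob_f: "\<forall>x\<in>ints. x ^ (q ^ f) - x \<in> P"
    and frob_less: "\<forall>j. 0 < j \<longrightarrow> j < f \<longrightarrow> (\<exists>x\<in>ints. x ^ (q ^ j) - x \<notin> P)"
    and norm_P: "of_nat (q ^ f) \<in> P"
begin

lemma D_cong:
  assumes "\<sigma> \<in> D" "x \<in> ints" "y \<in> ints" "x - y \<in> P"
  shows "\<sigma> x - \<sigma> y \<in> P"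
  using D_P[OF assms(1,4)] assms(2,3) by (simp add: Gal_diff D_Gal[OF assms(1)] ints_L)

text \<open>Modulo \<open>P\<close> every integer is 0 or a power of \<open>\<gamma>\<close>, so the
  action of an element of \<open>D\<close> on \<open>ints / P\<close> is determined by its value at
  \<open>\<gamma>\<close>. By \<open>n > 0\<close> the \<open>n\<close>-th power of an element of
  \<open>P\<close> is again in \<open>P\<close>.\<close>

lemma D_power_extend:
  assumes s: "\<sigma> \<in> D" and n: "n > 0" and g: "\<sigma> \<gamma> - \<gamma> ^ n \<in> P" and x: "x \<in> ints"
  shows "\<sigma> x - x ^ n \<in> P"
proof -
  have sG: "\<sigma> \<in> carrier G" by (rule D_Gal[OF s])
  consider "x \<in> P" | m where "x - \<gamma> ^ m \<in> P" using \<gamma>(3) x by blast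
  then show ?thesis
  proof cases
    case 1
    then have "x ^ n \<in> P"
      using P_closed(2)[OF ints_power[OF x] 1, of "n - 1"] n by (metis Suc_diff_1 power_Suc)
    then show ?thesis using D_P[OF s 1] by (intro P_closed(6))
  next
    case 2
    have gm: "\<gamma> ^ m \<in> ints" by (rule ints_power[OF \<gamma>(1)])
    have "\<sigma> x - \<sigma> (\<gamma> ^ m) \<in> P" by (rule D_cong[OF s x gm 2])
    moreover have "\<sigma> (\<gamma> ^ m) - (\<gamma> ^ n) ^ m \<in> P"
      using P_cong_power[OF Gal_ints[OF sG \<gamma>(1)] ints_power[OF \<gamma>(1)] g]
      by (simp add: Gal_power[OF sG ints_L[OF \<gamma>(1)]])
    moreover have "(\<gamma> ^ m) ^ n - x ^ n \<in> P"
      by (rule P_cong_power[OF gm x P_cong_sym[OF 2]])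
    then have "(\<gamma> ^ n) ^ m - x ^ n \<in> P" by (simp add: power_mult[symmetric] mult.commute)
    ultimately show ?thesis by (blast intro: P_cong_trans)
  qed
qed

text \<open>Every conjugate of \<open>\<alpha>\<close> is a root of a polynomial over \<open>\<O>\<^sub>K\<close>, hence so is \<open>\<alpha>\<^sup>q\<close> modulo \<open>P\<close>;
  as \<open>\<alpha>\<close> lies in all conjugates of \<open>P\<close> except \<open>P\<close> itself, the conjugate congruent to \<open>\<alpha>\<^sup>q\<close> comes
  from the decomposition group.\<close>

lemma frobenius_exists:
  obtains \<phi> where "\<phi> \<in> D" "\<And>x. x \<in> ints \<Longrightarrow> \<phi> x - x ^ q \<in> P"
proof -
  let ?S = "{\<sigma> \<in> carrier G. \<sigma> ` P \<noteq> P}"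
  have "\<exists>u. u \<in> \<sigma> ` P \<and> u - 1 \<in> P" if "\<sigma> \<in> ?S" for \<sigma>
  proof -
    have sG: "\<sigma> \<in> carrier G" and "\<not> \<sigma> ` P \<subseteq> P" using that image_P_subset[of \<sigma>] by auto
    then obtain v where "v \<in> \<sigma> ` P" "v - 1 \<in> P"
      using comaximal_P[OF image_P[OF sG]] by metis
    then show ?thesis by (intro exI conjI)
  qed
  then have "\<forall>\<sigma>\<in>?S. \<exists>u. u \<in> \<sigma> ` P \<and> u - 1 \<in> P" by (rule ballI)
  from bchoice[OF this] obtain u
    where u': "\<forall>\<sigma>\<in>?S. u \<sigma> \<in> \<sigma> ` P \<and> u \<sigma> - 1 \<in> P" ..
  have u: "u \<sigma> \<in> \<sigma> ` P" "u \<sigma> - 1 \<in> P" if "\<sigma> \<in> ?S" for \<sigma>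
    using bspec[OF u' that] by simp_all
  have uB: "u \<sigma> \<in> ints" if "\<sigma> \<in> ?S" for \<sigma> using u(1)[OF that] image_P(2)[of \<sigma>] that by blast
  have fS: "finite ?S" using finite_Gal by simp
  have prodB: "(\<Prod>\<sigma>\<in>I. u \<sigma>) \<in> ints \<and> (\<Prod>\<sigma>\<in>I. u \<sigma>) - 1 \<in> P" if "finite I" "I \<subseteq> ?S" for I
    using that
  proof (induction I rule: finite_induct)
    case (insert i I)
    then have i: "i \<in> ?S" and IH: "(\<Prod>\<sigma>\<in>I. u \<sigma>) \<in> ints" "(\<Prod>\<sigma>\<in>I. u \<sigma>) - 1 \<in> P" by auto
    show ?case
      using P_cong_mult[OF uB[OF i] ints_closed(2) u(2)[OF i] IH(2)] uB[OF i] IH(1) insert.hyps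
      by (simp add: ints_closed)
  qed (simp add: ints_closed P_closed)
  \<comment> \<open>\<open>e\<close> is the element that the Chinese remainder theorem would give:
    congruent to 1 modulo \<open>P\<close> and contained in every conjugate different from
    \<open>P\<close>.\<close>
  define e where "e = (\<Prod>\<sigma>\<in>?S. u \<sigma>)"
  have e: "e \<in> ints" "e - 1 \<in> P" using prodB[OF fS] by (auto simp: e_def)
  have eS: "e \<in> \<sigma> ` P" if s: "\<sigma> \<in> ?S" for \<sigma>
  proof -
    have "e = u \<sigma> * (\<Prod>\<sigma>\<in>?S - {\<sigma>}. u \<sigma>)" unfolding e_def by (rule prod.remove[OF fS s])
    moreover have "(\<Prod>\<sigma>\<in>?S - {\<sigma>}. u \<sigma>) \<in> ints" using prodB[of "?S - {\<sigma>}"] fS by auto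
    ultimately show ?thesis using submodule_LD(4)[OF image_P(1)] u(1)[OF s] s by auto
  qed
  define \<alpha> where "\<alpha> = \<gamma> * e"
  have \<alpha>: "\<alpha> \<in> ints" unfolding \<alpha>_def by (intro ints_closed \<gamma> e)
  have \<alpha>\<gamma>: "\<alpha> - \<gamma> \<in> P"
    using P_closed(1)[OF \<gamma>(1) e(2)] by (simp add: \<alpha>_def right_diff_distrib)
  have \<alpha>S: "\<alpha> \<in> \<sigma> ` P" if "\<sigma> \<in> ?S" for \<sigma>
    unfolding \<alpha>_def using submodule_LD(3)[OF image_P(1) \<gamma>(1) eS[OF that]] that by simp
  define g where "g = (\<Prod>\<sigma>\<in>carrier G. [:- \<sigma> \<alpha>, 1:])"
  have g_coeff: "coeff g i \<in> K.ints" for i unfolding g_def by (rule char_poly_coeff[OF \<alpha>])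
  have pg: "poly g x = (\<Prod>\<sigma>\<in>carrier G. x - \<sigma> \<alpha>)" for x
    by (simp add: g_def poly_prod)
  have "poly g \<alpha> = 0"
    unfolding pg using finite_Gal Gal_one_apply[OF ints_L[OF \<alpha>]] by (auto intro!: bexI[of _ "\<one>\<^bsub>G\<^esub>"])
  \<comment> \<open>The coefficients of \<open>g\<close> are integers of \<open>K\<close>, hence
    fixed by the \<open>q\<close>-th power modulo \<open>P\<close>; so \<open>\<alpha> ^ q\<close>
    is a root of \<open>g\<close> modulo \<open>P\<close> because \<open>\<alpha>\<close> is a
    root.\<close>
  moreover have "poly g \<alpha> \<in> ints \<and> (poly g \<alpha>) ^ q - poly g (\<alpha> ^ q) \<in> P"
    by (rule poly_hom_mod_P[where \<phi> = "\<lambda>x. x ^ q"])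
      (use q frob_add frob_K g_coeff Kints_ints \<alpha> in
        \<open>auto simp: P_closed power_mult_distrib zero_power intro: ints_power\<close>)
  ultimately have "poly g (\<alpha> ^ q) \<in> P"
    using q P_closed(4)[of "- poly g (\<alpha> ^ q)"] by (simp add: zero_power)
  then obtain \<sigma> where s: "\<sigma> \<in> carrier G" "\<alpha> ^ q - \<sigma> \<alpha> \<in> P"
    using P_prod[OF finite_Gal, of "\<lambda>\<sigma>. \<alpha> ^ q - \<sigma> \<alpha>"] \<alpha>
    by (auto simp: pg intro: ints_diff ints_power Gal_ints)
  have "\<sigma> \<in> D"
  proof (rule ccontr)
    \<comment> \<open>Then \<open>\<alpha>\<close> lies in the conjugate of \<open>P\<close> under
      the inverse of \<open>\<sigma>\<close>, so \<open>\<sigma> \<alpha>\<close> and with it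
      \<open>\<alpha> ^ q\<close> lie in \<open>P\<close>, although \<open>\<alpha>\<close> is
      congruent to \<open>\<gamma>\<close>.\<close>
    assume "\<sigma> \<notin> D"
    let ?i = "inv\<^bsub>G\<^esub> \<sigma>"
    have "?i ` P \<noteq> P"
      using \<open>\<sigma> \<notin> D\<close> s(1) Gal_image_inv(2)[OF s(1) P_L] by (auto simp: D_def)
    then have "\<alpha> \<in> ?i ` P" using \<alpha>S s(1) by simp
    then have "\<sigma> \<alpha> \<in> P" using Gal_inv_apply(2)[OF s(1)] P_L by auto
    from P_closed(5)[OF s(2) this] have "\<alpha> ^ q \<in> P" by simp
    then have "\<alpha> \<in> P" by (rule P_power[OF \<alpha>])
    then show False using P_closed(6)[OF _ \<alpha>\<gamma>, of \<alpha>] \<gamma>(2) by simp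
  qed
  moreover have "\<sigma> \<gamma> - \<gamma> ^ q \<in> P"
  proof -
    have 1: "\<sigma> \<gamma> - \<sigma> \<alpha> \<in> P" using D_cong[OF \<open>\<sigma> \<in> D\<close> \<gamma>(1) \<alpha> P_cong_sym[OF \<alpha>\<gamma>]] .
    have 2: "\<sigma> \<alpha> - \<alpha> ^ q \<in> P" by (rule P_cong_sym[OF s(2)])
    have 3: "\<alpha> ^ q - \<gamma> ^ q \<in> P" by (rule P_cong_power[OF \<alpha> \<gamma>(1) \<alpha>\<gamma>])
    show ?thesis by (rule P_cong_trans[OF 1 P_cong_trans[OF 2 3]])
  qed
  ultimately show ?thesis using that D_power_extend q by simp
qed

text \<open>The polynomial \<open>h\<close> lifts the minimal polynomial of \<open>\<gamma>\<close>
  modulo \<open>P\<close> over the residue field of \<open>K\<close>. The \<open>q\<close>-th power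
  permutes its roots cyclically modulo \<open>P\<close>, so its coefficients are congruent to
  elements of \<open>K.ints\<close>, which \<open>\<sigma>\<close> fixes; hence
  \<open>\<sigma> \<gamma>\<close> is again a root modulo \<open>P\<close>.\<close>

lemma D_power_of_frobenius:
  assumes s: "\<sigma> \<in> D"
  obtains i where "i < f" "\<And>x. x \<in> ints \<Longrightarrow> \<sigma> x - x ^ (q ^ i) \<in> P"
proof -
  have sG: "\<sigma> \<in> carrier G" by (rule D_Gal[OF s])
  define h where "h = (\<Prod>i<f. [:- (\<gamma> ^ (q ^ i)), 1:])"
  \<comment> \<open>The roots of \<open>h'\<close> are congruent to the \<open>q\<close>-th powers
    of the roots of \<open>h\<close>: \<open>\<gamma> ^ (q ^ f)\<close> is replaced by
    \<open>\<gamma>\<close>. So \<open>h'\<close> is \<open>h\<close> with its factors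
    permuted.\<close>
  define h' where "h' = (\<Prod>i<f. [:- (\<gamma> ^ (q ^ (Suc i mod f))), 1:])"
  have root: "(\<gamma> ^ (q ^ i)) ^ q - \<gamma> ^ (q ^ (Suc i mod f)) \<in> P" if "i < f" for i
  proof (cases "Suc i < f")
    case True
    then show ?thesis by (simp add: power_mult[symmetric] mult.commute P_closed)
  next
    case False
    then have "f = Suc i" using that by simp
    then show ?thesis using frob_f \<gamma>(1) by (simp add: power_mult[symmetric] mult.commute)
  qed
  have "h' = h"
    unfolding h_def h'_def
  proof (rule prod.reindex_bij_betw[where g = "\<lambda>i. [:- (\<gamma> ^ (q ^ i)), 1:]"])
    have "inj_on (\<lambda>i. Suc i mod f) {..<f}"
      using f by (auto simp: inj_on_def mod_Suc split: if_splits)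
    moreover have "(\<lambda>i. Suc i mod f) ` {..<f} \<subseteq> {..<f}" using f by auto
    ultimately show "bij_betw (\<lambda>i. Suc i mod f) {..<f} {..<f}"
      by (simp add: bij_betw_def endo_inj_surj)
  qed
  moreover have sub: "(x - y) ^ q - (x ^ q - y ^ q) \<in> P" if "x \<in> ints" "y \<in> ints" for x y
  proof -
    have "x ^ q - ((x - y) ^ q + y ^ q) \<in> P"
      using frob_add[rule_format, of "x - y" y] that ints_diff[OF that] by simp
    from P_closed(4)[OF this] show ?thesis by (simp add: algebra_simps)
  qed
  have "coeff h i \<in> ints \<and> coeff h' i \<in> ints \<and> (coeff h i) ^ q - coeff h' i \<in> P" for i
    unfolding h_def h'_def
    by (rule coeff_prod_linear_factors[where B = ints and \<phi> = "\<lambda>x. x ^ q"])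
      (use q sub root \<gamma>(1) in \<open>auto simp: P_closed power_mult_distrib zero_power
        intro: ints_closed ints_power ints_diff P_closed\<close>)
  ultimately have hc: "coeff h i \<in> ints" "(coeff h i) ^ q - coeff h i \<in> P" for i by auto
  have "\<sigma> (coeff h i) - coeff h i \<in> P" for i
  proof -
    obtain a where a: "a \<in> K.ints" "coeff h i - a \<in> P" using frob_fixed hc[of i] by blast
    have "\<sigma> (coeff h i) - \<sigma> a \<in> P" by (rule D_cong[OF s hc(1) Kints_ints[OF a(1)] a(2)])
    moreover have "\<sigma> a = a" using a(1) sG by (auto simp: Kints_iff intro: Gal_L)
    ultimately show ?thesis using P_cong_trans[OF _ P_cong_sym[OF a(2)]] by simp
  qed
  then have "poly h \<gamma> \<in> ints \<and> \<sigma> (poly h \<gamma>) - poly h (\<sigma> \<gamma>) \<in> P"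
    by (intro poly_hom_mod_P)
      (use sG hc \<gamma>(1) in \<open>auto simp: P_closed Gal_L ints_L intro: Gal_ints\<close>)
  moreover have ph: "poly h x = (\<Prod>i<f. x - \<gamma> ^ (q ^ i))" for x
    by (simp add: h_def poly_prod)
  have "poly h \<gamma> = 0" unfolding ph using f by (auto intro!: bexI[of _ 0])
  ultimately have "poly h (\<sigma> \<gamma>) \<in> P"
    using P_closed(4)[of "- poly h (\<sigma> \<gamma>)"] sG by simp
  then obtain i where i: "i < f" "\<sigma> \<gamma> - \<gamma> ^ (q ^ i) \<in> P"
    using P_prod[of "{..<f}" "\<lambda>i. \<sigma> \<gamma> - \<gamma> ^ (q ^ i)"] \<gamma>(1) sG
    by (auto simp: ph intro: ints_diff ints_power Gal_ints)
  have "q ^ i > 0" using q by simp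
  then show ?thesis using that[OF i(1)] D_power_extend[OF s _ i(2)] by blast
qed

text \<open>Over the unramified prime \<open>P\<close> the element \<open>\<pi>\<close> is a uniformiser up to the unit \<open>w\<close>; an inertia
  element moves every integer by an element of \<open>P\<^sup>k\<close>, for all \<open>k\<close>: since \<open>x \<equiv> x\<^sup>N\<close> with
  \<open>N = |\<O>/P| \<in> P\<close>, the derivation induced on \<open>\<O>/P\<close> vanishes at each stage.\<close>

lemma inertia_trivial:
  assumes \<pi>: "\<pi> \<in> K.ints" "\<pi> \<in> P" and w: "w \<in> ints" "w \<notin> P"
    and wP: "\<And>z. z \<in> P \<Longrightarrow> \<exists>v\<in>ints. w * z = \<pi> * v"
    and s: "\<sigma> \<in> D" and inertia: "\<And>x. x \<in> ints \<Longrightarrow> \<sigma> x - x \<in> P"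
  shows "\<sigma> = \<one>\<^bsub>G\<^esub>"
proof -
  have sG: "\<sigma> \<in> carrier G" by (rule D_Gal[OF s])
  note sB = Gal_ints[OF sG]
  have step: "\<sigma> x - x \<in> pow_P (Suc k)" if x: "x \<in> ints" for x k
    using x
  proof (induction k arbitrary: x)
    case 0
    then show ?case using inertia ideal_mult_ints(1)[OF P_sub] by simp
  next
    case (Suc k)
    let ?k = "Suc k"
    note Sk = submodule_LD[OF pow_P(1)[of "Suc ?k"]]
    have inP: "a * b \<in> pow_P (Suc ?k)" if "a \<in> pow_P ?k" "b \<in> P" for a b
      unfolding pow_P_Suc[of ?k] by (rule ideal_mult_prod[OF that])
    \<comment> \<open>On \<open>P\<close> the gain comes from \<open>w * z = \<pi> * v\<close>:
      applying \<open>\<sigma>\<close>, which fixes \<open>\<pi>\<close>, expresses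
      \<open>(\<sigma> z - z) * \<sigma> w\<close> through differences already in
      \<open>pow_P ?k\<close>, multiplied by \<open>\<pi>\<close> and \<open>z\<close> from
      \<open>P\<close>. The factor \<open>\<sigma> w\<close>, which is outside \<open>P\<close>,
      cancels.\<close>
    have on_P: "\<sigma> z - z \<in> pow_P (Suc ?k)" if z: "z \<in> P" for z
    proof -
      obtain v where v: "v \<in> ints" "w * z = \<pi> * v" using wP[OF z] by blast
      have zB: "z \<in> ints" and \<pi>B: "\<pi> \<in> ints" using z P_ints Kints_ints \<pi>(1) by auto
      have "\<sigma> w * \<sigma> z = \<pi> * \<sigma> v"
        using arg_cong[OF v(2), of \<sigma>] sG \<pi>(1) v(1) w(1) zB \<pi>B
        by (simp add: Gal_L(4) ints_L Gal_L(2) Kints_iff)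
      then have "(\<sigma> z - z) * \<sigma> w = (\<sigma> v - v) * \<pi> - (\<sigma> w - w) * z"
        using v(2) by (simp add: algebra_simps)
      also have "\<dots> \<in> pow_P (Suc ?k)"
        by (intro Sk(8) inP Suc.IH v(1) w(1) z \<pi>(2))
      finally have *: "(\<sigma> z - z) * \<sigma> w \<in> pow_P (Suc ?k)" .
      have "\<sigma> w \<notin> P" using D_iff[OF s ints_L[OF w(1)]] w(2) by simp
      from pow_P_cancel[OF sB[OF w(1)] this ints_diff[OF sB[OF zB] zB] *] show ?thesis .
    qed
    \<comment> \<open>\<open>x\<close> differs from \<open>x ^ N\<close> by an element of
      \<open>P\<close>, and \<open>N\<close>-th powers gain a factor in \<open>P\<close>: the sum in
      the factorisation of \<open>(\<sigma> x) ^ N - x ^ N\<close> is congruent to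
      \<open>N * x ^ (N - 1)\<close>, and \<open>N\<close> lies in \<open>P\<close>.\<close>
    define N where "N = q ^ f"
    have x: "x \<in> ints" by fact
    note xB = x sB[OF x]
    define z where "z = x - x ^ N"
    have z: "z \<in> P" using P_cong_sym frob_f x by (simp add: z_def N_def)
    have "(\<sigma> x) ^ N - x ^ N = (\<sigma> x - x) * (\<Sum>i<N. x ^ (N - Suc i) * (\<sigma> x) ^ i)"
      by (rule power_diff_sumr2)
    moreover have "(\<Sum>i<N. x ^ (N - Suc i) * (\<sigma> x) ^ i) \<in> P"
    proof -
      have "x ^ (N - Suc i) * (\<sigma> x) ^ i - x ^ (N - 1) \<in> P" if "i < N" for i
      proof -
        have "x ^ (N - 1) = x ^ (N - Suc i) * x ^ i" using that by (simp flip: power_add)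
        then have "x ^ (N - Suc i) * (\<sigma> x) ^ i - x ^ (N - 1) = x ^ (N - Suc i) * ((\<sigma> x) ^ i - x ^ i)"
          by (simp only: right_diff_distrib)
        also have "\<dots> \<in> P"
          by (intro P_closed(1) ints_power x P_cong_power xB inertia)
        finally show ?thesis .
      qed
      then have "(\<Sum>i<N. x ^ (N - Suc i) * (\<sigma> x) ^ i - x ^ (N - 1)) \<in> P"
        by (intro add_subgroup_sum[OF submodule_LD(2)[OF P_sub]]) simp
      then have "(\<Sum>i<N. x ^ (N - Suc i) * (\<sigma> x) ^ i) - of_nat N * x ^ (N - 1) \<in> P"
        by (simp add: sum_subtractf)
      moreover have "of_nat N * x ^ (N - 1) \<in> P"
        unfolding N_def by (rule P_closed(2)[OF ints_power[OF x] norm_P])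
      ultimately show ?thesis using P_closed(5) by fastforce
    qed
    ultimately have "(\<sigma> x) ^ N - x ^ N \<in> pow_P (Suc ?k)"
      using inP[OF Suc.IH[OF x]] by (simp only:)
    moreover have "\<sigma> x - x = (\<sigma> z - z) + ((\<sigma> x) ^ N - x ^ N)"
      using sG x by (simp add: z_def Gal_diff Gal_power ints_L ints_power)
    ultimately show ?case using Sk(7)[OF on_P[OF z]] by (simp only:)
  qed
  \<comment> \<open>A nonzero difference would lie in only finitely many powers of
    \<open>P\<close>.\<close>
  have "\<sigma> x = x" if x: "x \<in> ints" for x
  proof (rule ccontr)
    assume "\<sigma> x \<noteq> x"
    then obtain b where b: "\<And>k. \<sigma> x - x \<in> pow_P k \<Longrightarrow> k \<le> b"
      using pow_P_bounded[of "\<sigma> x - x"] x sB by (auto intro: ints_diff)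
    from b[OF step[OF x, of b]] show False by simp
  qed
  then show ?thesis
    by (intro Gal_eqI sG) (simp_all add: Gal_one_apply ints_L)
qed

end

context residue_data
begin

text \<open>By \<open>inert\<close>, elements of \<open>D\<close> that agree modulo \<open>P\<close>
  are equal. Each acts as some power \<open>q ^ i\<close> with \<open>i < f\<close>, so all are
  powers of the Frobenius element, and by \<open>frob_less\<close> no positive power of it below the
  \<open>f\<close>-th is trivial. Ramification is thus isolated in \<open>inert\<close>.\<close>

lemma D_cyclic:
  assumes inert: "\<And>\<sigma>. \<sigma> \<in> D \<Longrightarrow> (\<And>x. x \<in> ints \<Longrightarrow> \<sigma> x - x \<in> P) \<Longrightarrow> \<sigma> = \<one>\<^bsub>G\<^esub>"
  shows "D \<in> cyclic_subgroups G f"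
proof -
  obtain \<phi> where \<phi>: "\<phi> \<in> D" "\<And>x. x \<in> ints \<Longrightarrow> \<phi> x - x ^ q \<in> P"
    using frobenius_exists by blast
  have \<phi>G: "\<phi> \<in> carrier G" by (rule D_Gal[OF \<phi>(1)])
  let ?p = "\<lambda>i::nat. \<phi> [^]\<^bsub>G\<^esub> i"
  have pG: "?p i \<in> carrier G" for i using \<phi>G by simp
  have pD: "?p i \<in> D" for i
    by (induction i) (use \<phi>(1) subgroup.one_closed[OF D_subgroup] subgroup.m_closed[OF D_subgroup] in auto)
  have p: "?p i x - x ^ (q ^ i) \<in> P" if "x \<in> ints" for i x
    using that
  proof (induction i arbitrary: x)
    case 0
    then show ?case by (simp add: Gal_one_apply ints_L P_closed)
  next
    case (Suc i)
    have x: "x \<in> ints" "\<phi> x \<in> ints" using Suc.prems Gal_ints[OF \<phi>G] by auto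
    have 1: "?p (Suc i) x = ?p i (\<phi> x)"
      by (simp add: Gal_mult_apply pG \<phi>G x ints_L)
    have 2: "?p i (\<phi> x) - (\<phi> x) ^ (q ^ i) \<in> P" by (rule Suc.IH[OF x(2)])
    have "(\<phi> x) ^ (q ^ i) - (x ^ q) ^ (q ^ i) \<in> P"
      by (rule P_cong_power[OF x(2) ints_power[OF x(1)] \<phi>(2)[OF x(1)]])
    then have "(\<phi> x) ^ (q ^ i) - x ^ (q ^ Suc i) \<in> P" by (simp add: power_mult)
    from P_cong_trans[OF 2 this] show ?case unfolding 1 .
  qed
  have p_f: "?p f = \<one>\<^bsub>G\<^esub>"
  proof (rule inert[OF pD])
    fix x assume x: "x \<in> ints"
    from P_cong_trans[OF p[OF x] frob_f[rule_format, OF x]] show "?p f x - x \<in> P" .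
  qed
  have p_less: "?p j \<noteq> \<one>\<^bsub>G\<^esub>" if j: "0 < j" "j < f" for j
  proof
    assume 1: "?p j = \<one>\<^bsub>G\<^esub>"
    obtain x where x: "x \<in> ints" "x ^ (q ^ j) - x \<notin> P" using frob_less j by blast
    then show False using P_cong_sym[OF p[OF x(1), of j]] by (simp add: 1 Gal_one_apply ints_L)
  qed
  have D_eq: "D = ?p ` {..<f}"
  proof
    show "?p ` {..<f} \<subseteq> D" using pD by auto
    show "D \<subseteq> ?p ` {..<f}"
    proof
      fix \<sigma> assume s: "\<sigma> \<in> D"
      have sG: "\<sigma> \<in> carrier G" by (rule D_Gal[OF s])
      obtain i where i: "i < f" "\<And>x. x \<in> ints \<Longrightarrow> \<sigma> x - x ^ (q ^ i) \<in> P"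
        using D_power_of_frobenius[OF s] by blast
      \<comment> \<open>\<open>?\<tau>\<close> acts trivially modulo \<open>P\<close>, as
        \<open>\<sigma>\<close> and \<open>?p i\<close> both act as the power
        \<open>q ^ i\<close>.\<close>
      let ?\<tau> = "inv\<^bsub>G\<^esub> (?p i) \<otimes>\<^bsub>G\<^esub> \<sigma>"
      have t: "?\<tau> \<in> D" and ip: "inv\<^bsub>G\<^esub> (?p i) \<in> D"
        using subgroup.m_closed[OF D_subgroup subgroup.m_inv_closed[OF D_subgroup pD] s]
          subgroup.m_inv_closed[OF D_subgroup pD] by auto
      have "?\<tau> = \<one>\<^bsub>G\<^esub>"
      proof (rule inert[OF t])
        fix x assume x: "x \<in> ints"
        have "\<sigma> x - ?p i x \<in> P" by (rule P_cong_trans[OF i(2)[OF x] P_cong_sym[OF p[OF x]]])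
        from D_cong[OF ip Gal_ints[OF sG x] Gal_ints[OF pG x] this]
        show "?\<tau> x - x \<in> P"
          using x by (simp add: Gal_mult_apply Gal_inv_apply pG sG ints_L)
      qed
      then have "\<sigma> = ?p i" using Gal.inv_equality[of "inv\<^bsub>G\<^esub> (?p i)" \<sigma>] sG pG
        by (metis Gal.inv_closed Gal.inv_inv)
      then show "\<sigma> \<in> ?p ` {..<f}" using i(1) by auto
    qed
  qed
  have "inj_on ?p {..<f}"
  proof (rule linorder_inj_onI')
    fix i j assume ij: "i \<in> {..<f}" "j \<in> {..<f}" "i < j"
    have "?p (j - i) \<noteq> \<one>\<^bsub>G\<^esub>" using p_less[of "j - i"] ij by simp
    moreover have "?p j = ?p i \<otimes>\<^bsub>G\<^esub> ?p (j - i)" using ij by (simp add: Gal.nat_pow_mult \<phi>G)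
    ultimately show "?p i \<noteq> ?p j" using Gal.l_cancel_one'[OF pG pG, of i "j - i"] by simp
  qed
  then have "card D = f" by (simp add: D_eq card_image)
  interpret D: group "G\<lparr>carrier := D\<rparr>" by (rule Gal.subgroup_imp_group[OF D_subgroup])
  have "cyclic_group (G\<lparr>carrier := D\<rparr>)"
    unfolding D.cyclic_group
  proof (intro bexI)
    show "\<phi> \<in> carrier (G\<lparr>carrier := D\<rparr>)" using \<phi>(1) by simp
    have "?p i = \<phi> [^]\<^bsub>G\<lparr>carrier := D\<rparr>\<^esub> int i" for i
      by (simp add: int_pow_int Gal.nat_pow_consistent)
    then have "D \<subseteq> range (\<lambda>n::int. \<phi> [^]\<^bsub>G\<lparr>carrier := D\<rparr>\<^esub> n)" unfolding D_eq by blast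
    moreover have "\<phi> [^]\<^bsub>G\<lparr>carrier := D\<rparr>\<^esub> n \<in> D" for n :: int
      using D.int_pow_closed[of \<phi> n] \<phi>(1) by simp
    ultimately show "carrier (G\<lparr>carrier := D\<rparr>) = range (\<lambda>n::int. \<phi> [^]\<^bsub>G\<lparr>carrier := D\<rparr>\<^esub> n)" by auto
  qed
  with \<open>card D = f\<close> D_subgroup show ?thesis by (simp add: cyclic_subgroups_def)
qed

end

section \<open>Factorisation of unramified primes\<close>

lemma (in group) left_coset_reps_unique:
  assumes T: "left_coset_reps G H T" and H: "subgroup H G"
    and st: "s \<in> T" "t \<in> T" "inv s \<otimes> t \<in> H"
  shows "s = t"
proof -
  have G: "s \<in> carrier G" "t \<in> carrier G" using T st by (auto simp: left_coset_reps_def)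
  have "s <# H \<in> lcosets H" using G by (auto simp: LCOSETS_def)
  then have "\<exists>!u. u \<in> T \<inter> (s <# H)" using T by (simp add: left_coset_reps_def)
  moreover have "s \<otimes> \<one> \<in> s <# H"
    unfolding l_coset_def using subgroup.one_closed[OF H] by blast
  then have "s \<in> s <# H" using G by simp
  moreover have "s \<otimes> (inv s \<otimes> t) \<in> s <# H"
    unfolding l_coset_def using st(3) by blast
  then have "t \<in> s <# H" using G by (simp add: m_assoc[symmetric])
  ultimately show ?thesis using st(1,2) by blast
qed

text \<open>To contain is to divide: multiply \<open>M\<close> by the inverse of
  \<open>I\<close>.\<close>

lemma (in nfield) ideal_divides:
  assumes I: "fideal I" and M: "fideal M" "M \<subseteq> I"
  obtains J where "fideal J" "J \<subseteq> ints" "M = I \<star> J"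
proof -
  let ?J = "inverse_ideal I \<star> M"
  have "fideal ?J" by (intro fideal_mult fideal_inverse_ideal I M)
  moreover have "?J \<subseteq> inverse_ideal I \<star> I" by (rule ideal_mult_mono) (use M in auto)
  then have "?J \<subseteq> ints" using ideal_mult_inverse_ideal[OF I] ideal_mult_commute by metis
  moreover have "M = I \<star> ?J"
    by (simp add: ideal_mult_assoc[symmetric] ideal_mult_inverse_ideal[OF I] ideal_mult_ints fidealD M)
  ultimately show ?thesis by (rule that)
qed

context galois_prime
begin

text \<open>Write \<open>\<pi> ints = P \<star> J\<close>. As the ramification index is 1,
  \<open>P\<close> does not divide \<open>J\<close>, and for any \<open>w\<close> in
  \<open>J\<close> outside \<open>P\<close> the ideal \<open>w P\<close> is contained in
  \<open>P \<star> J = \<pi> ints\<close>.\<close>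

lemma unramified_uniformizer:
  assumes cn: "class_number K = 1" and unram: "unramified K L P"
  obtains \<pi> w where "\<pi> \<in> K.ints" "\<pi> \<noteq> 0" "P \<inter> K = (\<lambda>a. \<pi> * a) ` K.ints"
    "w \<in> ints" "w \<notin> P" "\<And>z. z \<in> P \<Longrightarrow> \<exists>v\<in>ints. w * z = \<pi> * v"
proof -
  have PK: "P \<inter> K \<subseteq> K.ints" using P_ints by (auto simp: Kints_iff)
  have "K.submodule_L (P \<inter> K)"
    by (rule K.submodule_LI) (auto simp: P_closed K.L_closed K.ints_L Kints_ints)
  moreover obtain l :: nat where l: "Factorial_Ring.prime l" "of_nat l \<in> P" using residue_prime .
  have "of_nat l \<in> P \<inter> K" "of_nat l \<noteq> (0 :: 'a)"
    using l K.L_of_int[of "int l"] by (auto simp: prime_gt_0_nat)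
  then have "P \<inter> K \<noteq> {0}" by blast
  ultimately obtain \<pi> where \<pi>: "\<pi> \<in> K.ints" "\<pi> \<noteq> 0" "P \<inter> K = (\<lambda>a. \<pi> * a) ` K.ints"
    using K.class_number_1_generator[OF cn _ PK] by blast
  have "\<pi> * 1 \<in> P \<inter> K" unfolding \<pi>(3) using K.ints_closed(2) by blast
  then have \<pi>P: "\<pi> \<in> P" and \<pi>L: "\<pi> \<in> L" using P_L by auto
  define M where "M = (\<lambda>a. \<pi> * a) ` ints"
  have M: "fideal M" unfolding M_def by (rule fideal_principal[OF \<pi>L \<pi>(2)])
  have MP: "M \<subseteq> P" unfolding M_def using P_closed(2)[OF _ \<pi>P] by auto
  have "\<pi> * 1 \<in> M" unfolding M_def using ints_closed(2) by blast
  then have \<pi>M: "\<pi> \<in> M" by simp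
  interpret O: domain "ring_of_integers L" by (rule domain_ring_of_integers)
  have Idl: "Idl\<^bsub>ring_of_integers L\<^esub> (P \<inter> K) = M"
  proof
    show "Idl\<^bsub>ring_of_integers L\<^esub> (P \<inter> K) \<subseteq> M"
    proof (rule O.genideal_minimal)
      show "ideal M (ring_of_integers L)" using M MP P_ints by (auto simp: ideal_iff fideal_def)
      show "P \<inter> K \<subseteq> M" unfolding \<pi>(3) M_def using Kints_ints by auto
    qed
    have I: "ideal (Idl\<^bsub>ring_of_integers L\<^esub> (P \<inter> K)) (ring_of_integers L)"
      using PK Kints_ints by (intro O.genideal_ideal) auto
    then have "\<pi> \<in> Idl\<^bsub>ring_of_integers L\<^esub> (P \<inter> K)"
      using O.genideal_self[of "P \<inter> K"] PK Kints_ints \<open>\<pi> * 1 \<in> P \<inter> K\<close> by auto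
    then show "M \<subseteq> Idl\<^bsub>ring_of_integers L\<^esub> (P \<inter> K)"
      unfolding M_def using I by (auto simp: ideal_iff submodule_LD(4))
  qed
  define E where "E e \<longleftrightarrow> (\<exists>J. ideal J (ring_of_integers L) \<and> M = pow_P e \<star> J)" for e
  have E1: "Greatest E = 1"
    using unram unfolding unramified_def ramification_index_def Idl ideal_prod_ring_of_integers E_def .
  \<comment> \<open>\<open>GREATEST\<close> is informative only for a bounded set of exponents; the
    bound comes from \<open>\<pi>\<close> being nonzero.\<close>
  obtain b where b: "\<And>k. \<pi> \<in> pow_P k \<Longrightarrow> k \<le> b"
    using pow_P_bounded[of \<pi>] \<pi>P P_ints \<pi>(2) by blast
  have bound: "e \<le> b" if "E e" for e
  proof -
    obtain J where J: "submodule_L J" "J \<subseteq> ints" "M = pow_P e \<star> J"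
      using \<open>E e\<close> by (auto simp: E_def ideal_iff)
    have "M \<subseteq> pow_P e \<star> ints" unfolding J(3) by (rule ideal_mult_mono) (use J(2) in auto)
    then show ?thesis using b[of e] \<pi>M ideal_mult_ints(2)[OF pow_P(1)] by blast
  qed
  have notE2: "\<not> E 2"
  proof
    assume "E 2"
    then have "2 \<le> Greatest E" using bound by (rule Greatest_le_nat)
    with E1 show False by simp
  qed
  obtain J where J: "fideal J" "J \<subseteq> ints" "M = P \<star> J" using ideal_divides[OF P_fideal M MP] .
  have "\<not> J \<subseteq> P"
  proof
    assume "J \<subseteq> P"
    then obtain J' where J': "fideal J'" "J' \<subseteq> ints" "J = P \<star> J'"
      using ideal_divides[OF P_fideal J(1)] by blast
    have "pow_P 2 = P \<star> P"
      by (simp add: numeral_2_eq_2 ideal_mult_ints(1)[OF P_sub])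
    then have "M = pow_P 2 \<star> J'" by (simp add: J(3) J'(3) ideal_mult_assoc)
    then have "E 2" unfolding E_def using J' by (auto simp: ideal_iff fideal_def)
    with notE2 show False ..
  qed
  then obtain w where w: "w \<in> J" "w \<notin> P" by blast
  have "\<exists>v\<in>ints. w * z = \<pi> * v" if "z \<in> P" for z
  proof -
    have "z * w \<in> M" unfolding J(3) by (rule ideal_mult_prod[OF that w(1)])
    then show ?thesis by (auto simp: M_def mult.commute)
  qed
  then show ?thesis using that[OF \<pi> _ w(2)] w(1) J(2) by blast
qed

lemma image_P_prime:
  assumes s: "\<sigma> \<in> carrier G" and x: "x \<in> ints" "y \<in> ints" "x * y \<in> \<sigma> ` P"
  shows "x \<in> \<sigma> ` P \<or> y \<in> \<sigma> ` P"
proof -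
  let ?i = "inv\<^bsub>G\<^esub> \<sigma>"
  have i: "?i \<in> carrier G" using s by simp
  note iff = Gal_image_mem_iff[OF s P_L ints_L]
  have "?i x * ?i y \<in> P"
    using iff[OF ints_closed(5)[OF x(1,2)]] x by (simp add: Gal_L(4)[OF i] ints_L)
  then show ?thesis
    using P_prime[OF Gal_ints[OF i x(1)] Gal_ints[OF i x(2)]] iff x by auto
qed

lemma image_P_prime_ideal:
  assumes s: "\<sigma> \<in> carrier G" and sub: "I \<subseteq> ints" "J \<subseteq> ints" "I \<star> J \<subseteq> \<sigma> ` P"
  shows "I \<subseteq> \<sigma> ` P \<or> J \<subseteq> \<sigma> ` P"
proof (rule ccontr)
  assume "\<not> ?thesis"
  then obtain x y where xy: "x \<in> I" "x \<notin> \<sigma> ` P" "y \<in> J" "y \<notin> \<sigma> ` P" by blast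
  then have "x * y \<in> \<sigma> ` P" using sub(3) ideal_mult_prod[of x I y J] by blast
  then show False using image_P_prime[OF s, of x y] xy sub(1,2) by blast
qed

lemma one_notin_image_P:
  assumes s: "\<sigma> \<in> carrier G"
  shows "1 \<notin> \<sigma> ` P"
  using Gal_image_mem_iff[OF s P_L, of 1] one_notin_P s by (simp add: L_closed)

lemma image_P_subset_image_P:
  assumes s: "\<sigma> \<in> carrier G" and t: "\<tau> \<in> carrier G" and sub: "\<tau> ` P \<subseteq> \<sigma> ` P"
  shows "inv\<^bsub>G\<^esub> \<sigma> \<otimes>\<^bsub>G\<^esub> \<tau> \<in> D"
proof -
  let ?i = "inv\<^bsub>G\<^esub> \<sigma>"
  have it: "?i \<otimes>\<^bsub>G\<^esub> \<tau> \<in> carrier G" using s t by simp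
  have "?i ` \<tau> ` P \<subseteq> ?i ` \<sigma> ` P" using sub by (rule image_mono)
  then have "(?i \<otimes>\<^bsub>G\<^esub> \<tau>) ` P \<subseteq> P"
    using s t by (simp add: Gal_image_mult P_L Gal_image_inv)
  then show ?thesis using image_P_subset[OF it] it by (simp add: D_def)
qed

lemma comaximal_image_P:
  assumes s: "\<sigma> \<in> carrier G" and J: "submodule_L J" "J \<subseteq> ints" "\<not> J \<subseteq> \<sigma> ` P"
  shows "\<exists>v. v \<in> J \<and> v - 1 \<in> \<sigma> ` P"
proof -
  let ?i = "inv\<^bsub>G\<^esub> \<sigma>"
  have i: "?i \<in> carrier G" using s by simp
  have JL: "J \<subseteq> L" by (rule submodule_LD(1)[OF J(1)])
  have "\<not> ?i ` J \<subseteq> P"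
  proof
    assume "?i ` J \<subseteq> P"
    then have "\<sigma> ` ?i ` J \<subseteq> \<sigma> ` P" by (rule image_mono)
    then show False using J(3) Gal_image_inv(2)[OF s JL] by simp
  qed
  moreover have "?i ` J \<subseteq> ints" using J(2) Gal_ints[OF i] by blast
  ultimately obtain u where u: "u \<in> ?i ` J" "u - 1 \<in> P"
    using comaximal_P[OF submodule_image[OF i J(1)]] by metis
  then obtain v where v: "v \<in> J" "u = ?i v" by blast
  have "\<sigma> (u - 1) = v - 1"
    using v JL s i by (simp add: Gal_diff Gal_L subsetD L_closed Gal_inv_apply)
  then have "v - 1 \<in> \<sigma> ` P" using u(2) by (metis image_eqI)
  then show ?thesis using v(1) by blast
qed

text \<open>This is transitivity of \<open>G\<close> on the primes above
  \<open>P \<inter> K\<close>, in the form needed for the cofactor of a product of conjugates. If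
  \<open>J\<close> lay in no conjugate, some \<open>x\<close> in \<open>J\<close> would be congruent
  to 1 modulo all of them; its norm lies in \<open>J\<close> and in \<open>K\<close>, and is
  contradictory both inside and outside \<open>P\<close>.\<close>

lemma ideal_in_conjugate:
  assumes J: "submodule_L J" "J \<subseteq> ints" "1 \<notin> J" and PK: "P \<inter> K \<subseteq> J"
  obtains \<sigma> where "\<sigma> \<in> carrier G" "J \<subseteq> \<sigma> ` P"
proof (rule ccontr)
  assume "\<not> thesis"
  then have "\<forall>\<sigma>\<in>carrier G. \<exists>v. v \<in> J \<and> v - 1 \<in> \<sigma> ` P"
    using comaximal_image_P[OF _ J(1,2)] that by blast
  from bchoice[OF this] obtain v
    where v: "\<forall>\<sigma>\<in>carrier G. v \<sigma> \<in> J \<and> v \<sigma> - 1 \<in> \<sigma> ` P" ..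
  note Js = submodule_LD[OF J(1)]
  have vB: "1 - v \<sigma> \<in> ints" if "\<sigma> \<in> carrier G" for \<sigma>
    using v that J(2) by (auto intro: ints_diff ints_closed)
  define e where "e I = (\<Prod>\<sigma>\<in>I. 1 - v \<sigma>)" for I
  have eB: "e I \<in> ints \<and> 1 - e I \<in> J" if "finite I" "I \<subseteq> carrier G" for I
    using that
  proof (induction I rule: finite_induct)
    case (insert i I)
    then have i: "i \<in> carrier G" and IH: "e I \<in> ints" "1 - e I \<in> J" by auto
    have 1: "e (insert i I) = (1 - v i) * e I" using insert.hyps by (simp add: e_def)
    then have 2: "1 - e (insert i I) = (1 - e I) + v i * e I" by (simp add: algebra_simps)
    have "v i * e I \<in> J" using Js(4)[OF IH(1)] v i by blast
    from Js(7)[OF IH(2) this] ints_closed(5)[OF vB[OF i] IH(1)]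
    show ?case unfolding 2 unfolding 1 by simp
  qed (simp add: e_def ints_closed Js)
  \<comment> \<open>Expanding the product of the \<open>1 - v \<sigma>\<close> shows that
    \<open>x\<close> is in \<open>J\<close>, while each single factor puts \<open>1 - x\<close> into
    the conjugate by \<open>\<sigma>\<close>.\<close>
  define x where "x = 1 - e (carrier G)"
  have xJ: "x \<in> J" using eB[OF finite_Gal] by (simp add: x_def)
  then have xB: "x \<in> ints" using J(2) by blast
  have x1: "1 - x \<in> \<sigma> ` P" if s: "\<sigma> \<in> carrier G" for \<sigma>
  proof -
    have "1 - x = (1 - v \<sigma>) * e (carrier G - {\<sigma>})"
      unfolding x_def e_def using prod.remove[OF finite_Gal s, of "\<lambda>\<sigma>. 1 - v \<sigma>"] by simp
    moreover have "1 - v \<sigma> \<in> \<sigma> ` P"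
      using submodule_LD(6)[OF image_P(1)[OF s], of "v \<sigma> - 1"] v s by simp
    moreover have "e (carrier G - {\<sigma>}) \<in> ints" using eB[of "carrier G - {\<sigma>}"] finite_Gal by auto
    ultimately show ?thesis using submodule_LD(4)[OF image_P(1)[OF s]] by simp
  qed
  define n where "n = (\<Prod>\<sigma>\<in>carrier G. \<sigma> x)"
  have nK: "n \<in> K.ints" unfolding n_def by (rule norm_Kints[OF xB])
  have prodB: "(\<Prod>\<sigma>\<in>I. \<sigma> x) \<in> ints" if "finite I" "I \<subseteq> carrier G" for I
    using that by (induction I rule: finite_induct) (auto intro: ints_closed Gal_ints[OF _ xB])
  have "n = \<one>\<^bsub>G\<^esub> x * (\<Prod>\<sigma>\<in>carrier G - {\<one>\<^bsub>G\<^esub>}. \<sigma> x)"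
    unfolding n_def by (rule prod.remove[OF finite_Gal]) simp
  then have nJ: "n \<in> J"
    using Js(4)[OF prodB xJ, of "carrier G - {\<one>\<^bsub>G\<^esub>}"] finite_Gal
    by (auto simp: Gal_one_apply ints_L[OF xB])
  have "n \<in> P"
  proof (rule ccontr)
    \<comment> \<open>A power of the norm is then congruent to 1 modulo \<open>P \<inter> K\<close>,
      hence modulo \<open>J\<close>, although the norm itself lies in \<open>J\<close>.\<close>
    assume "n \<notin> P"
    then obtain d where d: "d > 0" "n ^ d - 1 \<in> P" using P_power_cong[OF Kints_ints[OF nK]] by blast
    have "n ^ d - 1 \<in> K" by (intro K.L_diff K.L_power K.ints_L nK K.L_closed)
    then have "n ^ d - 1 \<in> J" using d(2) PK by blast
    moreover have "n ^ d = n ^ (d - 1) * n" using d(1) by (metis Suc_diff_1 power_Suc2)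
    then have "n ^ d \<in> J" using Js(3)[OF ints_power[OF Kints_ints[OF nK]] nJ] by simp
    ultimately have "n ^ d - (n ^ d - 1) \<in> J" using Js(8) by blast
    then show False using J(3) by simp
  qed
  then obtain \<sigma> where s: "\<sigma> \<in> carrier G" "\<sigma> x \<in> P"
    using P_prod[OF finite_Gal, of "\<lambda>\<sigma>. \<sigma> x"] Gal_ints[OF _ xB] by (auto simp: n_def)
  let ?i = "inv\<^bsub>G\<^esub> \<sigma>"
  have i: "?i \<in> carrier G" using s by simp
  have "x \<in> ?i ` P" using s Gal_inv_apply(1)[OF s(1) ints_L[OF xB]] by (metis image_eqI)
  then have "x + (1 - x) \<in> ?i ` P" using submodule_LD(7)[OF image_P(1)[OF i]] x1[OF i] by blast
  then show False using one_notin_image_P[OF i] by simp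
qed

lemma conjugates_closed: "I \<subseteq> carrier G \<Longrightarrow> (\<lambda>\<sigma>. \<sigma> ` P) \<in> I \<rightarrow> carrier (ideal_group L)"
  using fideal_image[OF _ P_fideal] by auto

text \<open>The conjugates by \<open>T\<close> are distinct primes dividing \<open>(\<pi>)\<close>,
  so their product divides it; call the cofactor \<open>J\<close>. If \<open>J\<close> were proper
  it would lie in a conjugate of \<open>P\<close>, whose square would then contain
  \<open>\<pi>\<close>; as \<open>\<pi>\<close> is fixed by \<open>G\<close>, so would
  \<open>P \<star> P\<close>. Then \<open>w P\<close> is contained in \<open>P \<star> P\<close>,
  and cancelling \<open>P\<close> puts \<open>w\<close> into \<open>P\<close>.\<close>

lemma prime_factorization:
  assumes \<pi>: "\<pi> \<in> K.ints" "\<pi> \<noteq> 0" "P \<inter> K = (\<lambda>a. \<pi> * a) ` K.ints"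
    and w: "w \<in> ints" "w \<notin> P" "\<And>z. z \<in> P \<Longrightarrow> \<exists>v\<in>ints. w * z = \<pi> * v"
    and T: "left_coset_reps G D T"
  shows "finprod (ideal_group L) (\<lambda>t. t ` P) T = (\<lambda>a. \<pi> * a) ` ints"
proof -
  define M where "M = (\<lambda>a. \<pi> * a) ` ints"
  have \<pi>K: "\<pi> \<in> K" and \<pi>B: "\<pi> \<in> ints" using \<pi>(1) by (auto simp: Kints_iff)
  have M: "fideal M" unfolding M_def by (rule fideal_principal[OF ints_L[OF \<pi>B] \<pi>(2)])
  have "\<pi> * 1 \<in> P \<inter> K" unfolding \<pi>(3) using K.ints_closed(2) by blast
  then have \<pi>P: "\<pi> \<in> P" by simp
  have TG: "T \<subseteq> carrier G" using T by (simp add: left_coset_reps_def)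
  have fT: "finite T" using finite_subset[OF TG finite_Gal] .
  note T_unique = Gal.left_coset_reps_unique[OF T D_subgroup]
  have T_cover: "\<exists>t\<in>T. \<sigma> ` P = t ` P" if s: "\<sigma> \<in> carrier G" for \<sigma>
  proof -
    have "\<sigma> <#\<^bsub>G\<^esub> D \<in> lcosets\<^bsub>G\<^esub> D" using s by (auto simp: LCOSETS_def)
    then obtain t where t: "t \<in> T" "t \<in> \<sigma> <#\<^bsub>G\<^esub> D" using T unfolding left_coset_reps_def by blast
    then obtain d where d: "d \<in> D" "t = \<sigma> \<otimes>\<^bsub>G\<^esub> d" by (auto simp: l_coset_def)
    then have "t ` P = \<sigma> ` P" using Gal_image_mult[OF s D_Gal P_L] by (simp add: D_def)
    then show ?thesis using t(1) by (metis (no_types))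
  qed
  have M_sub: "M \<subseteq> \<sigma> ` P" if s: "\<sigma> \<in> carrier G" for \<sigma>
  proof -
    have "\<pi> \<in> \<sigma> ` P" using \<pi>P Gal_L(2)[OF s \<pi>K] by (metis image_eqI)
    then show ?thesis unfolding M_def using submodule_LD(4)[OF image_P(1)[OF s]] by auto
  qed
  define F where "F I = finprod (ideal_group L) (\<lambda>t. t ` P) I" for I
  have F: "fideal (F I)" if "I \<subseteq> carrier G" for I
    using IG.finprod_closed[OF conjugates_closed[OF that]] by (simp add: F_def)
  have F_insert: "F (insert t I) = t ` P \<star> F I" if "finite I" "t \<notin> I" "insert t I \<subseteq> carrier G" for t I
    using IG.finprod_insert[OF that(1,2), of "\<lambda>t. t ` P"] conjugates_closed[of "insert t I"] that(3)
    by (simp add: F_def Pi_iff)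
  have F_ints: "F I \<subseteq> ints" if "finite I" "I \<subseteq> carrier G" for I
    using that
  proof (induction I rule: finite_induct)
    case (insert t I)
    have "t ` P \<star> F I \<subseteq> ints \<star> ints"
      using insert image_P(2)[of t] by (intro ideal_mult_mono) auto
    then show ?case using F_insert[OF insert.hyps insert.prems] ideal_mult_ints(1)[OF submodule_ints] by simp
  qed (simp add: F_def)
  have F_sub: "\<exists>t\<in>I. t ` P \<subseteq> \<sigma> ` P"
    if s: "\<sigma> \<in> carrier G" and I: "finite I" "I \<subseteq> carrier G" "F I \<subseteq> \<sigma> ` P" for \<sigma> I
    using I
  proof (induction I rule: finite_induct)
    case empty
    then show ?case using one_notin_image_P[OF s] ints_closed(2) by (auto simp: F_def)
  next
    case (insert t I)
    then show ?case
      using image_P_prime_ideal[OF s image_P(2) F_ints, of t I] F_insert[OF insert.hyps insert.prems(1)] by auto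
  qed
  \<comment> \<open>The conjugates are divided out one at a time: the prime for \<open>t\<close>
    does not contain the earlier product, as otherwise two representatives would share a coset of
    \<open>D\<close>; so it contains the cofactor.\<close>
  have "\<exists>J. fideal J \<and> J \<subseteq> ints \<and> M = F I \<star> J" if "finite I" "I \<subseteq> T" for I
    using that
  proof (induction I rule: finite_induct)
    case empty
    have "M \<subseteq> ints" using M_def \<pi>B by (auto intro: ints_closed)
    then show ?case
      using M ideal_mult_ints(1)[OF fidealD[OF M]] by (intro exI[of _ M]) (simp add: F_def)
  next
    case (insert t I)
    then obtain J where J: "fideal J" "J \<subseteq> ints" "M = F I \<star> J" by auto
    have IG: "I \<subseteq> carrier G" "t \<in> carrier G" "insert t I \<subseteq> carrier G" using insert.prems TG by auto
    have "\<not> F I \<subseteq> t ` P"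
    proof
      assume "F I \<subseteq> t ` P"
      then obtain s where s: "s \<in> I" "s ` P \<subseteq> t ` P" using F_sub[OF IG(2) insert.hyps(1) IG(1)] by blast
      then have "inv\<^bsub>G\<^esub> t \<otimes>\<^bsub>G\<^esub> s \<in> D" using image_P_subset_image_P IG by blast
      then have "t = s" using T_unique[of t s] s(1) insert.prems by blast
      then show False using s(1) insert.hyps(2) by simp
    qed
    then have "J \<subseteq> t ` P"
      using image_P_prime_ideal[OF IG(2) F_ints[OF insert.hyps(1) IG(1)] J(2)] M_sub[OF IG(2)] J(3) by blast
    then obtain J' where J': "fideal J'" "J' \<subseteq> ints" "J = t ` P \<star> J'"
      using ideal_divides[OF fideal_image[OF IG(2) P_fideal] J(1)] by blast
    have "M = F (insert t I) \<star> J'"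
      unfolding J(3) J'(3) F_insert[OF insert.hyps IG(3)] by (metis ideal_mult_assoc ideal_mult_commute)
    then show ?case using J' by blast
  qed
  from this[OF fT] obtain J where J: "fideal J" "J \<subseteq> ints" "M = F T \<star> J" by blast
  have FT: "fideal (F T)" "F T \<subseteq> ints" using F[OF TG] F_ints[OF fT TG] by auto
  have "1 \<in> J"
  proof (rule ccontr)
    assume "1 \<notin> J"
    have "M \<subseteq> ints \<star> J" unfolding J(3) using FT(2) by (intro ideal_mult_mono) auto
    then have MJ: "M \<subseteq> J" using ideal_mult_ints(1)[OF fidealD[OF J(1)]] by simp
    have "P \<inter> K \<subseteq> J" unfolding \<pi>(3) using MJ Kints_ints by (auto simp: M_def)
    then obtain \<sigma> where "\<sigma> \<in> carrier G" "J \<subseteq> \<sigma> ` P"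
      using ideal_in_conjugate[OF fidealD[OF J(1)] J(2) \<open>1 \<notin> J\<close>] by blast
    then obtain t where t: "t \<in> T" "J \<subseteq> t ` P" using T_cover by metis
    then have tG: "t \<in> carrier G" using TG by auto
    have "F T = t ` P \<star> F (T - {t})"
      using F_insert[of "T - {t}" t] fT TG t(1) by (simp add: insert_absorb)
    moreover have "F (T - {t}) \<subseteq> ints" using F_ints[of "T - {t}"] fT TG by blast
    ultimately have "F T \<subseteq> t ` P \<star> ints" by (simp add: ideal_mult_mono)
    then have "F T \<subseteq> t ` P" using ideal_mult_ints(2)[OF image_P(1)[OF tG]] by simp
    then have "M \<subseteq> t ` P \<star> t ` P" unfolding J(3) using t(2) by (rule ideal_mult_mono)
    then have "M \<subseteq> t ` (P \<star> P)" by (simp add: image_ideal_mult[OF tG P_sub P_sub])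
    then have MPP: "(inv\<^bsub>G\<^esub> t) ` M \<subseteq> P \<star> P"
      using Gal_image_inv(1)[OF tG submodule_LD(1)[OF submodule_ideal_mult[OF P_sub P_sub]]]
        image_mono[of M "t ` (P \<star> P)" "inv\<^bsub>G\<^esub> t"] by simp
    have "(inv\<^bsub>G\<^esub> t) ` M = M"
      unfolding M_def using image_principal[of "inv\<^bsub>G\<^esub> t" \<pi>] Gal_L(2)[of "inv\<^bsub>G\<^esub> t" \<pi>] tG \<pi>K ints_L[OF \<pi>B] by simp
    with MPP have "M \<subseteq> P \<star> P" by simp
    moreover have "(\<lambda>a. w * a) ` ints \<star> P \<subseteq> M"
    proof (rule ideal_mult_least)
      fix i z assume "i \<in> (\<lambda>a. w * a) ` ints" "z \<in> P"
      then obtain a v where "a \<in> ints" "i = w * a" "v \<in> ints" "w * z = \<pi> * v" using w(3) by blast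
      then show "i * z \<in> M"
        unfolding M_def by (intro image_eqI[of _ _ "a * v"]) (auto simp: mult_ac intro: ints_closed)
    qed (rule submodule_LD(7)[OF fidealD[OF M]])
    ultimately have "(\<lambda>a. w * a) ` ints \<star> P \<subseteq> P \<star> P" by blast
    then have "((\<lambda>a. w * a) ` ints \<star> P) \<star> inverse_ideal P \<subseteq> (P \<star> P) \<star> inverse_ideal P"
      by (rule ideal_mult_mono) simp
    then have sub: "(\<lambda>a. w * a) ` ints \<star> ints \<subseteq> P \<star> ints"
      by (simp add: ideal_mult_assoc ideal_mult_inverse_ideal[OF P_fideal])
    have "(w * 1) * 1 \<in> (\<lambda>a. w * a) ` ints \<star> ints"
      by (rule ideal_mult_prod) (use ints_closed(2) in blast)+
    then have "w \<in> P" using sub ideal_mult_ints(2)[OF P_sub] by auto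
    with w(2) show False ..
  qed
  then have "J = ints" using J(2) submodule_LD(3)[OF fidealD[OF J(1)], of _ 1] by force
  then show ?thesis using J(3) ideal_mult_ints(2)[OF fidealD[OF FT(1)]] by (simp add: F_def M_def)
qed

lemma theta_prime_principal:
  assumes cn: "class_number K = 1" and unram: "unramified K L P"
    and S: "S \<in> common_product_reps G (residue_degree K L P)"
  shows "finprod (ideal_group L) (\<lambda>\<sigma>. \<sigma> ` P) S \<in> principal_ideals L"
proof -
  define f where "f = residue_degree K L P"
  obtain q \<gamma> where *: "residue_data K L P f q \<gamma>"
  proof (rule residue_structure[folded f_def], goal_cases)
    case (1 q \<gamma>)
    then show ?case
      by (intro 1(1)[of q \<gamma>] residue_data.intro galois_prime_axioms residue_data_axioms.intro)
  qed
  interpret residue_data K L P f q \<gamma> by (rule *)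
  obtain \<pi> w where \<pi>: "\<pi> \<in> K.ints" "\<pi> \<noteq> 0" "P \<inter> K = (\<lambda>a. \<pi> * a) ` K.ints"
    and w: "w \<in> ints" "w \<notin> P" "\<And>z. z \<in> P \<Longrightarrow> \<exists>v\<in>ints. w * z = \<pi> * v"
    using unramified_uniformizer[OF cn unram] by blast
  have "\<pi> * 1 \<in> P \<inter> K" unfolding \<pi>(3) using K.ints_closed(2) by blast
  then have \<pi>P: "\<pi> \<in> P" by simp
  have "D \<in> cyclic_subgroups G f"
    by (rule D_cyclic) (rule inertia_trivial[OF \<pi>(1) \<pi>P w(1,2)], use w(3) in blast)
  then have "S \<in> product_reps G (cyclic_core G f) D"
    using S by (simp add: common_product_reps_def f_def)
  then obtain T T' where T: "left_coset_reps G D T"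
    and T': "left_coset_reps (G\<lparr>carrier := D\<rparr>) (cyclic_core G f) T'" and ST: "S = T <#>\<^bsub>G\<^esub> T'"
    by (auto simp: product_reps_def)
  have TG: "T \<subseteq> carrier G" and T'D: "T' \<subseteq> D" using T T' by (auto simp: left_coset_reps_def)
  have fin: "finite T" "finite T'"
    using finite_subset[OF TG finite_Gal] finite_subset[OF T'D] finite_subset[OF _ finite_Gal, of D]
    by (auto simp: D_def)
  \<comment> \<open>Since \<open>T'\<close> lies in \<open>D\<close>, all elements of a block
    \<open>t T'\<close> send \<open>P\<close> to the same ideal; blocks for different
    \<open>t\<close> are disjoint because they lie in different cosets of \<open>D\<close>.\<close>
  have SU: "S = \<Union>((\<lambda>t. (\<lambda>u. t \<otimes>\<^bsub>G\<^esub> u) ` T') ` T)" by (auto simp: ST set_mult_def)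
  have tuP: "(t \<otimes>\<^bsub>G\<^esub> u) ` P = t ` P" if "t \<in> T" "u \<in> T'" for t u
    using that TG T'D Gal_image_mult[of t u P] P_L by (auto simp: D_def subset_eq)
  have T_unique: "s = t" if st: "s \<in> T" "t \<in> T" "u \<in> D" "v \<in> D" "s \<otimes>\<^bsub>G\<^esub> u = t \<otimes>\<^bsub>G\<^esub> v" for s t u v
  proof -
    have G: "s \<in> carrier G" "t \<in> carrier G" "u \<in> carrier G" "v \<in> carrier G"
      using st TG D_Gal by auto
    have "inv\<^bsub>G\<^esub> s \<otimes>\<^bsub>G\<^esub> t = inv\<^bsub>G\<^esub> s \<otimes>\<^bsub>G\<^esub> (t \<otimes>\<^bsub>G\<^esub> v) \<otimes>\<^bsub>G\<^esub> inv\<^bsub>G\<^esub> v" using G by (simp add: Gal.m_assoc)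
    also have "\<dots> = u \<otimes>\<^bsub>G\<^esub> inv\<^bsub>G\<^esub> v" using G by (simp add: st(5)[symmetric] Gal.m_assoc[symmetric])
    also have "\<dots> \<in> D"
      using st by (intro subgroup.m_closed[OF D_subgroup] subgroup.m_inv_closed[OF D_subgroup])
    finally show ?thesis using Gal.left_coset_reps_unique[OF T D_subgroup st(1,2)] by simp
  qed
  have P_closed': "t ` P \<in> carrier (ideal_group L)" if "t \<in> T" for t
    using fideal_image[OF _ P_fideal, of t] that TG by auto
  have inner: "finprod (ideal_group L) (\<lambda>\<sigma>. \<sigma> ` P) ((\<lambda>u. t \<otimes>\<^bsub>G\<^esub> u) ` T') =
      (t ` P) [^]\<^bsub>ideal_group L\<^esub> card T'" if t: "t \<in> T" for t
  proof -
    have inj: "inj_on (\<lambda>u. t \<otimes>\<^bsub>G\<^esub> u) T'"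
    proof (rule inj_onI)
      fix u v assume uv: "u \<in> T'" "v \<in> T'" "t \<otimes>\<^bsub>G\<^esub> u = t \<otimes>\<^bsub>G\<^esub> v"
      have "t \<in> carrier G" "u \<in> carrier G" "v \<in> carrier G"
        using t TG uv(1,2) T'D D_Gal by auto
      then show "u = v" using uv(3) by simp
    qed
    have "finprod (ideal_group L) (\<lambda>\<sigma>. \<sigma> ` P) ((\<lambda>u. t \<otimes>\<^bsub>G\<^esub> u) ` T') =
        finprod (ideal_group L) (\<lambda>\<sigma>. t ` P) ((\<lambda>u. t \<otimes>\<^bsub>G\<^esub> u) ` T')"
      by (rule IG.finprod_cong') (use tuP[OF t] P_closed'[OF t] in auto)
    also have "\<dots> = (t ` P) [^]\<^bsub>ideal_group L\<^esub> card ((\<lambda>u. t \<otimes>\<^bsub>G\<^esub> u) ` T')"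
      by (rule IG.finprod_const[OF P_closed'[OF t]])
    finally show ?thesis unfolding card_image[OF inj] .
  qed
  have "finprod (ideal_group L) (\<lambda>\<sigma>. \<sigma> ` P) S =
      finprod (ideal_group L) (\<lambda>t. finprod (ideal_group L) (\<lambda>\<sigma>. \<sigma> ` P) ((\<lambda>u. t \<otimes>\<^bsub>G\<^esub> u) ` T')) T"
    unfolding SU
  proof (rule IG.finprod_UN_disjoint[OF fin(1)])
    show "pairwise (\<lambda>i j. disjnt ((\<otimes>\<^bsub>G\<^esub>) i ` T') ((\<otimes>\<^bsub>G\<^esub>) j ` T')) T"
    proof (rule pairwiseI)
      fix s t assume st: "s \<in> T" "t \<in> T" "s \<noteq> t"
      have "s \<otimes>\<^bsub>G\<^esub> u \<noteq> t \<otimes>\<^bsub>G\<^esub> v" if "u \<in> T'" "v \<in> T'" for u v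
        using T_unique[OF st(1,2), of u v] st(3) that T'D by auto
      then show "disjnt ((\<otimes>\<^bsub>G\<^esub>) s ` T') ((\<otimes>\<^bsub>G\<^esub>) t ` T')"
        unfolding disjnt_iff by auto
    qed
    show "x ` P \<in> carrier (ideal_group L)" if "t \<in> T" "x \<in> (\<otimes>\<^bsub>G\<^esub>) t ` T'" for t x
      using that tuP P_closed' by auto
  qed (use fin in auto)
  also have "\<dots> = finprod (ideal_group L) (\<lambda>t. (t ` P) [^]\<^bsub>ideal_group L\<^esub> card T') T"
    by (rule IG.finprod_cong') (use inner P_closed' IG.nat_pow_closed in \<open>auto simp del: ideal_group_simps\<close>)
  \<comment> \<open>Induction over an arbitrary exponent in place of \<open>card T'\<close>; each
    step multiplies by the product of the conjugates, which is \<open>(\<pi>)\<close>.\<close>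
  also have "finprod (ideal_group L) (\<lambda>t. (t ` P) [^]\<^bsub>ideal_group L\<^esub> n) T \<in> principal_ideals L" for n :: nat
  proof (induction n)
    case 0
    have "finprod (ideal_group L) (\<lambda>t. (t ` P) [^]\<^bsub>ideal_group L\<^esub> (0::nat)) T = \<one>\<^bsub>ideal_group L\<^esub>"
      by (rule IG.finprod_one_eqI) simp
    then show ?case using PI.one_closed by metis
  next
    case (Suc n)
    have "finprod (ideal_group L) (\<lambda>t. (t ` P) [^]\<^bsub>ideal_group L\<^esub> Suc n) T =
        finprod (ideal_group L) (\<lambda>t. (t ` P) [^]\<^bsub>ideal_group L\<^esub> n) T \<otimes>\<^bsub>ideal_group L\<^esub>
        finprod (ideal_group L) (\<lambda>t. t ` P) T"
      unfolding nat_pow_Suc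
      by (rule IG.finprod_multf) (use P_closed' IG.nat_pow_closed in blast)+
    moreover have "finprod (ideal_group L) (\<lambda>t. t ` P) T = (\<lambda>a. \<pi> * a) ` ints"
      by (rule prime_factorization[OF \<pi> w(1,2) _ T]) (rule w(3))
    then have "finprod (ideal_group L) (\<lambda>t. t ` P) T \<in> principal_ideals L"
      unfolding principal_ideals_eq using \<pi>(1,2) by (auto simp: Kints_iff K_L)
    ultimately show ?case using PI.m_closed[OF Suc.IH] by metis
  qed
  finally show ?thesis .
qed

end

section \<open>From unramified primes to all ideals\<close>

context galois_ext
begin

text \<open>The action of \<open>theta S\<close> as a product over \<open>S\<close> itself, without
  the exponents 0 and 1 of the group ring element; \<open>group_ring_act_theta\<close> is the
  link.\<close>

definition theta_act :: "('a \<Rightarrow> 'a) set \<Rightarrow> 'a set \<Rightarrow> 'a set" where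
  "theta_act S I = finprod (ideal_group L) (\<lambda>\<sigma>. \<sigma> ` I) S"

lemma image_closed:
  "S \<subseteq> carrier G \<Longrightarrow> fideal I \<Longrightarrow> (\<lambda>\<sigma>. \<sigma> ` I) \<in> S \<rightarrow> carrier (ideal_group L)"
  using fideal_image by auto

lemma theta_act_hom:
  assumes S: "S \<subseteq> carrier G"
  shows "group_hom (ideal_group L) (ideal_group L) (theta_act S)"
proof (unfold_locales, rule homI)
  show "theta_act S I \<in> carrier (ideal_group L)" if "I \<in> carrier (ideal_group L)" for I
    unfolding theta_act_def using that by (intro IG.finprod_closed image_closed S) simp
  fix I J assume "I \<in> carrier (ideal_group L)" "J \<in> carrier (ideal_group L)"
  then have IJ: "fideal I" "fideal J" by auto
  have "theta_act S (I \<star> J) = finprod (ideal_group L) (\<lambda>\<sigma>. \<sigma> ` I \<otimes>\<^bsub>ideal_group L\<^esub> \<sigma> ` J) S"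
    unfolding theta_act_def
  proof (rule IG.finprod_cong')
    show "(\<lambda>\<sigma>. \<sigma> ` I \<otimes>\<^bsub>ideal_group L\<^esub> \<sigma> ` J) \<in> S \<rightarrow> carrier (ideal_group L)"
      using S IJ by (auto intro!: fideal_mult fideal_image)
    show "\<sigma> ` (I \<star> J) = \<sigma> ` I \<otimes>\<^bsub>ideal_group L\<^esub> \<sigma> ` J" if "\<sigma> \<in> S" for \<sigma>
      using image_ideal_mult[of \<sigma> I J] that S IJ by (auto dest: fidealD)
  qed simp
  also have "\<dots> = theta_act S I \<otimes>\<^bsub>ideal_group L\<^esub> theta_act S J"
    unfolding theta_act_def by (intro IG.finprod_multf image_closed S IJ)
  finally show "theta_act S (I \<otimes>\<^bsub>ideal_group L\<^esub> J) = theta_act S I \<otimes>\<^bsub>ideal_group L\<^esub> theta_act S J"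
    by simp
qed

lemma theta_act_principal:
  assumes S: "S \<subseteq> carrier G" and I: "I \<in> principal_ideals L"
  shows "theta_act S I \<in> principal_ideals L"
proof -
  obtain x where x: "x \<in> L" "x \<noteq> 0" "I = (\<lambda>a. x * a) ` ints" using I by (auto simp: principal_ideals_eq)
  have "finite S" using finite_subset[OF S finite_Gal] .
  then show ?thesis
    unfolding theta_act_def using S
  proof (induction S rule: finite_induct)
    case empty
    then show ?case using ints_principal by simp
  next
    case (insert \<sigma> S)
    then have s: "\<sigma> \<in> carrier G" by simp
    have "\<sigma> ` I = (\<lambda>a. \<sigma> x * a) ` ints" unfolding x(3) by (rule image_principal[OF s x(1)])
    then have "\<sigma> ` I \<in> principal_ideals L"
      unfolding principal_ideals_eq using Gal_L(1)[OF s x(1)] Gal_eq_0_iff[OF s x(1)] x(2) by blast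
    moreover have "(\<lambda>\<sigma>. \<sigma> ` I) \<in> insert \<sigma> S \<rightarrow> carrier (ideal_group L)"
      using insert.prems I PI.subset by (intro image_closed) auto
    then have "finprod (ideal_group L) (\<lambda>\<sigma>. \<sigma> ` I) (insert \<sigma> S) =
        \<sigma> ` I \<otimes>\<^bsub>ideal_group L\<^esub> finprod (ideal_group L) (\<lambda>\<sigma>. \<sigma> ` I) S"
      by (intro IG.finprod_insert insert.hyps) auto
    ultimately show ?case using PI.m_closed insert by simp
  qed
qed

lemma group_ring_act_theta:
  assumes S: "S \<subseteq> carrier G" and I: "fideal I"
  shows "group_ring_act K L (theta S) I = theta_act S I"
proof -
  have fS: "finite S" using finite_subset[OF S finite_Gal] .
  have look: "Poly_Mapping.lookup (theta S) \<sigma> = (if \<sigma> \<in> S then 1 else 0)" for \<sigma>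
    using fS by (simp add: theta_def lookup_sum lookup_single when_def)
  have "group_ring_act K L (theta S) I =
      finprod (ideal_group L) (\<lambda>\<sigma>. if \<sigma> \<in> S then \<sigma> ` I else \<one>\<^bsub>ideal_group L\<^esub>) (carrier G)"
    unfolding group_ring_act_def
  proof (rule IG.finprod_cong')
    show "(\<lambda>\<sigma>. if \<sigma> \<in> S then \<sigma> ` I else \<one>\<^bsub>ideal_group L\<^esub>) \<in> carrier G \<rightarrow> carrier (ideal_group L)"
      using I fideal_image fideal_ints by auto
    show "\<sigma> ` I [^]\<^bsub>ideal_group L\<^esub> Poly_Mapping.lookup (theta S) \<sigma> =
        (if \<sigma> \<in> S then \<sigma> ` I else \<one>\<^bsub>ideal_group L\<^esub>)" if "\<sigma> \<in> carrier G" for \<sigma>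
      using IG.int_pow_1[of "\<sigma> ` I"] fideal_image[OF that I] by (simp add: look)
  qed simp
  also have "\<dots> = theta_act S I"
    unfolding theta_act_def
    by (rule IG.finprod_mono_neutral_cong_right[OF finite_Gal S])
      (use I fideal_image fideal_ints in auto)
  finally show ?thesis .
qed

text \<open>\<open>theta_act S\<close> is a homomorphism preserving principal ideals, so the classes
  whose members it all makes principal are closed under products and inverses; the generating prime
  classes are among them.\<close>

lemma theta_annihilates:
  assumes cn: "class_number K = 1" and f: "f \<in> generating_degrees K L"
    and S: "S \<in> common_product_reps G f" and I: "fideal I"
  shows "theta_act S I \<in> principal_ideals L"
proof -
  have SG: "S \<subseteq> carrier G" using S by (simp add: common_product_reps_def)
  interpret T: group_hom "ideal_group L" "ideal_group L" "theta_act S" by (rule theta_act_hom[OF SG])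
  define H where "H = {ideal_class L P | P. prime_of L P \<and> unramified K L P \<and> residue_degree K L P = f}"
  have gen: "generate (class_group L) H = carrier (class_group L)"
    using f by (simp add: generating_degrees_def H_def)
  \<comment> \<open>The property speaks of all members of a coset, because products and inverses in
    the quotient group are formed elementwise; \<open>fideal J\<close> is kept so that the
    homomorphism laws apply.\<close>
  have H: "\<forall>J\<in>h. fideal J \<and> theta_act S J \<in> principal_ideals L" if h: "h \<in> H" for h
  proof
    fix J assume J: "J \<in> h"
    obtain P where P: "prime_of L P" "unramified K L P" "residue_degree K L P = f" "h = ideal_class L P"
      using h by (auto simp: H_def)
    interpret galois_prime K L P by unfold_locales (rule P(1))
    obtain M where M: "M \<in> principal_ideals L" "J = M \<star> P"
      using J P(4) by (auto simp: ideal_class_def r_coset_def)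
    have Mf: "fideal M" using M(1) PI.subset by auto
    have "theta_act S J = theta_act S M \<star> theta_act S P"
      using T.hom_mult[of M P] Mf P_fideal M(2) by simp
    moreover have "theta_act S P \<in> principal_ideals L"
      unfolding theta_act_def by (rule theta_prime_principal[OF cn P(2)]) (use S P(3) in simp)
    ultimately show "fideal J \<and> theta_act S J \<in> principal_ideals L"
      using PI.m_closed[OF theta_act_principal[OF SG M(1)], of "theta_act S P"] fideal_mult[OF Mf P_fideal] M(2)
      by simp
  qed
  have HC: "H \<subseteq> carrier (class_group L)" using generate.incl[of _ H "class_group L"] gen by blast
  have main: "\<forall>J\<in>X'. fideal J \<and> theta_act S J \<in> principal_ideals L" if "X' \<in> generate (class_group L) H" for X'
    using that
  proof (induction rule: generate.induct)
    case one
    then show ?case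
      using theta_act_principal[OF SG] PI.subset by (auto simp: class_group_def)
  next
    case (incl h)
    then show ?case by (rule H)
  next
    case (inv h)
    then have "inv\<^bsub>class_group L\<^esub> h = set_inv\<^bsub>ideal_group L\<^esub> h"
      using HC PI.inv_FactGroup[of h] by (auto simp: class_group_def)
    moreover have "theta_act S (inv\<^bsub>ideal_group L\<^esub> J) \<in> principal_ideals L \<and> fideal (inv\<^bsub>ideal_group L\<^esub> J)"
      if "J \<in> h" for J
      using H[OF inv] that T.hom_inv[of J] PI.m_inv_closed IG.inv_closed[of J] by simp
    ultimately show ?case by (auto simp: SET_INV_def)
  next
    case (eng h1 h2)
    have "theta_act S (I \<star> J) \<in> principal_ideals L \<and> fideal (I \<star> J)" if "I \<in> h1" "J \<in> h2" for I J
      using eng.IH that T.hom_mult[of I J] PI.m_closed[of "theta_act S I" "theta_act S J"] fideal_mult[of I J] by simp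
    then show ?case by (auto simp: class_group_def FactGroup_def set_mult_def)
  qed
  have "ideal_class L I \<in> carrier (class_group L)"
    using I by (auto simp: ideal_class_def class_group_def carrier_FactGroup)
  moreover have "I \<in> ideal_class L I"
    using IG.rcos_self[OF _ subgroup_principal_ideals, of I] I by (simp add: ideal_class_def)
  ultimately show ?thesis using main gen by blast
qed

end

theorem theorem1p2:
  fixes K L :: "'a::field_char_0 set"
    and f :: nat
    and S :: "('a \<Rightarrow> 'a) set"
  assumes "number_field K" and "number_field L"
    and "galois_extension K L"
    and "f \<in> generating_degrees K L"
    and "S \<in> common_product_reps (Gal K L) f"
    and "class_number K = 1"
  shows "\<forall>I\<in>carrier (ideal_group L). group_ring_act K L (theta S) I \<in> principal_ideals L"
proof
  fix I assume I: "I \<in> carrier (ideal_group L)"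
  interpret nfield L by unfold_locales (rule assms(2))
  show "group_ring_act K L (theta S) I \<in> principal_ideals L"
  proof (cases "finite (carrier (Gal K L))")
    case True
    interpret galois_ext K L
      by unfold_locales (use assms True in auto)
    have SG: "S \<subseteq> carrier (Gal K L)" using assms(5) by (simp add: common_product_reps_def)
    show ?thesis
      using theta_annihilates[OF assms(6,4,5)] group_ring_act_theta[OF SG] I by simp
  next
    \<comment> \<open>The Galois group is in fact finite, but products over an infinite set are \<open>\<one>\<close> by convention,
      so this need not be proved.\<close>
    case False
    then show ?thesis
      using ints_principal by (simp add: group_ring_act_def)
  qed
qed

end
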